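(* Let $\zeta\colon[0,\infty)\to[0,\infty)$ be concave with $\lim_{t\to0}\zeta(t)=0$ and $\lim_{t\to\infty}\zeta(t)/t=0$. For $u\in\mathrm{Conv}_{cd,L}(\mathbb{R}^n)$ set $$\operatorname{Z}(u)=\int_{\operatorname{dom}(u)}\zeta\big(\det(\operatorname{Hess}u(x))\big)\,dx .$$ Then $\operatorname{Z}(u)$ is finite for every $u\in\mathrm{Conv}_{cd,L}(\mathbb{R}^n)$, and $$\operatorname{Z}(u)\ge\limsup_{k\to\infty}\operatorname{Z}(u_k)$$ for every sequence $u_k\in\mathrm{Conv}_{cd,L}(\mathbb{R}^n)$ that epi-converges to $u\in\mathrm{Conv}_{cd,L}(\mathbb{R}^n)$ and whose Lipschitz constants are uniformly bounded, i.e. there is $M>0$ such that each $u_k$ is $M$-Lipschitz on the interior of its domain.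
   Context: $\mathrm{Conv}(\mathbb{R}^n)$ denotes the set of functions $u\colon\mathbb{R}^n\to(-\infty,\infty]$ that are convex, lower semicontinuous and not identically $\infty$; $\operatorname{dom}(u)=\{x:u(x)<\infty\}$. $\mathrm{Conv}_{cd,L}(\mathbb{R}^n)$ is the set of $u\in\mathrm{Conv}(\mathbb{R}^n)$ such that $\operatorname{dom}(u)$ is compact and $u$ is Lipschitz on the interior of $\operatorname{dom}(u)$. By Aleksandrov's theorem a convex function is twice differentiable almost everywhere on the interior of its domain; $\operatorname{Hess}u(x)$ denotes the Hessian there, and $\det(\operatorname{Hess}u(x))$ is set to $0$ at points where $u$ is not twice differentiable. $dx$ is Lebesgue measure on $\mathbb{R}^n$. A sequence $u_k$ epi-converges to $u$ if for every sequence $x_k\to x$ one has $u(x)\le\liminf_k u_k(x_k)$, and for every $x$ there is a sequence $x_k\to x$ with $u(x)=\lim_k u_k(x_k)$. *)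

theory Defs
  imports "HOL-Analysis.Analysis"
begin

definition edom :: "(real^'n::finite \<Rightarrow> ereal) \<Rightarrow> (real^'n) set" where
  "edom u = {x. u x < \<infinity>}"

definition conv_fun :: "(real^'n::finite \<Rightarrow> ereal) \<Rightarrow> bool" where
  "conv_fun u \<longleftrightarrow>
     (\<forall>x. u x \<noteq> -\<infinity>) \<and> (\<exists>x. u x \<noteq> \<infinity>) \<and>
     convex (edom u) \<and> convex_on (edom u) (\<lambda>x. real_of_ereal (u x)) \<and>
     (\<forall>x. u x \<le> Liminf (at x) u)"

definition conv_cdL :: "(real^'n::finite \<Rightarrow> ereal) \<Rightarrow> bool" where
  "conv_cdL u \<longleftrightarrow> conv_fun u \<and> compact (edom u) \<and>
     (\<exists>L. L-lipschitz_on (interior (edom u)) (\<lambda>x. real_of_ereal (u x)))"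

definition has_hessian_at :: "(real^'n::finite \<Rightarrow> ereal) \<Rightarrow> real^'n^'n \<Rightarrow> real^'n \<Rightarrow> bool" where
  "has_hessian_at u H x \<longleftrightarrow> x \<in> interior (edom u) \<and> transpose H = H \<and>
     (\<exists>g::real^'n. ((\<lambda>y. (real_of_ereal (u y) - real_of_ereal (u x) - g \<bullet> (y - x)
          - (1/2) * ((y - x) \<bullet> (H *v (y - x)))) / (norm (y - x))^2) \<longlongrightarrow> 0) (at x))"

definition det_hess :: "(real^'n::finite \<Rightarrow> ereal) \<Rightarrow> real^'n \<Rightarrow> real" where
  "det_hess u x = (if \<exists>H. has_hessian_at u H x then det (THE H. has_hessian_at u H x) else 0)"

definition epi_converges :: "(nat \<Rightarrow> real^'n::finite \<Rightarrow> ereal) \<Rightarrow> (real^'n \<Rightarrow> ereal) \<Rightarrow> bool" where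
  "epi_converges us u \<longleftrightarrow>
     (\<forall>x xs. xs \<longlonglongrightarrow> x \<longrightarrow> u x \<le> liminf (\<lambda>k. us k (xs k))) \<and>
     (\<forall>x. \<exists>xs. xs \<longlonglongrightarrow> x \<and> (\<lambda>k. us k (xs k)) \<longlonglongrightarrow> u x)"

definition Zfun :: "(real \<Rightarrow> real) \<Rightarrow> (real^'n::finite \<Rightarrow> ereal) \<Rightarrow> ennreal" where
  "Zfun \<zeta> u = (\<integral>\<^sup>+ x \<in> edom u. ennreal (\<zeta> (det_hess u x)) \<partial>lebesgue)"

end

theory Submission
  imports Defs
begin

text \<open>Let \<open>u\<close> be the limit and extend everything to convex \<open>M\<close>-Lipschitz functions on the whole space. By
  Aleksandrov's theorem almost every point \<open>x\<close> of the interior of the domain admits a second order expansion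
  of \<open>u\<close>, which forces the subgradients of every convex function that is uniformly close to \<open>u\<close> on a small
  ball \<open>B\<close> around \<open>x\<close> into a set of measure at most \<open>(det (Hess u(x)) + \<tau>) |B|\<close>. The area formula for the
  gradient map bounds the integral of \<open>det (Hess u\<^sub>k)\<close> over \<open>B\<close> by this measure, and Jensen's inequality for
  the concave function \<open>\<zeta>\<close> compares the energy of \<open>u\<^sub>k\<close> on \<open>B\<close> with that of \<open>u\<close>. Finitely many such balls
  exhaust the domain up to a set of small measure by Vitali's theorem. What is left is negligible uniformly in
  \<open>k\<close>: all gradients lie in a ball of radius \<open>M\<close>, so the integrals of \<open>det (Hess u\<^sub>k)\<close> are bounded, and
  \<open>\<zeta>\<close> is sublinear.

  Aleksandrov's theorem itself follows Mignot: Rademacher's theorem applies to the proximal map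
  \<open>(I + \<partial>v)\<inverse>\<close>, which is onto and 1-Lipschitz, and at the image of a point where this map has an
  invertible derivative \<open>v\<close> has a second order expansion; by Sard's lemma these images have full measure.\<close>

section \<open>Vitali coverings and Lebesgue points\<close>

text \<open>Only an upper bound is wanted, and there concavity of \<zeta> points the right way:
  spreading the determinant evenly over a ball can only increase the energy, and the even level is
  capped by the volume of a set containing the subgradients, which uniform closeness to a quadratic
  function suffices to control. The cap uses det + \<tau> with \<tau> > 0 for two reasons: the
  subgradients are confined to a thickened ellipsoid rather than an ellipsoid, and \<zeta> may have
  infinite slope at 0, so that tangents are taken at positive levels only. The uniform Lipschitz
  constant does more than bound the gradients. Epi-convergence by itself does not keep the domains
  near the limit domain \<open>K\<close>: the functions k dist(x,K), restricted to a larger ball,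
  epi-converge to 0 on \<open>K\<close> and \<infinity> elsewhere, while their domains stay too
  large.\<close>

lemma Vitali_centered_cballs:
  fixes S :: "'a::euclidean_space set"
  assumes "open U" "S \<subseteq> U"
    and P: "\<And>x d. x \<in> S \<Longrightarrow> 0 < d \<Longrightarrow> \<exists>r. 0 < r \<and> r < d \<and> P x r"
  obtains C where "countable C" "\<And>x r. (x, r) \<in> C \<Longrightarrow> x \<in> S \<and> 0 < r \<and> P x r \<and> cball x r \<subseteq> U"
    "disjoint_family_on (\<lambda>p. cball (fst p) (snd p)) C"
    "negligible (S - (\<Union>p\<in>C. cball (fst p) (snd p)))"
proof -
  define K where "K = {p. fst p \<in> S \<and> 0 < snd p \<and> P (fst p) (snd p) \<and> cball (fst p) (snd p) \<subseteq> U}"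
  have r: "\<And>i. i \<in> K \<Longrightarrow> 0 < snd i" by (auto simp: K_def)
  have ex: "\<exists>i. i \<in> K \<and> x \<in> cball (fst i) (snd i) \<and> snd i < d" if x: "x \<in> S" and d: "0 < d" for x d
  proof -
    obtain e where e: "e > 0" "cball x e \<subseteq> U"
      using assms(1,2) x open_contains_cball_eq[of U] by blast
    obtain r where "0 < r" "r < min d e" "P x r"
      using P[OF x, of "min d e"] e(1) d by auto
    moreover have "cball x r \<subseteq> U" using e(2) \<open>r < min d e\<close> subset_cball[of r e x] by auto
    ultimately show ?thesis using x by (intro exI[of _ "(x, r)"]) (simp add: K_def)
  qed
  obtain C where C: "countable C" "C \<subseteq> K"
     "pairwise (\<lambda>i j. disjnt (cball (fst i) (snd i)) (cball (fst j) (snd j))) C"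
     "negligible(S - (\<Union>i \<in> C. cball (fst i) (snd i)))"
    by (rule Vitali_covering_theorem_cballs[where K=K and S=S and a=fst and r=snd, OF r ex]) (assumption | rule that)+
  show ?thesis
  proof
    show "disjoint_family_on (\<lambda>p. cball (fst p) (snd p)) C"
      using C(3) by (auto simp: disjoint_family_on_def pairwise_def disjnt_def)
    show "x \<in> S \<and> 0 < r \<and> P x r \<and> cball x r \<subseteq> U" if "(x, r) \<in> C" for x r
      using subsetD[OF C(2) that] by (simp add: K_def)
  qed (use C in simp_all)
qed

declare emeasure_completion [simp del]

lemma emeasure_lebesgue_cball:
  "emeasure lebesgue (cball (x::'a::euclidean_space) r) = ennreal (measure lebesgue (cball x r))"
  using fmeasurableD2[OF lmeasurable_cball[of x r]] by (intro emeasure_eq_ennreal_measure) auto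

text \<open>Balls in which the density has too much mass are selected inside an open
  \<open>U\<close> around the zero set \<open>A\<close>. All their mass sits in
  \<open>U - A\<close>, where it is at most \<open>D\<close> times an arbitrarily small volume, so
  the selected balls, and with them the bad points, occupy little volume.\<close>

lemma AE_density_zero:
  fixes g :: "'a::euclidean_space \<Rightarrow> ennreal"
  assumes g[measurable]: "g \<in> borel_measurable lebesgue" and le: "\<And>x. g x \<le> ennreal C" and "0 < c"
  shows "AE x in lebesgue. g x = 0 \<longrightarrow> (\<exists>\<rho>>0. \<forall>r. 0 < r \<and> r < \<rho> \<longrightarrow>
           emeasure (density lebesgue g) (cball x r) \<le> ennreal c * emeasure lebesgue (cball x r))"
proof -
  define \<nu> where "\<nu> = density lebesgue g"
  have sets[simp]: "sets \<nu> = sets lebesgue" by (simp add: \<nu>_def)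
  define Q where "Q x \<longleftrightarrow> (\<exists>\<rho>>0. \<forall>r. 0 < r \<and> r < \<rho> \<longrightarrow>
           emeasure \<nu> (cball x r) \<le> ennreal c * emeasure lebesgue (cball x r))" for x
  define D where "D = max C 1"
  have D: "D > 0" "\<And>x. g x \<le> ennreal D" 
    using le by (auto simp: D_def intro: order_trans[OF le] ennreal_leI)
  have "negligible {x. g x = 0 \<and> \<not> Q x \<and> norm x < real m}" for m :: nat
  proof -
    define N where "N = {x. g x = 0 \<and> \<not> Q x \<and> norm x < real m}"
    define A where "A = {x. g x = 0} \<inter> ball 0 (real m)"
    have "{x \<in> space lebesgue. g x = 0} \<in> sets lebesgue" by measurable
    then have A: "A \<in> sets lebesgue" unfolding A_def by (intro sets.Int) auto
    have NA: "N \<subseteq> A" by (auto simp: N_def A_def)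
    have "\<exists>T. N \<subseteq> T \<and> T \<in> lmeasurable \<and> measure lebesgue T \<le> e" if e0: "e > 0" for e
    proof -
      \<comment> \<open>The tolerance is set by the chain below: \<open>c\<close> times the volume
        of the balls is at most \<open>D\<close> times that of \<open>U - A\<close>, hence at most
        \<open>c * e\<close>.\<close>
      obtain U where U: "open U" "A \<subseteq> U" "U - A \<in> lmeasurable" "emeasure lebesgue (U - A) < ennreal (e * c / D)"
        by (rule sets_lebesgue_outer_open[OF A, of "e * c / D"]) (use e0 \<open>0 < c\<close> D(1) in auto)
      have ex: "\<exists>r. 0 < r \<and> r < d \<and> emeasure \<nu> (cball x r) > ennreal c * emeasure lebesgue (cball x r)"
        if "x \<in> N" "0 < d" for x d
        using that by (auto simp: N_def Q_def not_le)
      obtain K where K: "countable K"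
        "\<And>x r. (x, r) \<in> K \<Longrightarrow> x \<in> N \<and> 0 < r \<and> emeasure \<nu> (cball x r) > ennreal c * emeasure lebesgue (cball x r) \<and> cball x r \<subseteq> U"
        "disjoint_family_on (\<lambda>p. cball (fst p) (snd p)) K"
        "negligible (N - (\<Union>p\<in>K. cball (fst p) (snd p)))"
        by (rule Vitali_centered_cballs[where P="\<lambda>x r. emeasure \<nu> (cball x r) > ennreal c * emeasure lebesgue (cball x r)",
              OF U(1) order_trans[OF NA U(2)] ex]) (assumption | rule that)+
      have K2: "fst p \<in> N" "ennreal c * emeasure lebesgue (cball (fst p) (snd p)) < emeasure \<nu> (cball (fst p) (snd p))"
          "cball (fst p) (snd p) \<subseteq> U" if "p \<in> K" for p
        using K(2)[of "fst p" "snd p"] that by auto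
      let ?W = "\<Union>p\<in>K. cball (fst p) (snd p)"
      have W: "?W \<in> sets lebesgue" using K(1) by (intro sets.countable_UN') auto
      have U': "U \<in> sets lebesgue" using U(1) by auto
      have "ennreal c * emeasure lebesgue ?W = (\<integral>\<^sup>+p. ennreal c * emeasure lebesgue (cball (fst p) (snd p)) \<partial>count_space K)"
        by (subst emeasure_UN_countable[OF _ K(1) K(3)]) (auto simp: nn_integral_cmult)
      also have "\<dots> \<le> (\<integral>\<^sup>+p. emeasure \<nu> (cball (fst p) (snd p)) \<partial>count_space K)"
        by (intro nn_integral_mono less_imp_le K2) auto
      also have "\<dots> = emeasure \<nu> ?W"
        by (subst emeasure_UN_countable[OF _ K(1) K(3)]) auto
      also have "\<dots> \<le> emeasure \<nu> U"
        using U' by (intro emeasure_mono UN_least K2) auto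
      also have "\<dots> = (\<integral>\<^sup>+x. g x * indicator U x \<partial>lebesgue)"
        unfolding \<nu>_def by (intro emeasure_density) (use U' in auto)
      also have "\<dots> \<le> (\<integral>\<^sup>+x. ennreal D * indicator (U - A) x \<partial>lebesgue)"
        using D(2) by (intro nn_integral_mono) (auto simp: A_def indicator_def)
      also have "\<dots> = ennreal D * emeasure lebesgue (U - A)"
        using U(3) by (intro nn_integral_cmult_indicator) auto
      also have "\<dots> \<le> ennreal D * ennreal (e * c / D)" by (intro mult_left_mono less_imp_le[OF U(4)]) auto
      also have "\<dots> = ennreal c * ennreal e" using D e0 \<open>0 < c\<close> by (simp add: ennreal_mult[symmetric] mult.commute)
      finally have *: "emeasure lebesgue ?W \<le> ennreal e"
        using \<open>0 < c\<close> by (subst (asm) ennreal_mult_le_mult_iff) (auto simp: ennreal_eq_0_iff)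
      let ?T = "?W \<union> (N - ?W)"
      have n: "N - ?W \<in> null_sets lebesgue" using K(4) by (simp add: negligible_iff_null_sets)
      have T: "emeasure lebesgue ?T \<le> ennreal e"
        unfolding emeasure_Un_null_set[OF W n] by (rule *)
      have "?T \<in> sets lebesgue" by (intro sets.Un W null_setsD2[OF n])
      then have "?T \<in> lmeasurable" using T by (intro fmeasurableI) (auto elim: le_less_trans simp del: Un_Diff_cancel)
      moreover have "measure lebesgue ?T \<le> e" using T e0 unfolding measure_def
        by (intro enn2real_leI) auto
      moreover have "N \<subseteq> ?T" by blast
      ultimately show ?thesis by (intro exI[of _ ?T] conjI)
    qed
    then show ?thesis unfolding N_def[symmetric] negligible_outer_le by blast
  qed
  then have neg: "negligible (\<Union>m. {x. g x = 0 \<and> \<not> Q x \<and> norm x < real m})"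
    by (intro negligible_countable_Union) auto
  have "{x. \<not> (g x = 0 \<longrightarrow> Q x)} \<subseteq> (\<Union>m. {x. g x = 0 \<and> \<not> Q x \<and> norm x < real m})"
    using reals_Archimedean2 by auto
  then have "AE x in lebesgue. g x = 0 \<longrightarrow> Q x"
    unfolding eventually_ae_filter_negligible using neg by (intro exI conjI)
  then show ?thesis unfolding Q_def \<nu>_def .
qed

lemma AE_Lebesgue_lower:
  fixes h :: "'a::euclidean_space \<Rightarrow> real"
  assumes h[measurable]: "h \<in> borel_measurable lebesgue" and nn: "\<And>x. 0 \<le> h x"
  shows "AE x in lebesgue. \<forall>e>0. \<exists>\<rho>>0. \<forall>r. 0 < r \<and> r < \<rho> \<longrightarrow>
           (\<forall>S\<in>sets lebesgue. S \<subseteq> cball x r \<longrightarrow>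
             ennreal (h x * measure lebesgue S - e * measure lebesgue (cball x r)) \<le> emeasure (density lebesgue (\<lambda>y. ennreal (h y))) S)"
proof -
  let ?g = "\<lambda>a x. ennreal (a - h x)"
  have dens: "AE x in lebesgue. ?g a x = 0 \<longrightarrow> (\<exists>\<rho>>0. \<forall>r. 0 < r \<and> r < \<rho> \<longrightarrow>
           emeasure (density lebesgue (?g a)) (cball x r) \<le> ennreal c * emeasure lebesgue (cball x r))"
    if "c \<in> \<rat> \<inter> {0<..}" for a c
    by (rule AE_density_zero[where C=a]) (use that in \<open>auto intro!: ennreal_leI simp: nn\<close>)
  have "AE x in lebesgue. \<forall>a\<in>\<rat>. \<forall>c\<in>\<rat>\<inter>{0<..}. ?g a x = 0 \<longrightarrow> (\<exists>\<rho>>0. \<forall>r. 0 < r \<and> r < \<rho> \<longrightarrow>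
           emeasure (density lebesgue (?g a)) (cball x r) \<le> ennreal c * emeasure lebesgue (cball x r))"
    using countable_rat
    by (intro AE_ball_countable' dens) auto
  then show ?thesis
  proof (eventually_elim, intro allI impI)
    fix x and e :: real assume ae: "\<forall>a\<in>\<rat>. \<forall>c\<in>\<rat>\<inter>{0<..}. ?g a x = 0 \<longrightarrow> (\<exists>\<rho>>0. \<forall>r. 0 < r \<and> r < \<rho> \<longrightarrow>
           emeasure (density lebesgue (?g a)) (cball x r) \<le> ennreal c * emeasure lebesgue (cball x r))" and "e > 0"
    obtain c where c: "c \<in> \<rat>" "0 < c" "c < e/2" using Rats_dense_in_real[of 0 "e/2"] \<open>e > 0\<close> by auto
    obtain a where a: "a \<in> \<rat>" "h x - e/2 < a" "a < h x" using Rats_dense_in_real[of "h x - e/2" "h x"] \<open>e > 0\<close> by auto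
    obtain \<rho> where \<rho>: "\<rho> > 0" "\<And>r. 0 < r \<Longrightarrow> r < \<rho> \<Longrightarrow> emeasure (density lebesgue (?g a)) (cball x r) \<le> ennreal c * emeasure lebesgue (cball x r)"
      using ae[rule_format, of a c] a c by (auto simp: ennreal_eq_0_iff)
    have "ennreal (h x * measure lebesgue S - e * measure lebesgue (cball x r)) \<le> emeasure (density lebesgue (\<lambda>y. ennreal (h y))) S"
      if r: "0 < r" "r < \<rho>" and S[measurable]: "S \<in> sets lebesgue" and sub: "S \<subseteq> cball x r" for r S
    proof -
      have [measurable]: "cball x r \<in> sets lebesgue" by simp
      let ?s = "measure lebesgue S" and ?b = "measure lebesgue (cball x r)"
      let ?X = "emeasure (density lebesgue (\<lambda>y. ennreal (h y))) S"
      have Sl: "S \<in> lmeasurable" using S sub by (meson bounded_cball bounded_set_imp_lmeasurable bounded_subset)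
      have sb: "?s \<le> ?b" using sub S by (intro measure_mono_fmeasurable) auto
      have "ennreal (a * ?s) = ennreal a * emeasure lebesgue S"
        using Sl by (simp add: ennreal_mult'' emeasure_eq_measure2)
      also have "\<dots> = (\<integral>\<^sup>+y. ennreal a * indicator S y \<partial>lebesgue)"
        by (subst nn_integral_cmult_indicator) auto
      also have "\<dots> \<le> (\<integral>\<^sup>+y. ennreal (h y) * indicator S y + ?g a y * indicator (cball x r) y \<partial>lebesgue)"
      proof (intro nn_integral_mono)
        fix y
        have "ennreal a \<le> ennreal (h y) + ennreal (a - h y)"
          using nn[of y] by (cases "a \<le> h y") (auto simp: ennreal_leI ennreal_plus[symmetric] ennreal_neg simp del: ennreal_plus)
        then show "ennreal a * indicator S y \<le> ennreal (h y) * indicator S y + ?g a y * indicator (cball x r) y"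
          using sub by (auto simp: indicator_def)
      qed
      also have "\<dots> = ?X + emeasure (density lebesgue (?g a)) (cball x r)"
        by (subst nn_integral_add) (auto simp: emeasure_density)
      also have "\<dots> \<le> ?X + ennreal c * ?b" using \<rho>(2)[OF r] by (intro add_left_mono) (simp add: emeasure_lebesgue_cball)
      finally have *: "ennreal (a * ?s) \<le> ?X + ennreal (c * ?b)" using c by (simp add: ennreal_mult)
      show ?thesis
      proof (cases "?X = top")
        case False
        then obtain t where t: "?X = ennreal t" "t \<ge> 0" by (metis ennreal_cases)
        have nn: "0 \<le> t + c * ?b" using t c by (intro add_nonneg_nonneg mult_nonneg_nonneg) auto
        have "?X + ennreal (c * ?b) = ennreal (t + c * ?b)" using t c by (simp add: ennreal_plus[symmetric] del: ennreal_plus)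
        then have "a * ?s \<le> t + c * ?b" using * nn by (simp only: ennreal_le_iff)
        moreover have "(h x - e/2) * ?s \<le> a * ?s" "e/2 * ?s \<le> e/2 * ?b" "c * ?b \<le> e/2 * ?b"
          using a c sb \<open>e > 0\<close> mult_right_mono[of c "e/2" ?b] by (auto intro!: mult_right_mono)
        ultimately show ?thesis unfolding t by (intro ennreal_leI) (simp add: algebra_simps)
      qed simp
    qed
    then show "\<exists>\<rho>>0. \<forall>r. 0 < r \<and> r < \<rho> \<longrightarrow> (\<forall>S\<in>sets lebesgue. S \<subseteq> cball x r \<longrightarrow>
             ennreal (h x * measure lebesgue S - e * measure lebesgue (cball x r)) \<le> emeasure (density lebesgue (\<lambda>y. ennreal (h y))) S)"
      using \<rho>(1) by blast
  qed
qed

lemma AE_le_of_emeasure_le: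
  fixes f :: "'a::euclidean_space \<Rightarrow> ennreal"
  assumes f[measurable]: "f \<in> borel_measurable borel" and "0 \<le> C"
    and le: "\<And>A. A \<in> sets borel \<Longrightarrow> emeasure (density lborel f) A \<le> ennreal C * emeasure lborel A"
  shows "AE x in lborel. f x \<le> ennreal C"
proof (rule AE_upper_bound_inf_ennreal)
  fix e :: real assume e: "e > 0"
  have "AE x in lborel. \<forall>m\<in>(UNIV::nat set). \<not> (f x > ennreal C + ennreal e \<and> x \<in> cball 0 (real m))"
  proof (intro AE_ball_countable' ballI)
    fix m :: nat
    define B where "B = {x \<in> space lborel. f x > ennreal C + ennreal e} \<inter> cball 0 (real m)"
    have B[measurable]: "B \<in> sets borel" unfolding B_def by measurable
    have fin: "emeasure lborel B < \<infinity>"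
      by (rule le_less_trans[OF emeasure_mono[of B "cball 0 (real m)"] emeasure_lborel_cball_finite]) (auto simp: B_def)
    have "(ennreal C + ennreal e) * emeasure lborel B = (\<integral>\<^sup>+x. (ennreal C + ennreal e) * indicator B x \<partial>lborel)"
      by (subst nn_integral_cmult_indicator) auto
    also have "\<dots> \<le> (\<integral>\<^sup>+x. f x * indicator B x \<partial>lborel)"
      by (intro nn_integral_mono) (auto simp: B_def indicator_def)
    also have "\<dots> = emeasure (density lborel f) B" by (simp add: emeasure_density)
    also have "\<dots> \<le> ennreal C * emeasure lborel B" by (rule le) simp
    finally have *: "(ennreal C + ennreal e) * emeasure lborel B \<le> ennreal C * emeasure lborel B" .
    obtain b where b: "emeasure lborel B = ennreal b" "b \<ge> 0" using fin by (metis ennreal_cases less_irrefl infinity_ennreal_def)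
    have "(C + e) * b \<le> C * b" using * b \<open>0 \<le> C\<close> e
      by (simp add: ennreal_mult[symmetric] ennreal_plus[symmetric] del: ennreal_plus)
    then have "b = 0" using b(2) e by (simp add: algebra_simps mult_le_0_iff)
    then have "B \<in> null_sets lborel" using b by (auto intro: null_setsI)
    then show "AE x in lborel. \<not> (f x > ennreal C + ennreal e \<and> x \<in> cball 0 (real m))"
      by (rule AE_I') (auto simp: B_def)
  qed simp
  then show "AE x in lborel. f x \<le> ennreal C + ennreal e"
  proof eventually_elim
    case (elim x)
    obtain m :: nat where "norm x \<le> real m" using real_arch_simple by blast
    then show ?case using elim by (auto simp: not_less)
  qed
qed

text \<open>The function \<open>G x = F x + 2 K x\<close> is bi-Lipschitz, so its inverse transports Lebesgue measure to an absolutely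
  continuous measure with a bounded density, and \<open>G\<close> is differentiable at the Lebesgue points of this density.\<close>

lemma AE_differentiable_lipschitz_real:
  fixes F :: "real \<Rightarrow> real"
  assumes lip: "L-lipschitz_on UNIV F"
  shows "AE x in lebesgue. \<exists>D. (F has_real_derivative D) (at x)"
proof -
  define K where "K = L + 1"
  have K: "K > 0" using lipschitz_on_nonneg[OF lip] by (simp add: K_def)
  have FK: "\<bar>F x - F y\<bar> \<le> K * \<bar>x - y\<bar>" for x y
    using lipschitz_onD[OF lip, of x y] by (simp add: K_def dist_real_def algebra_simps)
  define G where "G x = F x + 2 * K * x" for x
  have G1: "K * (y - x) \<le> G y - G x" if "x \<le> y" for x y
    using FK[of y x] that by (simp add: G_def algebra_simps abs_le_iff)
  have G2: "G y - G x \<le> 3 * K * (y - x)" if "x \<le> y" for x y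
    using FK[of y x] that by (simp add: G_def algebra_simps abs_le_iff)
  have Gabs: "\<bar>G y - G x\<bar> \<le> 3 * K * \<bar>y - x\<bar>" for x y
    using G1[of x y] G2[of x y] G1[of y x] G2[of y x] K
    by (cases "x \<le> y") (auto simp: abs_if algebra_simps)
  have Gmono: "G x \<le> G y \<longleftrightarrow> x \<le> y" for x y
  proof
    show "x \<le> y \<Longrightarrow> G x \<le> G y" using G1[of x y] K by (smt (verit) mult_nonneg_nonneg)
    show "G x \<le> G y \<Longrightarrow> x \<le> y" using G1[of y x] K by (smt (verit) mult_pos_pos)
  qed
  have injG: "inj G" by (rule injI) (metis Gmono order_antisym order_refl)
  have lipG: "(3*K)-lipschitz_on UNIV G"
    using Gabs K by (intro lipschitz_onI) (auto simp: dist_real_def)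
  have contG: "continuous_on UNIV G" by (rule lipschitz_on_continuous_on[OF lipG])
  have surjG: "surj G"
  proof (rule surjI)
    fix y
    define a where "a = \<bar>y - G 0\<bar> / K"
    have a: "a \<ge> 0" "K * a = \<bar>y - G 0\<bar>" using K by (auto simp: a_def)
    have "G (-a) \<le> y" "y \<le> G a" using G1[of "-a" 0] G1[of 0 a] a by auto
    then obtain x where "G x = y"
      using IVT'[of G "-a" y a] a(1) contG continuous_on_subset by (metis subset_UNIV neg_le_iff_le neg_le_0_iff_le order_trans)
    then show "G (SOME x. G x = y) = y" by (rule someI)
  qed
  define H where "H = inv G"
  have GH[simp]: "G (H y) = y" "H (G x) = x" for x y
    using injG surjG by (simp_all add: H_def surj_f_inv_f)
  have "(1/K)-lipschitz_on UNIV H"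
  proof (rule lipschitz_onI)
    fix x y
    have "K * \<bar>H x - H y\<bar> \<le> \<bar>x - y\<bar>"
      using G1[of "H x" "H y"] G1[of "H y" "H x"] K by (auto simp: abs_if algebra_simps)
    then show "dist (H x) (H y) \<le> 1 / K * dist x y" using K by (simp add: dist_real_def field_simps)
  qed (use K in auto)
  then have Hm[measurable]: "H \<in> borel_measurable borel"
    by (intro borel_measurable_continuous_onI lipschitz_on_continuous_on)
  \<comment> \<open>The Stieltjes measure of \<open>G\<close>, obtained as the image of Lebesgue
    measure under the inverse \<open>H\<close>.\<close>
  define \<mu> where "\<mu> = distr lborel borel H"
  have [simp]: "sets \<mu> = sets borel" by (simp add: \<mu>_def)
  have \<mu>I: "emeasure \<mu> {a..b} = ennreal (G b - G a)" if "a \<le> b" for a b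
  proof -
    have "H -` {a..b} = {G a..G b}"
      using Gmono by (auto) (metis GH Gmono)+
    then show ?thesis using that Gmono by (simp add: \<mu>_def emeasure_distr)
  qed
  have \<mu>null: "A \<in> null_sets \<mu>" if A: "A \<in> null_sets lborel" for A
  proof -
    have "negligible A" using A by (simp add: negligible_iff_null_sets null_sets_completionI)
    then have "negligible (G ` A)"
      by (rule negligible_locally_Lipschitz_image[rotated])
        (use Gabs in \<open>auto intro!: exI[of _ UNIV] exI[of _ "3*K"]\<close>)
    moreover have "G ` A = H -` A" by (auto simp: image_iff) (metis GH)
    ultimately have "H -` A \<in> null_sets lebesgue" by (simp add: negligible_iff_null_sets)
    moreover have "H -` A \<in> sets lborel" using measurable_sets[OF Hm, of A] A by auto
    ultimately have "emeasure lborel (H -` A) = 0"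
      using null_sets_completion_iff by blast
    then show ?thesis using A by (intro null_setsI) (auto simp: \<mu>_def emeasure_distr)
  qed
  \<comment> \<open>The bound is known for intervals; disjoint closed intervals exhaust an open set
    up to a set that is null for both measures.\<close>
  have \<mu>open: "emeasure \<mu> U \<le> ennreal (3*K) * emeasure lborel U" if U: "open U" for U
  proof -
    obtain C where C: "countable C"
        "\<And>x r. (x, r) \<in> C \<Longrightarrow> x \<in> U \<and> 0 < r \<and> True \<and> cball x r \<subseteq> U"
        "disjoint_family_on (\<lambda>p. cball (fst p) (snd p)) C"
        "negligible (U - (\<Union>p\<in>C. cball (fst p) (snd p)))"
      by (rule Vitali_centered_cballs[where P="\<lambda>x r. True", OF U order_refl])
        (use dense in \<open>auto intro: that\<close>)
    let ?W = "\<Union>p\<in>C. cball (fst p) (snd p)"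
    have C2: "cball (fst p) (snd p) \<subseteq> U" "0 < snd p" if "p \<in> C" for p
      using C(2)[of "fst p" "snd p"] that by auto
    have W: "?W \<in> sets borel" using C(1) by (intro sets.countable_UN') auto
    have WU: "?W \<subseteq> U" using C2 by (intro UN_least) auto
    have "U - ?W \<in> null_sets lborel"
      using C(4) W U by (subst null_sets_completion_iff[symmetric]) (auto simp: negligible_iff_null_sets)
    then have 0: "U - ?W \<in> null_sets \<mu>" by (rule \<mu>null)
    have "emeasure \<mu> U = emeasure \<mu> (?W \<union> (U - ?W))" using WU by (simp add: Un_absorb1)
    also have "\<dots> = emeasure \<mu> ?W" by (rule emeasure_Un_null_set[OF _ 0]) (use W in simp)
    also have "\<dots> = (\<integral>\<^sup>+p. emeasure \<mu> (cball (fst p) (snd p)) \<partial>count_space C)"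
      by (subst emeasure_UN_countable[OF _ C(1) C(3)]) auto
    also have "\<dots> \<le> (\<integral>\<^sup>+p. ennreal (3*K) * emeasure lborel (cball (fst p) (snd p)) \<partial>count_space C)"
    proof (intro nn_integral_mono)
      fix p assume "p \<in> space (count_space C)"
      then have p: "0 < snd p" using C2 by auto
      then show "emeasure \<mu> (cball (fst p) (snd p)) \<le> ennreal (3*K) * emeasure lborel (cball (fst p) (snd p))"
        using G2[of "fst p - snd p" "fst p + snd p"] K
        by (auto simp: cball_eq_atLeastAtMost \<mu>I ennreal_mult[symmetric] intro!: ennreal_leI)
    qed
    also have "\<dots> = ennreal (3*K) * emeasure lborel ?W"
      by (subst emeasure_UN_countable[OF _ C(1) C(3)]) (auto simp: nn_integral_cmult)
    also have "\<dots> \<le> ennreal (3*K) * emeasure lborel U"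
      using WU U by (intro mult_left_mono emeasure_mono) auto
    finally show ?thesis .
  qed
  have \<mu>le: "emeasure \<mu> A \<le> ennreal (3*K) * emeasure lborel A" if A: "A \<in> sets borel" for A
  proof (rule ennreal_le_epsilon)
    fix e :: real assume e: "0 < e"
    have A': "A \<in> sets lebesgue" using A by simp
    obtain T where T: "open T" "A \<subseteq> T" "(T - A) \<in> lmeasurable" "emeasure lebesgue (T - A) < ennreal (e / (3*K))"
      by (rule sets_lebesgue_outer_open[OF A', of "e / (3*K)"]) (use e K in auto)
    have TA: "emeasure lborel (T - A) \<le> ennreal (e / (3*K))"
      using T A by (simp add: emeasure_completion less_imp_le)
    have "emeasure \<mu> A \<le> emeasure \<mu> T" using T by (intro emeasure_mono) auto
    also have "\<dots> \<le> ennreal (3*K) * emeasure lborel T" by (rule \<mu>open) fact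
    also have "emeasure lborel T = emeasure lborel A + emeasure lborel (T - A)"
      using T A by (subst plus_emeasure) (auto simp: Un_absorb1)
    also have "ennreal (3*K) * \<dots> \<le> ennreal (3*K) * (emeasure lborel A + ennreal (e / (3*K)))"
      using TA by (intro mult_left_mono add_left_mono) auto
    also have "\<dots> = ennreal (3*K) * emeasure lborel A + ennreal e"
      using K e by (simp add: distrib_left ennreal_mult[symmetric])
    finally show "emeasure \<mu> A \<le> ennreal (3*K) * emeasure lborel A + ennreal e" .
  qed
  have "absolutely_continuous lborel \<mu>" using \<mu>null by (auto simp: absolutely_continuous_def)
  then obtain f where f[measurable]: "f \<in> borel_measurable lborel" and fd: "density lborel f = \<mu>"
    using sigma_finite_measure.Radon_Nikodym[OF sigma_finite_lborel, of \<mu>] by auto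
  have fm[measurable]: "f \<in> borel_measurable borel" using f by simp
  have fle: "AE x in lborel. f x \<le> ennreal (3*K)"
    by (rule AE_le_of_emeasure_le[OF fm]) (use \<mu>le K in \<open>auto simp: fd\<close>)
  \<comment> \<open>Truncation turns the almost everywhere bound into a pointwise one, so that
    \<open>g\<close> and \<open>3*K - g\<close> both qualify as nonnegative densities.\<close>
  define g where "g x = min (enn2real (f x)) (3*K)" for x
  have g[measurable]: "g \<in> borel_measurable borel" unfolding g_def by measurable
  have g0: "0 \<le> g x" and g3: "g x \<le> 3*K" for x using K by (auto simp: g_def)
  have fg: "AE x in lborel. f x = ennreal (g x)"
    using fle
  proof eventually_elim
    case (elim x)
    then have "enn2real (f x) \<le> 3*K" using K by (intro enn2real_leI) auto
    moreover have "f x < top" using elim by (rule le_less_trans) simp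
    ultimately show ?case by (simp add: g_def min_def)
  qed
  have gm[measurable]: "g \<in> borel_measurable lebesgue" by (intro measurable_completion) simp
  have D1: "emeasure (density lebesgue (\<lambda>x. ennreal (g x))) {a..b} = ennreal (G b - G a)" if "a \<le> b" for a b
  proof -
    have "emeasure (density lebesgue (\<lambda>x. ennreal (g x))) {a..b} = (\<integral>\<^sup>+x. ennreal (g x) * indicator {a..b} x \<partial>lebesgue)"
      by (subst emeasure_density) auto
    also have "\<dots> = (\<integral>\<^sup>+x. ennreal (g x) * indicator {a..b} x \<partial>lborel)"
      by (rule nn_integral_completion)
    also have "\<dots> = (\<integral>\<^sup>+x. f x * indicator {a..b} x \<partial>lborel)"
      by (intro nn_integral_cong_AE) (use fg in eventually_elim, auto)
    also have "\<dots> = emeasure \<mu> {a..b}" by (simp add: fd[symmetric] emeasure_density)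
    finally show ?thesis using \<mu>I[OF that] by simp
  qed
  \<comment> \<open>\<open>AE_Lebesgue_lower\<close> gives lower estimates; applied to the
    complementary density it yields the upper estimate for \<open>g\<close>.\<close>
  have D2: "emeasure (density lebesgue (\<lambda>x. ennreal (3*K - g x))) {a..b} = ennreal (3*K*(b-a) - (G b - G a))" if ab: "a \<le> b" for a b
  proof -
    have [measurable]: "{a..b} \<in> sets lebesgue" by simp
    let ?X = "emeasure (density lebesgue (\<lambda>x. ennreal (3*K - g x))) {a..b}"
    have "ennreal (G b - G a) + ?X = (\<integral>\<^sup>+x. ennreal (g x) * indicator {a..b} x + ennreal (3*K - g x) * indicator {a..b} x \<partial>lebesgue)"
      by (subst nn_integral_add) (auto simp: emeasure_density D1[OF ab, symmetric])
    also have "\<dots> = (\<integral>\<^sup>+x. ennreal (3*K) * indicator {a..b} x \<partial>lebesgue)"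
      using g0 g3 by (intro nn_integral_cong) (auto simp: indicator_def ennreal_plus[symmetric] simp del: ennreal_plus)
    also have "\<dots> = ennreal (3*K*(b-a))"
      using ab K by (subst nn_integral_cmult_indicator) (auto simp: ennreal_mult emeasure_completion)
    finally have *: "ennreal (G b - G a) + ?X = ennreal (3*K*(b-a))" .
    then have "?X \<noteq> top" by (metis ennreal_add_eq_top ennreal_neq_top)
    then obtain t where t: "?X = ennreal t" "t \<ge> 0" by (metis ennreal_cases)
    have "G b - G a \<ge> 0" using ab Gmono by simp
    then have "G b - G a + t = 3*K*(b-a)" using * t ab K
      by (simp add: ennreal_plus[symmetric] del: ennreal_plus)
    then show ?thesis using t by simp
  qed
  have "AE x in lebesgue. \<forall>e>0. \<exists>\<rho>>0. \<forall>r. 0 < r \<and> r < \<rho> \<longrightarrow> (\<forall>S\<in>sets lebesgue. S \<subseteq> cball x r \<longrightarrow>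
             ennreal (g x * measure lebesgue S - e * measure lebesgue (cball x r)) \<le> emeasure (density lebesgue (\<lambda>y. ennreal (g y))) S)"
    by (rule AE_Lebesgue_lower) (use g0 in auto)
  moreover have "AE x in lebesgue. \<forall>e>0. \<exists>\<rho>>0. \<forall>r. 0 < r \<and> r < \<rho> \<longrightarrow> (\<forall>S\<in>sets lebesgue. S \<subseteq> cball x r \<longrightarrow>
             ennreal ((3*K - g x) * measure lebesgue S - e * measure lebesgue (cball x r)) \<le> emeasure (density lebesgue (\<lambda>y. ennreal (3*K - g y))) S)"
    by (rule AE_Lebesgue_lower) (use g3 in auto)
  ultimately show ?thesis
  proof eventually_elim
    case (elim x)
    have "(G has_real_derivative g x) (at x)"
      unfolding has_field_derivative_def has_derivative_within_alt
    proof (intro conjI allI impI)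
      show "bounded_linear ((*) (g x))" by (rule bounded_linear_mult_right)
      fix e :: real assume e: "0 < e"
      obtain \<rho>1 where \<rho>1: "\<rho>1 > 0" "\<And>r S. 0 < r \<Longrightarrow> r < \<rho>1 \<Longrightarrow> S\<in>sets lebesgue \<Longrightarrow> S \<subseteq> cball x r \<Longrightarrow>
         ennreal (g x * measure lebesgue S - e/2 * measure lebesgue (cball x r)) \<le> emeasure (density lebesgue (\<lambda>y. ennreal (g y))) S"
        using elim(1)[rule_format, of "e/2"] e by auto
      obtain \<rho>2 where \<rho>2: "\<rho>2 > 0" "\<And>r S. 0 < r \<Longrightarrow> r < \<rho>2 \<Longrightarrow> S\<in>sets lebesgue \<Longrightarrow> S \<subseteq> cball x r \<Longrightarrow>
         ennreal ((3*K - g x) * measure lebesgue S - e/2 * measure lebesgue (cball x r)) \<le> emeasure (density lebesgue (\<lambda>y. ennreal (3*K - g y))) S"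
        using elim(2)[rule_format, of "e/2"] e by auto
      show "\<exists>d>0. \<forall>y\<in>UNIV. norm (y - x) < d \<longrightarrow> norm (G y - G x - g x * (y - x)) \<le> e * norm (y - x)"
      proof (intro exI[of _ "min \<rho>1 \<rho>2"] conjI ballI impI)
        fix y assume y: "norm (y - x) < min \<rho>1 \<rho>2"
        \<comment> \<open>Both one-sided increments at \<open>x\<close> are covered, since
          \<open>x\<close> may be either endpoint. The ball \<open>cball x (b - a)\<close> has
          length \<open>2 * (b - a)\<close>, which explains the tolerance
          \<open>e/2\<close>.\<close>
        have key: "\<bar>(G b - G a) - g x * (b - a)\<bar> \<le> e * (b - a)"
          if ab: "a < b" "b - a < \<rho>1" "b - a < \<rho>2" "x = a \<or> x = b" for a b
        proof -
          have sub: "{a..b} \<subseteq> cball x (b - a)" using ab by (auto simp: dist_real_def)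
          have m: "measure lebesgue {a..b} = b - a" "measure lebesgue (cball x (b-a)) = 2 * (b - a)"
            using ab(1) by (auto simp: cball_eq_atLeastAtMost)
          have 1: "ennreal (g x * (b - a) - e/2 * (2 * (b - a))) \<le> ennreal (G b - G a)"
            using \<rho>1(2)[OF _ _ _ sub] ab unfolding m by (simp add: D1)
          have 2: "ennreal ((3*K - g x) * (b - a) - e/2 * (2 * (b - a))) \<le> ennreal (3*K*(b-a) - (G b - G a))"
            using \<rho>2(2)[OF _ _ _ sub] ab unfolding m by (simp add: D2)
          have "0 \<le> G b - G a" "0 \<le> 3*K*(b-a) - (G b - G a)" using ab(1) G2[of a b] Gmono by auto
          with 1 2 show ?thesis by (simp add: ennreal_le_iff algebra_simps abs_le_iff)
        qed
        show "norm (G y - G x - g x * (y - x)) \<le> e * norm (y - x)"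
          using key[of x y] key[of y x] y by (cases x y rule: linorder_cases) (auto simp: algebra_simps abs_if split: if_splits)
      qed (use \<rho>1 \<rho>2 in auto)
    qed
    then have "((\<lambda>x. G x - 2 * K * x) has_real_derivative g x - 2 * K) (at x)"
      by (auto intro!: derivative_eq_intros)
    then show ?case unfolding G_def by auto
  qed
qed

section \<open>Rademacher's theorem\<close>

text \<open>Tonelli's theorem for the indicator of \<open>x + t v \<in> N\<close> with \<open>x\<close> in the whole space and \<open>t\<close> in \<open>[0,1]\<close>.\<close>

lemma null_sets_of_null_lines:
  fixes N :: "'a::euclidean_space set"
  assumes N[measurable]: "N \<in> sets borel" and null: "\<And>x. {t::real. x + t *\<^sub>R v \<in> N} \<in> null_sets lborel"
  shows "N \<in> null_sets lborel"
proof -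
  have "(\<integral>\<^sup>+t. (\<integral>\<^sup>+x. indicator N (x + t *\<^sub>R v) * indicator {0..1} t \<partial>lborel) \<partial>lborel)
      = (\<integral>\<^sup>+x. (\<integral>\<^sup>+t. indicator N (x + t *\<^sub>R v) * indicator {0..1::real} t \<partial>lborel) \<partial>lborel)"
    by (rule lborel_pair.Fubini') measurable
  also have "\<dots> = integral\<^sup>N lborel (\<lambda>x::'a. 0)"
  proof (intro nn_integral_cong)
    fix x
    have "AE t in lborel. \<not> x + t *\<^sub>R v \<in> N"
      by (rule AE_I'[OF null[of x]]) auto
    then have "AE t in lborel. indicator N (x + t *\<^sub>R v) * indicator {0..1::real} t = (0::ennreal)"
      by eventually_elim auto
    then show "(\<integral>\<^sup>+t. indicator N (x + t *\<^sub>R v) * indicator {0..1::real} t \<partial>lborel) = 0"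
      by (subst nn_integral_cong_AE) auto
  qed
  also have "\<dots> = 0" by simp
  finally have 0: "(\<integral>\<^sup>+t. (\<integral>\<^sup>+x. indicator N (x + t *\<^sub>R v) * indicator {0..1} t \<partial>lborel) \<partial>lborel) = 0" .
  have "(\<integral>\<^sup>+x. indicator N (x + t *\<^sub>R v) * indicator {0..1} t \<partial>lborel) = emeasure lborel N * indicator {0..1} t" for t
  proof -
    have "emeasure lborel N = (\<integral>\<^sup>+x. indicator N x \<partial>distr lborel borel ((+) (t *\<^sub>R v)))"
      by (simp add: lborel_distr_plus)
    also have "\<dots> = (\<integral>\<^sup>+x. indicator N (x + t *\<^sub>R v) \<partial>lborel)"
      by (subst nn_integral_distr) (auto simp: add.commute)
    finally show ?thesis by (subst nn_integral_multc) auto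
  qed
  with 0 have "emeasure lborel N * emeasure lborel {0..1::real} = 0"
    by (simp add: nn_integral_cmult_indicator)
  then show ?thesis by (auto intro: null_setsI)
qed

definition dirq :: "('a::real_normed_vector \<Rightarrow> real) \<Rightarrow> 'a \<Rightarrow> 'a \<Rightarrow> real \<Rightarrow> real" where
  "dirq f v x t = (f (x + t *\<^sub>R v) - f x) / t"

lemma dirq_bound:
  assumes "L-lipschitz_on UNIV f"
  shows "\<bar>dirq f v x t\<bar> \<le> L * norm v"
proof (cases "t = 0")
  case True
  then show ?thesis using lipschitz_on_nonneg[OF assms] by (simp add: dirq_def)
next
  case False
  then show ?thesis using lipschitz_onD[OF assms, of "x + t *\<^sub>R v" x]
    by (simp add: dirq_def dist_norm field_simps)
qed

text \<open>On each line in direction \<open>v\<close> the one-dimensional theorem applies, so the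
  points without a limit form a null set on every such line. To integrate these slices the
  exceptional set has to be Borel, which a Cauchy criterion provides.\<close>

lemma AE_dirq_converges:
  fixes f :: "'a::euclidean_space \<Rightarrow> real"
  assumes lip: "L-lipschitz_on UNIV f"
  shows "AE x in lborel. \<exists>D. (dirq f v x \<longlongrightarrow> D) (at 0)"
proof -
  have cont: "continuous_on UNIV f" by (rule lipschitz_on_continuous_on[OF lip])
  have conv: "cauchy_filter (filtermap g (at 0)) \<longleftrightarrow> (\<exists>D. (g \<longlongrightarrow> D) (at 0))" for g :: "real \<Rightarrow> real"
    using cauchy_filter_complete_converges[of "filtermap g (at 0)" UNIV] nhds_imp_cauchy_filter[of "filtermap g (at 0)"]
    by (auto simp: filterlim_def complete_UNIV filtermap_bot_iff)
  define G where "G = {x. \<exists>D. (dirq f v x \<longlongrightarrow> D) (at 0)}"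
  \<comment> \<open>Non-strict inequalities make this set closed although \<open>s\<close> and
    \<open>t\<close> range over uncountably many values; only \<open>n\<close> and \<open>m\<close>
    enter through countable unions and intersections.\<close>
  let ?C = "\<lambda>n m. {x. \<forall>s t. s \<noteq> 0 \<and> \<bar>s\<bar> < inverse (Suc m) \<and> t \<noteq> 0 \<and> \<bar>t\<bar> < inverse (Suc m) \<longrightarrow>
      \<bar>dirq f v x s - dirq f v x t\<bar> \<le> inverse (real (Suc n))}"
  have eq: "G = (\<Inter>n. \<Union>m. ?C n m)"
  proof (intro equalityI subsetI)
    fix x assume "x \<in> G"
    then have c: "cauchy_filter (filtermap (dirq f v x) (at 0))"
      using conv by (auto simp: G_def)
    have "\<exists>m. x \<in> ?C n m" for n
    proof -
      obtain P where P: "eventually P (at (0::real))" "\<And>s t. P s \<Longrightarrow> P t \<Longrightarrow> dist (dirq f v x s) (dirq f v x t) < inverse (Suc n)"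
        using c unfolding cauchy_filter_metric_filtermap by (metis inverse_positive_iff_positive of_nat_0_less_iff zero_less_Suc)
      obtain d where d: "d > 0" "\<And>s. s \<noteq> 0 \<Longrightarrow> \<bar>s\<bar> < d \<Longrightarrow> P s"
        using P(1) by (auto simp: eventually_at dist_real_def)
      obtain m where "inverse (Suc m) < d" using reals_Archimedean[OF d(1)] by auto
      then have "x \<in> ?C n m" using d(2) P(2) by (force simp: dist_real_def intro: less_imp_le)
      then show ?thesis ..
    qed
    then show "x \<in> (\<Inter>n. \<Union>m. ?C n m)" by blast
  next
    fix x assume x: "x \<in> (\<Inter>n. \<Union>m. ?C n m)"
    have "cauchy_filter (filtermap (dirq f v x) (at 0))"
      unfolding cauchy_filter_metric_filtermap
    proof (intro allI impI)
      fix e :: real assume "e > 0"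
      then obtain n where n: "inverse (real (Suc n)) < e" using reals_Archimedean by blast
      obtain m where m: "x \<in> ?C n m" using x by blast
      show "\<exists>P. eventually P (at 0) \<and> (\<forall>s t. P s \<and> P t \<longrightarrow> dist (dirq f v x s) (dirq f v x t) < e)"
      proof (intro exI conjI)
        show "eventually (\<lambda>s. s \<noteq> 0 \<and> \<bar>s\<bar> < inverse (Suc m)) (at (0::real))"
          by (auto simp: eventually_at dist_real_def intro!: exI[of _ "inverse (Suc m)"])
        show "\<forall>s t. (s \<noteq> 0 \<and> \<bar>s\<bar> < inverse (Suc m)) \<and> (t \<noteq> 0 \<and> \<bar>t\<bar> < inverse (Suc m)) \<longrightarrow> dist (dirq f v x s) (dirq f v x t) < e"
          using m n unfolding dist_real_def by (simp add: le_less_trans) (meson le_less_trans)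
      qed
    qed
    then show "x \<in> G" using conv by (auto simp: G_def)
  qed
  have "continuous_on UNIV (\<lambda>x. dirq f v x t)" for t
  proof (cases "t = 0")
    case False
    then show ?thesis unfolding dirq_def
      by (intro continuous_intros continuous_on_compose2[OF cont]) auto
  qed (simp add: dirq_def)
  then have "closed (?C n m)" for n m
    by (intro closed_Collect_all closed_Collect_imp open_Collect_const closed_Collect_le continuous_on_rabs
        continuous_on_diff continuous_on_const)
  then have "?C n m \<in> sets borel" for n m by (rule borel_closed)
  then have G[measurable]: "G \<in> sets borel" unfolding eq by (intro sets.countable_INT' sets.countable_UN') auto
  have "- G \<in> null_sets lborel"
  proof (rule null_sets_of_null_lines[where v=v])
    show "- G \<in> sets borel" using G by auto
    fix x
    define F where "F t = f (x + t *\<^sub>R v)" for t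
    have "(L * norm v)-lipschitz_on UNIV F"
    proof (rule lipschitz_onI)
      fix s t :: real
      show "dist (F s) (F t) \<le> L * norm v * dist s t"
        using lipschitz_onD[OF lip, of "x + s *\<^sub>R v" "x + t *\<^sub>R v"]
          scaleR_diff_left[of s t v, symmetric]
        by (simp add: F_def dist_norm mult_ac)
    qed (use lipschitz_on_nonneg[OF lip] in simp)
    then have "AE t in lebesgue. \<exists>D. (F has_real_derivative D) (at t)"
      by (rule AE_differentiable_lipschitz_real)
    then have "AE t in lborel. \<exists>D. (F has_real_derivative D) (at t)" by (simp add: AE_completion_iff)
    then have "AE t in lborel. x + t *\<^sub>R v \<in> G"
    proof eventually_elim
      case (elim t)
      then obtain D where "(F has_real_derivative D) (at t)" ..
      then have "((\<lambda>h. (F (t + h) - F t) / h) \<longlongrightarrow> D) (at 0)" by (simp add: DERIV_def)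
      moreover have "(\<lambda>h. (F (t + h) - F t) / h) = dirq f v (x + t *\<^sub>R v)"
        by (auto simp: dirq_def F_def fun_eq_iff scaleR_add_left add.assoc)
      ultimately show ?case by (auto simp: G_def)
    qed
    moreover have "{t \<in> space lborel. \<not> x + t *\<^sub>R v \<in> G} \<in> sets lborel" by measurable
    ultimately have "{t \<in> space lborel. \<not> x + t *\<^sub>R v \<in> G} \<in> null_sets lborel" by (subst (asm) AE_iff_null) auto
    then show "{t. x + t *\<^sub>R v \<in> - G} \<in> null_sets lborel" by simp
  qed
  then show ?thesis by (rule AE_I') (auto simp: G_def)
qed

text \<open>Adding \<open>C\<close> makes the integrand nonnegative, as the lower Lebesgue estimate
  requires. Over a small ball around \<open>x\<close> the average of \<open>h + C\<close> is
  \<open>C\<close>, and the estimate says that it is at least \<open>h x + C - e\<close>.\<close>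

lemma AE_nonpos_of_integral_cball:
  fixes h :: "'a::euclidean_space \<Rightarrow> real"
  assumes h[measurable]: "h \<in> borel_measurable borel" and bd: "\<And>x. \<bar>h x\<bar> \<le> C"
    and int: "\<And>c r. (\<integral>x. indicator (cball c r) x * h x \<partial>lborel) = 0"
  shows "AE x in lborel. h x \<le> 0"
proof -
  have hl[measurable]: "h \<in> borel_measurable lebesgue" by (intro measurable_completion) simp
  have C0: "0 \<le> C" using bd[of undefined] by linarith
  have hC: "0 \<le> h x + C" for x using bd[of x] by linarith
  have "AE x in lebesgue. \<forall>e>0. \<exists>\<rho>>0. \<forall>r. 0 < r \<and> r < \<rho> \<longrightarrow> (\<forall>S\<in>sets lebesgue. S \<subseteq> cball x r \<longrightarrow>
             ennreal ((h x + C) * measure lebesgue S - e * measure lebesgue (cball x r)) \<le> emeasure (density lebesgue (\<lambda>y. ennreal (h y + C))) S)"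
    by (rule AE_Lebesgue_lower) (use hC in auto)
  then have "AE x in lebesgue. h x \<le> 0"
  proof eventually_elim
    case (elim x)
    show ?case
    proof (rule field_le_epsilon)
      fix e :: real assume e: "e > 0"
      obtain \<rho> where "\<rho> > 0" and \<rho>: "\<And>r S. 0 < r \<Longrightarrow> r < \<rho> \<Longrightarrow> S\<in>sets lebesgue \<Longrightarrow> S \<subseteq> cball x r \<Longrightarrow>
         ennreal ((h x + C) * measure lebesgue S - e * measure lebesgue (cball x r)) \<le> emeasure (density lebesgue (\<lambda>y. ennreal (h y + C))) S"
        using elim[rule_format, of e] e by auto
      define B where "B = cball x (\<rho>/2)"
      have fin: "emeasure lborel B < \<infinity>" unfolding B_def by (rule emeasure_lborel_cball_finite)
      have [measurable]: "B \<in> sets borel" by (simp add: B_def)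
      have i1: "integrable lborel (\<lambda>x. indicator B x * h x)"
        by (rule integrableI_bounded_set[where A=B and B=C])
          (use fin bd in auto)
      have i2: "integrable lborel (\<lambda>x. indicator B x * C)" using fin by (intro integrable_mult_left integrable_real_indicator) auto
      have "emeasure (density lebesgue (\<lambda>y. ennreal (h y + C))) B = (\<integral>\<^sup>+y. ennreal (h y + C) * indicator B y \<partial>lebesgue)"
        by (subst emeasure_density) auto
      also have "\<dots> = (\<integral>\<^sup>+y. ennreal (indicator B y * h y + indicator B y * C) \<partial>lborel)"
        by (subst nn_integral_completion, intro nn_integral_cong) (auto simp: indicator_def)
      also have "\<dots> = ennreal (\<integral>y. indicator B y * h y + indicator B y * C \<partial>lborel)"
        using hC by (intro nn_integral_eq_integral Bochner_Integration.integrable_add i1 i2) (auto simp: indicator_def)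
      also have "(\<integral>y. indicator B y * h y + indicator B y * C \<partial>lborel) = C * measure lborel B"
        using int[of x "\<rho>/2"] i1 i2 by (simp add: B_def mult.commute)
      finally have "emeasure (density lebesgue (\<lambda>y. ennreal (h y + C))) B = ennreal (C * measure lborel B)" .
      moreover have "ennreal ((h x + C) * measure lebesgue B - e * measure lebesgue B) \<le> emeasure (density lebesgue (\<lambda>y. ennreal (h y + C))) B"
        unfolding B_def using \<open>\<rho> > 0\<close> by (intro \<rho>) auto
      ultimately have "(h x + C) * measure lborel B - e * measure lborel B \<le> C * measure lborel B"
        using C0 by (simp add: ennreal_le_iff)
      then have "(h x - e) * measure lborel B \<le> 0" by (simp add: algebra_simps)
      moreover have "measure lborel B > 0" unfolding B_def using \<open>\<rho> > 0\<close> by (intro content_cball_pos) auto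
      ultimately have "h x - e \<le> 0" by (simp add: mult_le_0_iff)
      then show "h x \<le> 0 + e" by simp
    qed
  qed
  then show ?thesis by (simp add: AE_completion_iff)
qed

text \<open>Truncating the limit makes the directional derivative bounded also where the limit does not exist.\<close>

definition dirder :: "real \<Rightarrow> ('a::euclidean_space \<Rightarrow> real) \<Rightarrow> 'a \<Rightarrow> 'a \<Rightarrow> real" where
  "dirder L f v x = max (- (L * norm v)) (min (L * norm v) (lim (\<lambda>n. dirq f v x (inverse (real (Suc n))))))"

lemma dirder_bound: "0 \<le> L \<Longrightarrow> \<bar>dirder L f v x\<bar> \<le> L * norm v"
  unfolding dirder_def by (auto simp: abs_le_iff max_def min_def)

lemma dirq_measurable:
  fixes f :: "'a::euclidean_space \<Rightarrow> real"
  assumes "L-lipschitz_on UNIV f"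
  shows "(\<lambda>x. dirq f v x t) \<in> borel_measurable borel"
proof -
  have [measurable]: "f \<in> borel_measurable borel"
    by (rule borel_measurable_continuous_onI[OF lipschitz_on_continuous_on[OF assms]])
  show ?thesis unfolding dirq_def by measurable
qed

lemma dirder_measurable:
  fixes f :: "'a::euclidean_space \<Rightarrow> real"
  assumes "L-lipschitz_on UNIV f"
  shows "dirder L f v \<in> borel_measurable borel"
proof -
  note dirq_measurable[OF assms, measurable]
  show ?thesis unfolding dirder_def by measurable
qed

lemma dirq_tendsto_dirder:
  fixes f :: "'a::euclidean_space \<Rightarrow> real"
  assumes lip: "L-lipschitz_on UNIV f" and lim: "(dirq f v x \<longlongrightarrow> D) (at 0)"
  shows "dirder L f v x = D" "(\<lambda>n. dirq f v x (inverse (real (Suc n)))) \<longlonglongrightarrow> dirder L f v x"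
proof -
  have "filterlim (\<lambda>n. inverse (real (Suc n))) (at 0) sequentially"
    using LIMSEQ_inverse_real_of_nat by (auto simp: filterlim_at)
  then have 1: "(\<lambda>n. dirq f v x (inverse (real (Suc n)))) \<longlonglongrightarrow> D"
    by (rule filterlim_compose[OF lim])
  then have "\<bar>D\<bar> \<le> L * norm v"
    using dirq_bound[OF lip, of v x] by (intro LIMSEQ_le_const2[OF tendsto_rabs[OF 1]]) auto
  then show "dirder L f v x = D" using limI[OF 1] by (auto simp: dirder_def)
  with 1 show "(\<lambda>n. dirq f v x (inverse (real (Suc n)))) \<longlonglongrightarrow> dirder L f v x" by simp
qed

lemma AE_dirq_tendsto_dirder:
  fixes f :: "'a::euclidean_space \<Rightarrow> real"
  assumes lip: "L-lipschitz_on UNIV f"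
  shows "AE x in lborel. (dirq f v x \<longlongrightarrow> dirder L f v x) (at 0)"
  using AE_dirq_converges[OF lip, of v] by eventually_elim (use dirq_tendsto_dirder[OF lip] in auto)

lemma AE_dirder_scaleR:
  fixes f :: "'a::euclidean_space \<Rightarrow> real"
  assumes lip: "L-lipschitz_on UNIV f"
  shows "AE x in lborel. dirder L f (c *\<^sub>R v) x = c * dirder L f v x"
  using AE_dirq_tendsto_dirder[OF lip, of v]
proof eventually_elim
  case (elim x)
  have "(dirq f (c *\<^sub>R v) x \<longlongrightarrow> c * dirder L f v x) (at 0)"
  proof (cases "c = 0")
    case True
    then have "dirq f (c *\<^sub>R v) x = (\<lambda>_. 0)" by (auto simp: dirq_def fun_eq_iff)
    then show ?thesis using True by simp
  next
    case False
    have "filterlim (\<lambda>t. t * c) (at 0) (at (0::real))"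
      using False by (auto simp: filterlim_at eventually_at intro!: tendsto_eq_intros exI[of _ 1])
    then have "((\<lambda>t. c * dirq f v x (t * c)) \<longlongrightarrow> c * dirder L f v x) (at 0)"
      by (intro tendsto_mult_left filterlim_compose[OF elim])
    moreover have "(\<lambda>t. c * dirq f v x (t * c)) = dirq f (c *\<^sub>R v) x"
      using False by (auto simp: dirq_def fun_eq_iff)
    ultimately show ?thesis by simp
  qed
  then show ?case by (rule dirq_tendsto_dirder(1)[OF lip])
qed

text \<open>Difference quotients are additive up to a translation by \<open>t v\<close>, which disappears in the limit of the integrals
  over a fixed ball.\<close>

lemma AE_dirder_add:
  fixes f :: "'a::euclidean_space \<Rightarrow> real"
  assumes lip: "L-lipschitz_on UNIV f"
  shows "AE x in lborel. dirder L f (v + w) x = dirder L f v x + dirder L f w x"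
proof -
  let ?d = "dirder L f"
  define t where "t n = inverse (real (Suc n))" for n
  have t: "0 < t n" "t n \<le> 1" for n by (auto simp: t_def field_simps)
  have t0: "t \<longlonglongrightarrow> 0" unfolding t_def by (rule LIMSEQ_inverse_real_of_nat)
  have L0: "0 \<le> L" by (rule lipschitz_on_nonneg[OF lip])
  note [measurable] = dirq_measurable[OF lip] dirder_measurable[OF lip]
  have [measurable]: "cball c r \<in> sets borel" for c :: 'a and r by simp
  have qlim: "AE x in lborel. (\<lambda>n. dirq f u x (t n)) \<longlonglongrightarrow> ?d u x" for u
    using AE_dirq_tendsto_dirder[OF lip, of u]
    by eventually_elim (use dirq_tendsto_dirder(2)[OF lip] in \<open>auto simp: t_def\<close>)
  have intb: "integrable lborel (\<lambda>x. indicator (cball c r) x * g x)"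
    if g[measurable]: "g \<in> borel_measurable borel" and B: "\<And>x. \<bar>g x\<bar> \<le> B" for g :: "'a \<Rightarrow> real" and B c r
  proof (rule integrableI_bounded_set[where A="cball c r" and B=B])
    have [measurable]: "cball c r \<in> sets borel" by simp
    have "(\<lambda>x. indicator (cball c r) x * g x) \<in> borel_measurable borel" by measurable
    then show "(\<lambda>x. indicator (cball c r) x * g x) \<in> borel_measurable lborel" by simp
  qed (use B emeasure_lborel_cball_finite in auto)
  define h where "h x = ?d (v + w) x - ?d v x - ?d w x" for x
  have int: "(\<integral>x. indicator (cball c r) x * h x \<partial>lborel) = 0" for c :: 'a and r
  proof -
    let ?I = "\<lambda>g::'a\<Rightarrow>real. \<integral>x. indicator (cball c r) x * g x \<partial>lborel"
    have l1: "(\<lambda>n. ?I (\<lambda>x. dirq f u x (t n))) \<longlonglongrightarrow> ?I (?d u)" for u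
    proof (rule integral_dominated_convergence[where w="\<lambda>x. indicator (cball c r) x * (L * norm u)"])
      show "integrable lborel (\<lambda>x. indicator (cball c r) x * (L * norm u))" by (rule intb[where B="L * norm u"]) (use L0 in auto)
      show "AE x in lborel. (\<lambda>n. indicator (cball c r) x * dirq f u x (t n)) \<longlonglongrightarrow> indicator (cball c r) x * ?d u x"
        using qlim[of u] by eventually_elim (intro tendsto_mult_left)
      show "AE x in lborel. norm (indicator (cball c r) x * dirq f u x (t n)) \<le> indicator (cball c r) x * (L * norm u)" for n
        using dirq_bound[OF lip] by (auto simp: abs_mult indicator_def)
    qed (unfold measurable_lborel2, measurable)
    \<comment> \<open>Substitution moves the translation from the difference quotient to the
      indicator of the ball. The shifted indicators converge off the sphere, which is a null set,
      and a ball enlarged by \<open>norm v\<close> dominates them because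
      \<open>t n \<le> 1\<close>.\<close>
    have l2: "(\<lambda>n. ?I (\<lambda>x. dirq f w (x + t n *\<^sub>R v) (t n))) \<longlonglongrightarrow> ?I (?d w)"
    proof -
      have shift: "?I (\<lambda>x. dirq f w (x + t n *\<^sub>R v) (t n)) = (\<integral>y. indicator (cball c r) (y - t n *\<^sub>R v) * dirq f w y (t n) \<partial>lborel)" for n
      proof -
        have "(\<integral>y. indicator (cball c r) (y - t n *\<^sub>R v) * dirq f w y (t n) \<partial>lborel)
            = (\<integral>y. indicator (cball c r) (y - t n *\<^sub>R v) * dirq f w y (t n) \<partial>distr lborel borel ((+) (t n *\<^sub>R v)))"
          by (simp add: lborel_distr_plus)
        also have "\<dots> = ?I (\<lambda>x. dirq f w (x + t n *\<^sub>R v) (t n))"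
          by (subst integral_distr) (auto simp: add.commute)
        finally show ?thesis by simp
      qed
      have sph: "AE y in lborel. y \<notin> sphere c r"
      proof (rule AE_I')
        have "sphere c r \<in> null_sets lebesgue" using negligible_sphere by (simp add: negligible_iff_null_sets)
        then show "sphere c r \<in> null_sets lborel" by (subst null_sets_completion_iff[symmetric]) auto
      qed auto
      show ?thesis unfolding shift
      proof (rule integral_dominated_convergence[where w="\<lambda>x. indicator (cball c (r + norm v)) x * (L * norm w)"])
        show "integrable lborel (\<lambda>x. indicator (cball c (r + norm v)) x * (L * norm w))" by (rule intb[where B="L * norm w"]) (use L0 in auto)
        show "AE y in lborel. (\<lambda>n. indicator (cball c r) (y - t n *\<^sub>R v) * dirq f w y (t n)) \<longlonglongrightarrow> indicator (cball c r) y * ?d w y"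
          using qlim[of w] sph
        proof eventually_elim
          case (elim y)
          have conv: "(\<lambda>n. y - t n *\<^sub>R v) \<longlonglongrightarrow> y" using t0 by (auto intro!: tendsto_eq_intros)
          have "eventually (\<lambda>n. indicator (cball c r) (y - t n *\<^sub>R v) = (indicator (cball c r) y :: real)) sequentially"
          proof (cases "y \<in> cball c r")
            case True
            then have "y \<in> ball c r" using elim(2) by (auto simp: less_le)
            then have "eventually (\<lambda>n. y - t n *\<^sub>R v \<in> ball c r) sequentially" by (intro topological_tendstoD[OF conv]) auto
            then show ?thesis by eventually_elim (use True in \<open>auto simp: indicator_def\<close>)
          next
            case False
            then have "eventually (\<lambda>n. y - t n *\<^sub>R v \<in> - cball c r) sequentially" by (intro topological_tendstoD[OF conv]) auto
            then show ?thesis by eventually_elim (use False in \<open>auto simp: indicator_def\<close>)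
          qed
          then have "(\<lambda>n. indicator (cball c r) (y - t n *\<^sub>R v)) \<longlonglongrightarrow> (indicator (cball c r) y :: real)"
            by (rule tendsto_eventually)
          then show ?case by (intro tendsto_mult elim)
        qed
        show "AE y in lborel. norm (indicator (cball c r) (y - t n *\<^sub>R v) * dirq f w y (t n)) \<le> indicator (cball c (r + norm v)) y * (L * norm w)" for n
        proof (rule AE_I2)
          fix y
          have "y \<in> cball c (r + norm v)" if "y - t n *\<^sub>R v \<in> cball c r"
          proof -
            have "dist c y \<le> dist c (y - t n *\<^sub>R v) + dist (y - t n *\<^sub>R v) y" by (rule dist_triangle)
            also have "dist (y - t n *\<^sub>R v) y \<le> norm v" using t[of n] by (simp add: dist_norm mult_left_le_one_le)
            finally show ?thesis using that by simp
          qed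
          then show "norm (indicator (cball c r) (y - t n *\<^sub>R v) * dirq f w y (t n)) \<le> indicator (cball c (r + norm v)) y * (L * norm w)"
            using dirq_bound[OF lip, of w y "t n"] L0 by (auto simp: indicator_def)
        qed
      qed (unfold measurable_lborel2, measurable)
    qed
    have "?I (\<lambda>x. dirq f (v + w) x (t n)) = ?I (\<lambda>x. dirq f v x (t n)) + ?I (\<lambda>x. dirq f w (x + t n *\<^sub>R v) (t n))" for n
    proof -
      have "?I (\<lambda>x. dirq f v x (t n)) + ?I (\<lambda>x. dirq f w (x + t n *\<^sub>R v) (t n)) =
         (\<integral>x. indicator (cball c r) x * dirq f v x (t n) + indicator (cball c r) x * dirq f w (x + t n *\<^sub>R v) (t n) \<partial>lborel)"
        by (intro Bochner_Integration.integral_add[symmetric] intb[where B="L * norm v"] intb[where B="L * norm w"] dirq_bound[OF lip])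
          (measurable)
      also have "\<dots> = ?I (\<lambda>x. dirq f (v + w) x (t n))"
        using t[of n] by (intro Bochner_Integration.integral_cong refl)
          (auto simp: dirq_def add_divide_distrib[symmetric] indicator_def algebra_simps diff_divide_distrib)
      finally show ?thesis by simp
    qed
    then have "(\<lambda>n. ?I (\<lambda>x. dirq f (v + w) x (t n))) \<longlonglongrightarrow> ?I (?d v) + ?I (?d w)"
      using tendsto_add[OF l1[of v] l2] by simp
    with l1[of "v + w"] have eq: "?I (?d (v + w)) = ?I (?d v) + ?I (?d w)" by (rule LIMSEQ_unique)
    have i: "integrable lborel (\<lambda>x. indicator (cball c r) x * ?d u x)" for u
      by (rule intb[where B="L * norm u"]) (use dirder_bound[OF L0] in auto)
    have "?I h = ?I (?d (v + w)) - ?I (?d v) - ?I (?d w)"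
      unfolding h_def right_diff_distrib using i by simp
    with eq show ?thesis by simp
  qed
  have hb: "\<bar>h x\<bar> \<le> L * norm (v + w) + L * norm v + L * norm w" for x
    using dirder_bound[OF L0, of f "v+w" x] dirder_bound[OF L0, of f v x] dirder_bound[OF L0, of f w x]
    unfolding h_def by linarith
  have [measurable]: "h \<in> borel_measurable borel" unfolding h_def by measurable
  have "AE x in lborel. h x \<le> 0" by (rule AE_nonpos_of_integral_cball[OF _ hb int]) measurable
  moreover have "AE x in lborel. - h x \<le> 0"
    by (rule AE_nonpos_of_integral_cball[where C="L * norm (v + w) + L * norm v + L * norm w"]) (use hb int in auto)
  ultimately show ?thesis by eventually_elim (simp add: h_def)
qed

lemma AE_dirder_linear:
  fixes f :: "'a::euclidean_space \<Rightarrow> real"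
  assumes lip: "L-lipschitz_on UNIV f"
  shows "AE x in lborel. dirder L f v x = (\<Sum>i\<in>Basis. dirder L f i x *\<^sub>R i) \<bullet> v"
proof -
  have "AE x in lborel. dirder L f (\<Sum>i\<in>F. (v \<bullet> i) *\<^sub>R i) x = (\<Sum>i\<in>F. (v \<bullet> i) * dirder L f i x)" if "finite F" "F \<subseteq> Basis" for F :: "'a set"
    using that
  proof (induction F rule: finite_induct)
    case empty
    have "AE x in lborel. dirder L f (0 *\<^sub>R 0) x = 0 * dirder L f 0 x" by (rule AE_dirder_scaleR[OF lip])
    then show ?case by simp
  next
    case (insert i F)
    then have "AE x in lborel. dirder L f (\<Sum>i\<in>F. (v \<bullet> i) *\<^sub>R i) x = (\<Sum>i\<in>F. (v \<bullet> i) * dirder L f i x)" by auto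
    then show ?case
      using AE_dirder_add[OF lip, of "(v \<bullet> i) *\<^sub>R i" "\<Sum>i\<in>F. (v \<bullet> i) *\<^sub>R i"] AE_dirder_scaleR[OF lip, of "v \<bullet> i" i]
      by eventually_elim (use insert in simp)
  qed
  from this[OF finite_Basis order_refl] show ?thesis
    by eventually_elim (simp only: euclidean_representation, simp add: inner_sum_left inner_sum_right mult.commute inner_commute)
qed

text \<open>The exceptional null sets depend on the direction, so convergence is secured for a
  countable dense set of directions. Finitely many of these are \<epsilon>-close to all of the unit
  sphere, and the Lipschitz bound carries the estimate from them to every direction,
  uniformly.\<close>

theorem Rademacher_real:
  fixes f :: "'a::euclidean_space \<Rightarrow> real"
  assumes lip: "L-lipschitz_on UNIV f"
  shows "AE x in lborel. f differentiable (at x)"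
proof -
  obtain V :: "'a set" where V: "countable V" "\<And>X. open X \<Longrightarrow> X \<noteq> {} \<Longrightarrow> \<exists>d\<in>V. d \<in> X"
    using countable_dense_setE by blast
  have L0: "0 \<le> L" by (rule lipschitz_on_nonneg[OF lip])
  define D where "D x = (\<Sum>i\<in>Basis. dirder L f i x *\<^sub>R i)" for x
  have "AE x in lborel. \<forall>v\<in>V. (dirq f v x \<longlongrightarrow> D x \<bullet> v) (at 0)"
  proof (rule AE_ball_countable'[OF _ V(1)])
    fix v
    show "AE x in lborel. (dirq f v x \<longlongrightarrow> D x \<bullet> v) (at 0)"
      using AE_dirder_linear[OF lip, of v] AE_dirq_tendsto_dirder[OF lip, of v]
      by eventually_elim (simp add: D_def)
  qed
  then show ?thesis
  proof eventually_elim
    case (elim x)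
    have "(f has_derivative (\<lambda>h. D x \<bullet> h)) (at x)"
      unfolding has_derivative_within_alt
    proof (intro conjI allI impI)
      show "bounded_linear ((\<bullet>) (D x))" by (rule bounded_linear_inner_right)
      fix e :: real assume e: "e > 0"
      \<comment> \<open>Three errors add up: \<open>L * \<epsilon>\<close> for changing the
        direction in \<open>f\<close>, \<open>norm (D x) * \<epsilon>\<close> for changing it in the
        linear part, and \<epsilon> for the difference quotient.\<close>
      define \<epsilon> where "\<epsilon> = e / (L + norm (D x) + 1)"
      have \<epsilon>: "\<epsilon> > 0" "\<epsilon> * (L + norm (D x) + 1) = e" using e L0 add_nonneg_pos[OF add_nonneg_nonneg[OF L0 norm_ge_zero[of "D x"]], of 1]
        by (auto simp: \<epsilon>_def)
      have "sphere 0 1 \<subseteq> (\<Union>v\<in>V. ball v \<epsilon>)"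
      proof
        fix u :: 'a
        obtain v where "v \<in> V" "v \<in> ball u \<epsilon>" using V(2)[of "ball u \<epsilon>"] \<epsilon> by auto
        then show "u \<in> (\<Union>v\<in>V. ball v \<epsilon>)" by (auto simp: dist_commute)
      qed
      then obtain V0 where V0: "V0 \<subseteq> V" "finite V0" "sphere 0 1 \<subseteq> (\<Union>v\<in>V0. ball v \<epsilon>)"
        by (rule compactE_image[OF compact_sphere, rotated]) auto
      have "eventually (\<lambda>t. \<forall>v\<in>V0. dist (dirq f v x t) (D x \<bullet> v) < \<epsilon>) (at 0)"
        using V0 elim \<epsilon> by (intro eventually_ball_finite) (auto dest: tendstoD)
      then obtain d where d: "d > 0" "\<And>t v. t \<noteq> 0 \<Longrightarrow> \<bar>t\<bar> < d \<Longrightarrow> v \<in> V0 \<Longrightarrow> \<bar>dirq f v x t - D x \<bullet> v\<bar> < \<epsilon>"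
        by (auto simp: eventually_at dist_real_def)
      show "\<exists>d>0. \<forall>y\<in>UNIV. norm (y - x) < d \<longrightarrow> norm (f y - f x - D x \<bullet> (y - x)) \<le> e * norm (y - x)"
      proof (intro exI[of _ d] conjI ballI impI)
        fix y assume y: "norm (y - x) < d"
        show "norm (f y - f x - D x \<bullet> (y - x)) \<le> e * norm (y - x)"
        proof (cases "y = x")
          case False
          define t where "t = norm (y - x)"
          define u where "u = (1/t) *\<^sub>R (y - x)"
          have t: "t > 0" "t < d" using False y by (auto simp: t_def)
          have yx: "y = x + t *\<^sub>R u" using t by (simp add: u_def)
          have "norm u = 1" using t by (simp add: u_def t_def)
          then obtain v where v: "v \<in> V0" "norm (u - v) < \<epsilon>" using V0(3) by (force simp: dist_norm norm_minus_commute)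
          have 1: "\<bar>f y - f (x + t *\<^sub>R v)\<bar> \<le> L * (t * \<epsilon>)"
          proof -
            have "\<bar>f y - f (x + t *\<^sub>R v)\<bar> \<le> L * norm (t *\<^sub>R (u - v))"
              using lipschitz_onD[OF lip, of y "x + t *\<^sub>R v"] by (simp add: yx dist_norm algebra_simps)
            also have "\<dots> \<le> L * (t * \<epsilon>)" using t v L0 by (intro mult_left_mono) auto
            finally show ?thesis .
          qed
          have 2: "\<bar>f (x + t *\<^sub>R v) - f x - t * (D x \<bullet> v)\<bar> \<le> t * \<epsilon>"
          proof -
            have "f (x + t *\<^sub>R v) - f x - t * (D x \<bullet> v) = t * (dirq f v x t - D x \<bullet> v)"
              using t by (simp add: dirq_def field_simps)
            then have "\<bar>f (x + t *\<^sub>R v) - f x - t * (D x \<bullet> v)\<bar> = t * \<bar>dirq f v x t - D x \<bullet> v\<bar>"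
              using t by (simp add: abs_mult)
            also have "\<dots> \<le> t * \<epsilon>" using d(2)[of t v] t v by (intro mult_left_mono) auto
            finally show ?thesis .
          qed
          have 3: "\<bar>t * (D x \<bullet> v) - t * (D x \<bullet> u)\<bar> \<le> t * (norm (D x) * \<epsilon>)"
          proof -
            have "\<bar>t * (D x \<bullet> v) - t * (D x \<bullet> u)\<bar> = t * \<bar>D x \<bullet> (u - v)\<bar>"
              using t unfolding right_diff_distrib[symmetric] abs_mult by (simp add: inner_diff_right abs_minus_commute)
            also have "\<dots> \<le> t * (norm (D x) * \<epsilon>)"
              using t v by (intro mult_left_mono order_trans[OF Cauchy_Schwarz_ineq2]) auto
            finally show ?thesis .
          qed
          have "norm (f y - f x - D x \<bullet> (y - x)) = \<bar>f y - f x - t * (D x \<bullet> u)\<bar>" by (simp add: yx)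
          also have "\<dots> \<le> L * (t * \<epsilon>) + t * \<epsilon> + t * (norm (D x) * \<epsilon>)" using 1 2 3 by linarith
          also have "\<dots> = \<epsilon> * (L + norm (D x) + 1) * t" by (simp add: algebra_simps)
          finally show ?thesis by (simp add: \<epsilon> t_def)
        qed simp
      qed (use d in auto)
    qed
    then show ?case by (auto simp: differentiable_def)
  qed
qed

theorem Rademacher:
  fixes f :: "'a::euclidean_space \<Rightarrow> 'b::euclidean_space"
  assumes lip: "L-lipschitz_on UNIV f"
  shows "AE x in lebesgue. f differentiable (at x)"
proof -
  have "AE x in lborel. \<forall>i\<in>(Basis::'b set). (\<lambda>x. f x \<bullet> i) differentiable (at x)"
  proof (rule AE_ball_countable')
    fix i :: 'b assume i: "i \<in> Basis"
    have "L-lipschitz_on UNIV (\<lambda>x. f x \<bullet> i)"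
    proof (rule lipschitz_onI)
      fix x y
      have "dist (f x \<bullet> i) (f y \<bullet> i) \<le> dist (f x) (f y)"
        using Basis_le_norm[OF i, of "f x - f y"] by (simp add: dist_norm inner_diff_left)
      also have "\<dots> \<le> L * dist x y" by (rule lipschitz_onD[OF lip]) auto
      finally show "dist (f x \<bullet> i) (f y \<bullet> i) \<le> L * dist x y" .
    qed (rule lipschitz_on_nonneg[OF lip])
    then show "AE x in lborel. (\<lambda>x. f x \<bullet> i) differentiable (at x)" by (rule Rademacher_real)
  qed (simp add: countable_finite)
  then have "AE x in lborel. f differentiable (at x)"
    by eventually_elim (subst differentiable_componentwise_within)
  then show ?thesis by (rule AE_completion)
qed

section \<open>Aleksandrov's theorem\<close>

definition subgrad :: "('a::real_inner \<Rightarrow> real) \<Rightarrow> 'a \<Rightarrow> 'a \<Rightarrow> bool" where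
  "subgrad v x p \<longleftrightarrow> (\<forall>y. v x + p \<bullet> (y - x) \<le> v y)"

lemma subgradD: "subgrad v x p \<Longrightarrow> v x + p \<bullet> (y - x) \<le> v y"
  by (simp add: subgrad_def)

lemma subgrad_monotone:
  assumes "subgrad v x p" "subgrad v y q"
  shows "0 \<le> (p - q) \<bullet> (x - y)"
  using subgradD[OF assms(1), of y] subgradD[OF assms(2), of x]
  by (simp add: inner_diff_left inner_diff_right)

lemma subgrad_norm_le:
  assumes lip: "M-lipschitz_on UNIV v" and p: "subgrad v x p"
  shows "norm p \<le> M"
proof (cases "p = 0")
  case False
  have "norm p * norm p \<le> \<bar>v (x + p) - v x\<bar>" using subgradD[OF p, of "x + p"]
    by (simp add: dot_square_norm power2_eq_square)
  also have "\<dots> \<le> M * norm p" using lipschitz_onD[OF lip, of "x + p" x] by (simp add: dist_norm)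
  finally show ?thesis using False by simp
qed (use lipschitz_on_nonneg[OF lip] in simp)

text \<open>The point is the minimizer of \<open>v\<close> plus half the squared distance to
  \<open>z\<close>. Beyond distance \<open>2 * M\<close> the quadratic term outweighs any decrease
  of \<open>v\<close>, so minimizing over that ball is enough. Moving a little from \<open>x\<close>
  towards \<open>y\<close> and using convexity turns minimality into the subgradient
  inequality.\<close>

lemma prox_exists:
  fixes v :: "'a::euclidean_space \<Rightarrow> real"
  assumes cv: "convex_on UNIV v" and lip: "M-lipschitz_on UNIV v"
  shows "\<exists>x. subgrad v x (z - x)"
proof -
  have M0: "0 \<le> M" by (rule lipschitz_on_nonneg[OF lip])
  define \<phi> where "\<phi> y = v y + (norm (y - z))\<^sup>2 / 2" for y
  have "continuous_on (cball z (2*M)) \<phi>" unfolding \<phi>_def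
    by (intro continuous_intros continuous_on_subset[OF lipschitz_on_continuous_on[OF lip]]) auto
  then obtain x where x: "x \<in> cball z (2*M)" "\<And>y. y \<in> cball z (2*M) \<Longrightarrow> \<phi> x \<le> \<phi> y"
    using continuous_attains_inf[of "cball z (2*M)" \<phi>] M0 by auto
  have min: "\<phi> x \<le> \<phi> y" for y
  proof (cases "y \<in> cball z (2*M)")
    case False
    define r where "r = norm (y - z)"
    have r: "r > 2 * M" using False by (simp add: r_def dist_norm norm_minus_commute)
    have "v z - v y \<le> M * r" using lipschitz_onD[OF lip, of z y] by (auto simp: r_def dist_norm norm_minus_commute)
    moreover have "M * r \<le> r * r / 2" using r M0 mult_right_mono[of "2 * M" r r] by simp
    ultimately have "v z \<le> \<phi> y" by (simp add: \<phi>_def r_def[symmetric] power2_eq_square)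
    then show ?thesis using x(2)[of z] M0 by (simp add: \<phi>_def)
  qed (rule x(2))
  have "v x + (z - x) \<bullet> (y - x) \<le> v y" for y
  proof (rule field_le_epsilon)
    fix e :: real assume e: "e > 0"
    define N where "N = (norm (y - x))\<^sup>2"
    have N0: "N \<ge> 0" by (simp add: N_def)
    define t where "t = min 1 (e / (N + 1))"
    have t: "0 < t" "t \<le> 1" using e N0 by (auto simp: t_def)
    have tN: "t * N \<le> e"
    proof -
      have "t * N \<le> (e / (N + 1)) * (N + 1)" using N0 e by (intro mult_mono) (auto simp: t_def)
      then show ?thesis using N0 by simp
    qed
    let ?y = "x + t *\<^sub>R (y - x)"
    have "v ?y \<le> (1 - t) * v x + t * v y"
      using convex_onD[OF cv, of t x y] t by (simp add: algebra_simps)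
    moreover have "(norm (?y - z))\<^sup>2 = (norm (x - z))\<^sup>2 + 2 * t * ((x - z) \<bullet> (y - x)) + t * t * N"
    proof -
      have "?y - z = (x - z) + t *\<^sub>R (y - x)" by simp
      then show ?thesis unfolding N_def power2_norm_eq_inner by (simp add: inner_add_left inner_add_right inner_commute algebra_simps)
    qed
    moreover have "\<phi> x \<le> \<phi> ?y" by (rule min)
    ultimately have "0 \<le> t * (v y - v x + (x - z) \<bullet> (y - x) + t * N / 2)"
      by (simp add: \<phi>_def algebra_simps)
    then have "0 \<le> v y - v x + (x - z) \<bullet> (y - x) + t * N / 2" using t by (simp add: zero_le_mult_iff)
    then show "v x + (z - x) \<bullet> (y - x) \<le> v y + e" using tN e
      by (simp add: inner_diff_left)
  qed
  then show ?thesis by (auto simp: subgrad_def)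
qed

text \<open>Proximal points of \<open>c n * v\<close> with \<open>c n\<close> tending to 0 converge
  to \<open>x\<close>, and each carries a subgradient of \<open>v\<close> of norm at most
  \<open>M\<close>. A cluster point of these subgradients supports \<open>v\<close> at
  \<open>x\<close>, because the inequality passes to the limit.\<close>

lemma subgrad_exists:
  fixes v :: "'a::euclidean_space \<Rightarrow> real"
  assumes cv: "convex_on UNIV v" and lip: "M-lipschitz_on UNIV v"
  shows "\<exists>p. subgrad v x p"
proof -
  have M0: "0 \<le> M" by (rule lipschitz_on_nonneg[OF lip])
  define c where "c n = 1 / real (Suc n)" for n
  have c: "0 < c n" for n by (simp add: c_def)
  have "\<exists>y. subgrad (\<lambda>x. c n * v x) y (x - y)" for n
  proof (rule prox_exists)
    show "convex_on UNIV (\<lambda>x. c n * v x)" using c[of n] by (intro convex_on_cmul cv) auto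
    show "(c n * M)-lipschitz_on UNIV (\<lambda>x. c n * v x)" 
    proof (rule lipschitz_onI)
      fix a b
      have "c n * \<bar>v a - v b\<bar> \<le> c n * (M * dist a b)" using lipschitz_onD[OF lip, of a b] c[of n]
        by (intro mult_left_mono) (auto simp: dist_norm)
      then show "dist (c n * v a) (c n * v b) \<le> c n * M * dist a b"
        using c[of n] by (simp add: dist_real_def right_diff_distrib[symmetric] abs_mult)
    qed (use c[of n] M0 in simp)
  qed
  then obtain y where y: "\<And>n. subgrad (\<lambda>x. c n * v x) (y n) (x - y n)" by metis
  define p where "p n = (1 / c n) *\<^sub>R (x - y n)" for n
  have p: "subgrad v (y n) (p n)" for n
    unfolding subgrad_def
  proof
    fix z
    have "c n * (v (y n) + p n \<bullet> (z - y n)) \<le> c n * v z"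
      using subgradD[OF y[of n], of z] c[of n] by (simp add: p_def distrib_left)
    then show "v (y n) + p n \<bullet> (z - y n) \<le> v z" using c[of n] by simp
  qed
  have pM: "norm (p n) \<le> M" for n by (rule subgrad_norm_le[OF lip p])
  have "y n = x - c n *\<^sub>R p n" for n using c[of n] by (simp add: p_def)
  then have "y = (\<lambda>n. x - c n *\<^sub>R p n)" by auto
  moreover have "(\<lambda>n. c n *\<^sub>R p n) \<longlonglongrightarrow> 0"
  proof (rule Lim_null_comparison)
    show "eventually (\<lambda>n. norm (c n *\<^sub>R p n) \<le> c n * M) sequentially"
      using pM c by (intro always_eventually allI) (simp add: mult_left_mono less_imp_le)
    have "c \<longlonglongrightarrow> 0" unfolding c_def using LIMSEQ_inverse_real_of_nat by (simp add: divide_inverse)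
    then show "(\<lambda>n. c n * M) \<longlonglongrightarrow> 0" by (rule tendsto_mult_left_zero)
  qed
  ultimately have yx: "y \<longlonglongrightarrow> x" using tendsto_diff[OF tendsto_const[of x], of "\<lambda>n. c n *\<^sub>R p n" 0 sequentially] by simp
  obtain l r where r: "strict_mono r" "(p \<circ> r) \<longlonglongrightarrow> l"
    using compact_cball[of 0 M] pM unfolding compact_def by (metis mem_cball_0)
  have yr: "(\<lambda>n. y (r n)) \<longlonglongrightarrow> x" using LIMSEQ_subseq_LIMSEQ[OF yx r(1)] by (simp add: comp_def)
  have pr: "(\<lambda>n. p (r n)) \<longlonglongrightarrow> l" using r(2) by (simp add: comp_def)
  have "isCont v x" using lipschitz_on_continuous_on[OF lip] continuous_on_eq_continuous_at by blast
  then have vr: "(\<lambda>n. v (y (r n))) \<longlonglongrightarrow> v x" using yr by (rule isCont_tendsto_compose)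
  have "subgrad v x l" unfolding subgrad_def
  proof
    fix z
    have "(\<lambda>n. v (y (r n)) + p (r n) \<bullet> (z - y (r n))) \<longlonglongrightarrow> v x + l \<bullet> (z - x)"
      by (intro tendsto_intros vr pr yr)
    then show "v x + l \<bullet> (z - x) \<le> v z"
      by (rule LIMSEQ_le_const2) (use subgradD[OF p] in auto)
  qed
  then show ?thesis ..
qed

definition prox :: "('a::euclidean_space \<Rightarrow> real) \<Rightarrow> 'a \<Rightarrow> 'a" where
  "prox v z = (SOME x. subgrad v x (z - x))"

text \<open>Firm nonexpansiveness. Stated for the relation, it yields uniqueness of the proximal
  point as well as the Lipschitz bound, and it retains the direction of the displacement, which
  \<open>prox_growth\<close> exploits.\<close>

lemma subgrad_firm:
  assumes "subgrad v x (z - x)" "subgrad v x' (z' - x')"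
  shows "(norm (x - x'))\<^sup>2 \<le> (z - z') \<bullet> (x - x')"
  using subgrad_monotone[OF assms]
  by (simp add: power2_norm_eq_inner inner_diff_left inner_diff_right inner_commute algebra_simps)

locale convex_lipschitz =
  fixes v :: "'a::euclidean_space \<Rightarrow> real" and M :: real
  assumes cv: "convex_on UNIV v" and lip: "M-lipschitz_on UNIV v"
begin

lemma prox: "subgrad v (prox v z) (z - prox v z)"
  unfolding prox_def by (rule someI_ex[OF prox_exists[OF cv lip]])

lemma prox_eq: assumes "subgrad v x p" shows "prox v (x + p) = x"
proof -
  have "(norm (prox v (x + p) - x))\<^sup>2 \<le> 0"
    using subgrad_firm[OF prox[of "x + p"], of x "x + p"] assms by simp
  then show ?thesis by simp
qed

lemma prox_firm: "(norm (prox v z - prox v w))\<^sup>2 \<le> (z - w) \<bullet> (prox v z - prox v w)"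
  by (rule subgrad_firm[OF prox prox])

lemma prox_lipschitz: "1-lipschitz_on UNIV (prox v)"
proof (rule lipschitz_onI)
  fix z w
  let ?d = "norm (prox v z - prox v w)"
  have "?d * ?d \<le> norm (z - w) * ?d"
    using prox_firm[of z w] norm_cauchy_schwarz[of "z - w" "prox v z - prox v w"]
    by (simp add: power2_eq_square)
  then have "?d \<le> norm (z - w)" by (cases "?d = 0") (auto simp: mult_le_cancel_right)
  then show "dist (prox v z) (prox v w) \<le> 1 * dist z w" by (simp add: dist_norm)
qed simp

end

section \<open>Sard's lemma for Lipschitz maps\<close>

lemma scaled_measure:
  fixes S :: "'a::euclidean_space set"
  assumes "0 \<le> r"
  shows "measure lebesgue ((\<lambda>x. r *\<^sub>R x + a) ` S) = r ^ DIM('a) * measure lebesgue S"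
  using measure_lebesgue_affine[of r a S] assms by (simp add: add.commute)

lemma measure_cball_scale:
  fixes x :: "'a::euclidean_space"
  assumes "0 \<le> r"
  shows "measure lebesgue (cball x r) = r ^ DIM('a) * measure lebesgue (cball (0::'a) 1)"
  using content_cball[of r x] content_cball[of 1 "0::'a"] assms by simp

text \<open>Near a point where the derivative is singular, small balls are mapped into
  a thin neighbourhood of a degenerate ellipsoid.\<close>

lemma singular_derivative_image_small:
  fixes f :: "'a::euclidean_space \<Rightarrow> 'a"
  assumes cont: "continuous_on UNIV f" and der: "(f has_derivative A) (at z)" and sing: "\<not> inj A" and e: "e > 0"
  shows "\<exists>\<rho>>0. \<forall>r. 0 < r \<and> r < \<rho> \<longrightarrow> measure lebesgue (f ` cball z r) \<le> e * measure lebesgue (cball z r)"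
proof -
  have lin: "linear A" using der by (rule has_derivative_linear)
  let ?K = "A ` cball 0 1" and ?\<omega> = "measure lebesgue (cball (0::'a) 1)"
  have \<omega>: "?\<omega> > 0" using content_cball_pos[of 1 "0::'a"] by simp
  have K: "compact ?K" using lin by (intro compact_continuous_image linear_continuous_on) (auto simp: linear_conv_bounded_linear)
  have neg: "negligible ?K" by (rule negligible_linear_singular_image[OF lin sing])
  \<comment> \<open>A small neighbourhood of a bounded set with null frontier has almost the same
    volume; here that volume is 0.\<close>
  have "negligible (frontier ?K)"
    using neg frontier_subset_closed[OF compact_imp_closed[OF K]] negligible_subset by blast
  then obtain d where d: "d > 0" "\<And>T. T \<in> lmeasurable \<Longrightarrow> (\<And>y. y \<in> T \<Longrightarrow> \<exists>x. x \<in> ?K \<and> dist x y < d) \<Longrightarrow> measure lebesgue T < measure lebesgue ?K + e * ?\<omega>"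
    using measure_semicontinuous_with_hausdist_explicit[of ?K "e * ?\<omega>"] compact_imp_bounded[OF K] e \<omega> by (metis mult_pos_pos)
  have K0: "measure lebesgue ?K = 0" by (rule negligible_imp_measure0[OF neg])
  obtain \<rho> where \<rho>: "\<rho> > 0" "\<And>y. norm (y - z) < \<rho> \<Longrightarrow> norm (f y - f z - A (y - z)) \<le> d/2 * norm (y - z)"
    using der d(1) unfolding has_derivative_within_alt by (metis UNIV_I half_gt_zero)
  show ?thesis
  proof (intro exI[of _ \<rho>] conjI allI impI)
    fix r assume r: "0 < r \<and> r < \<rho>"
    \<comment> \<open>Rescaling the image by \<open>1/r\<close> brings it within \<open>d\<close> of
      the fixed set \<open>?K\<close>, so one \<open>d\<close> serves all small radii.\<close>
    define T where "T = (\<lambda>y. (1/r) *\<^sub>R y + (- (1/r)) *\<^sub>R f z) ` f ` cball z r"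
    have "compact T" unfolding T_def
      by (intro compact_continuous_image continuous_intros continuous_on_subset[OF cont] compact_cball) auto
    then have "T \<in> lmeasurable" by (rule lmeasurable_compact)
    moreover have "\<exists>x. x \<in> ?K \<and> dist x t < d" if t: "t \<in> T" for t
    proof -
      obtain y where y: "y \<in> cball z r" "t = (1/r) *\<^sub>R (f y - f z)" using t by (auto simp: T_def algebra_simps)
      have ny: "norm (y - z) \<le> r" using y by (simp add: dist_norm norm_minus_commute)
      let ?x = "A ((1/r) *\<^sub>R (y - z))"
      have "norm (t - ?x) = (1/r) * norm (f y - f z - A (y - z))"
        using r unfolding y linear_cmul[OF lin] scaleR_diff_right[symmetric] by simp
      also have "\<dots> \<le> (1/r) * (d/2 * norm (y - z))" using \<rho>(2)[of y] ny r by (intro mult_left_mono) auto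
      also have "\<dots> \<le> (1/r) * (d/2 * r)" using ny r d(1) by (intro mult_left_mono) auto
      also have "\<dots> < d" using r d(1) by simp
      finally have "dist ?x t < d" by (simp add: dist_norm norm_minus_commute)
      moreover have "?x \<in> ?K" using ny r by (intro imageI) (simp add: divide_le_eq)
      ultimately show ?thesis by blast
    qed
    ultimately have "measure lebesgue T < e * ?\<omega>" using d(2)[of T] K0 by simp
    moreover have "measure lebesgue T = (1/r) ^ DIM('a) * measure lebesgue (f ` cball z r)"
      unfolding T_def using r by (intro scaled_measure) auto
    ultimately have "measure lebesgue (f ` cball z r) < e * (r ^ DIM('a) * ?\<omega>)" using r
      by (simp add: field_simps)
    then show "measure lebesgue (f ` cball z r) \<le> e * measure lebesgue (cball z r)"
      using r measure_cball_scale[of r z] by (metis less_imp_le)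
  qed (rule \<rho>(1))
qed

text \<open>Disjoint balls whose images have only a small fraction of their volume cover the
  critical points up to a null set. The Lipschitz property takes care of what they miss: its image
  is null too.\<close>

lemma Sard_lipschitz:
  fixes f :: "'a::euclidean_space \<Rightarrow> 'a"
  assumes lip: "L-lipschitz_on UNIV f"
  shows "negligible (f ` {z. \<exists>A. (f has_derivative A) (at z) \<and> \<not> inj A})"
proof -
  let ?S = "{z. \<exists>A. (f has_derivative A) (at z) \<and> \<not> inj A}"
  have cont: "continuous_on UNIV f" by (rule lipschitz_on_continuous_on[OF lip])
  have neg_image: "negligible (f ` N)" if "negligible N" for N
    using that by (rule negligible_locally_Lipschitz_image[OF order_refl])
      (use lipschitz_onD[OF lip] in \<open>auto simp: dist_norm intro!: exI[of _ UNIV] exI[of _ L]\<close>)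
  have "negligible (f ` (?S \<inter> ball 0 (real m)))" for m :: nat
    unfolding negligible_outer_le
  proof (intro allI impI)
    fix e :: real assume e: "e > 0"
    let ?b = "measure lebesgue (ball (0::'a) (real m))"
    \<comment> \<open>The summand 1 avoids a division by 0 in the case \<open>m = 0\<close>, where
      the ball is empty.\<close>
    define e' where "e' = e / (?b + 1)"
    have e': "e' > 0" using e by (auto simp: e'_def add_nonneg_pos)
    have e'b: "e' * ?b \<le> e" 
    proof -
      have "e' * ?b \<le> e' * (?b + 1)" using e' by (intro mult_left_mono) auto
      also have "\<dots> = e" using add_nonneg_pos[of ?b 1] by (auto simp: e'_def)
      finally show ?thesis .
    qed
    have ex: "\<exists>r. 0 < r \<and> r < d \<and> measure lebesgue (f ` cball x r) \<le> e' * measure lebesgue (cball x r)"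
      if x: "x \<in> ?S \<inter> ball 0 (real m)" and d: "0 < d" for x d
    proof -
      obtain A where "(f has_derivative A) (at x)" "\<not> inj A" using x by blast
      from singular_derivative_image_small[OF cont this e']
      obtain \<rho> where "\<rho> > 0" "\<forall>r. 0 < r \<and> r < \<rho> \<longrightarrow> measure lebesgue (f ` cball x r) \<le> e' * measure lebesgue (cball x r)" by blast
      then show ?thesis using d by (intro exI[of _ "min \<rho> d / 2"]) auto
    qed
    obtain C where C: "countable C"
        "\<And>x r. (x, r) \<in> C \<Longrightarrow> x \<in> ?S \<inter> ball 0 (real m) \<and> 0 < r \<and> measure lebesgue (f ` cball x r) \<le> e' * measure lebesgue (cball x r) \<and> cball x r \<subseteq> ball 0 (real m)"
        "disjoint_family_on (\<lambda>p. cball (fst p) (snd p)) C"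
        "negligible (?S \<inter> ball 0 (real m) - (\<Union>p\<in>C. cball (fst p) (snd p)))"
      by (rule Vitali_centered_cballs[where P="\<lambda>x r. measure lebesgue (f ` cball x r) \<le> e' * measure lebesgue (cball x r)",
            OF open_ball Int_lower2 ex]) (assumption | rule that)+
    let ?B = "\<lambda>p. cball (fst p) (snd p)"
    have C2: "measure lebesgue (f ` ?B p) \<le> e' * measure lebesgue (?B p)" "?B p \<subseteq> ball 0 (real m)" if "p \<in> C" for p
      using C(2)[of "fst p" "snd p"] that by auto
    have lm: "f ` ?B p \<in> lmeasurable" for p
      by (intro lmeasurable_compact compact_continuous_image continuous_on_subset[OF cont] compact_cball) auto
    have bound: "measure lebesgue (\<Union>p\<in>I. f ` ?B p) \<le> e" if I: "I \<subseteq> C" "finite I" for I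
    proof -
      have "measure lebesgue (\<Union>p\<in>I. f ` ?B p) \<le> (\<Sum>p\<in>I. measure lebesgue (f ` ?B p))"
        using lm I by (intro measure_UNION_le) auto
      also have "\<dots> \<le> (\<Sum>p\<in>I. e' * measure lebesgue (?B p))"
        using C2 I by (intro sum_mono) auto
      also have "\<dots> = e' * measure lebesgue (\<Union>p\<in>I. ?B p)"
      proof -
        have "pairwise (\<lambda>p q. disjnt (?B p) (?B q)) I"
          unfolding pairwise_def disjnt_def using C(3) I(1) unfolding disjoint_family_on_def by blast
        then show ?thesis using I unfolding sum_distrib_left[symmetric]
          by (subst measure_UNION'[of I]) auto
      qed
      also have "\<dots> \<le> e' * ?b"
        using I e' by (intro mult_left_mono measure_mono_fmeasurable UN_least C2 sets.finite_UN) auto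
      finally show ?thesis using e'b by simp
    qed
    let ?T = "(\<Union>p\<in>C. f ` ?B p)" and ?N = "f ` (?S \<inter> ball 0 (real m) - (\<Union>p\<in>C. ?B p))"
    have T: "?T \<in> lmeasurable" "measure lebesgue ?T \<le> e"
      using fmeasurable_UN_bound[OF C(1) lm bound] measure_UN_bound[OF C(1) lm bound] by auto
    have N: "negligible ?N" by (rule neg_image[OF C(4)])
    show "\<exists>T. f ` (?S \<inter> ball 0 (real m)) \<subseteq> T \<and> T \<in> lmeasurable \<and> measure lebesgue T \<le> e"
    proof (intro exI conjI)
      show "f ` (?S \<inter> ball 0 (real m)) \<subseteq> ?T \<union> ?N" by blast
      show "?T \<union> ?N \<in> lmeasurable" by (intro fmeasurable.Un T negligible_imp_measurable N)
      have "measure lebesgue (?T \<union> ?N) \<le> measure lebesgue ?T + measure lebesgue ?N"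
        by (intro measure_Un_le fmeasurableD T negligible_imp_measurable N)
      then show "measure lebesgue (?T \<union> ?N) \<le> e" using T negligible_imp_measure0[OF N] by simp
    qed
  qed
  then have "negligible (\<Union>m. f ` (?S \<inter> ball 0 (real m)))"
    by (intro negligible_countable_Union) auto
  moreover have "f ` ?S \<subseteq> (\<Union>m. f ` (?S \<inter> ball 0 (real m)))"
  proof (rule image_subsetI)
    fix z assume "z \<in> ?S"
    moreover obtain m :: nat where "norm z < real m" using reals_Archimedean2 by blast
    ultimately show "f z \<in> (\<Union>m. f ` (?S \<inter> ball 0 (real m)))" by (intro UN_I[of m] imageI) auto
  qed
  ultimately show ?thesis by (rule negligible_subset)
qed

section \<open>Second order expansions from the proximal map\<close>

text \<open>With \<open>n\<close> equal steps the increments sum to at most \<open>C / n\<close>.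
  This takes the place of integrating a derivative, since \<psi> is not assumed
  differentiable.\<close>

lemma telescoping_le:
  fixes \<psi> :: "real \<Rightarrow> real"
  assumes "\<And>s t. 0 \<le> s \<Longrightarrow> s \<le> t \<Longrightarrow> t \<le> 1 \<Longrightarrow> \<psi> t - \<psi> s \<le> C * (t - s)\<^sup>2"
  shows "\<psi> 1 \<le> \<psi> 0"
proof -
  have "\<psi> 1 - \<psi> 0 \<le> C / real (Suc N)" for N
  proof -
    let ?n = "real (Suc N)"
    have "\<psi> 1 - \<psi> 0 = (\<Sum>i<Suc N. \<psi> (real (Suc i) / ?n) - \<psi> (real i / ?n))"
      by (subst sum_lessThan_telescope) simp
    also have "\<dots> \<le> (\<Sum>i<Suc N. C * (1 / ?n)\<^sup>2)"
    proof (rule sum_mono)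
      fix i assume i: "i \<in> {..<Suc N}"
      have "real (Suc i) / ?n - real i / ?n = 1 / ?n" by (simp add: diff_divide_distrib[symmetric])
      then show "\<psi> (real (Suc i) / ?n) - \<psi> (real i / ?n) \<le> C * (1 / ?n)\<^sup>2"
        using assms[of "real i / ?n" "real (Suc i) / ?n"] i by (auto simp: divide_right_mono)
    qed
    also have "\<dots> = C / ?n" by (simp add: power2_eq_square del: of_nat_Suc)
    finally show ?thesis .
  qed
  moreover have "(\<lambda>N. C / real (Suc N)) \<longlonglongrightarrow> 0"
    using LIMSEQ_Suc[OF lim_const_over_n[of C]] by simp
  ultimately have "\<psi> 1 - \<psi> 0 \<le> 0" by (intro LIMSEQ_le_const) auto
  then show ?thesis by simp
qed

text \<open>Subgradients at the two ends of a subsegment bound the increment of \<open>v\<close>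
  from both sides, so their linear expansion can be summed along the segment from \<open>x\<close>
  to \<open>y\<close>. The mismatch between the two ends is quadratic in the step and disappears by
  \<open>telescoping_le\<close>.\<close>

lemma taylor_of_subgrad:
  fixes v :: "'a::euclidean_space \<Rightarrow> real"
  assumes sub: "\<And>y. \<exists>q. subgrad v y q" and B: "linear B"
    and exp: "\<And>y q. norm (y - x) < \<delta> \<Longrightarrow> subgrad v y q \<Longrightarrow> norm (q - p - B (y - x)) \<le> \<epsilon> * norm (y - x)"
    and y: "norm (y - x) < \<delta>" and \<epsilon>: "\<epsilon> \<ge> 0"
  shows "\<bar>v y - v x - p \<bullet> (y - x) - (1/2) * ((y - x) \<bullet> B (y - x))\<bar> \<le> \<epsilon> * (norm (y - x))\<^sup>2"
proof -
  define h where "h = y - x"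
  define b where "b = h \<bullet> B h"
  define n where "n = \<epsilon> * (norm h)\<^sup>2"
  have n0: "n \<ge> 0" using \<epsilon> by (simp add: n_def)
  define \<phi> where "\<phi> s = v (x + s *\<^sub>R h) - s * (p \<bullet> h) - s\<^sup>2 / 2 * b" for s
  obtain g where g: "\<And>y. subgrad v y (g y)" using sub by metis
  let ?g = "\<lambda>s. g (x + s *\<^sub>R h) \<bullet> h"
  have gh: "\<bar>?g s - p \<bullet> h - s * b\<bar> \<le> s * n" if s: "0 \<le> s" "s \<le> 1" for s
  proof -
    have eq: "x + s *\<^sub>R h - x = s *\<^sub>R h" by simp
    have "norm (s *\<^sub>R h) \<le> norm h" using s by (simp add: mult_left_le_one_le)
    then have "norm (g (x + s *\<^sub>R h) - p - B (s *\<^sub>R h)) \<le> \<epsilon> * norm (s *\<^sub>R h)"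
      using exp[OF _ g, of "x + s *\<^sub>R h"] y by (simp add: h_def)
    then have "\<bar>(g (x + s *\<^sub>R h) - p - B (s *\<^sub>R h)) \<bullet> h\<bar> \<le> (\<epsilon> * norm (s *\<^sub>R h)) * norm h"
      by (intro order_trans[OF Cauchy_Schwarz_ineq2] mult_right_mono) auto
    also have "\<dots> = s * n" using s by (simp add: n_def power2_eq_square)
    finally show ?thesis using s by (simp add: inner_diff_left linear_cmul[OF B] b_def inner_commute[of "B h"])
  qed
  have up: "v (x + t *\<^sub>R h) - v (x + s *\<^sub>R h) \<le> (t - s) * ?g t" for s t
    using subgradD[OF g, of "x + t *\<^sub>R h" "x + s *\<^sub>R h"]
    by (simp add: scaleR_left_diff_distrib[symmetric] left_diff_distrib)
  have lo: "(t - s) * ?g s \<le> v (x + t *\<^sub>R h) - v (x + s *\<^sub>R h)" for s t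
    using subgradD[OF g, of "x + s *\<^sub>R h" "x + t *\<^sub>R h"]
    by (simp add: scaleR_left_diff_distrib[symmetric] left_diff_distrib)
  \<comment> \<open>The drift \<open>n * s\<close> absorbs the first order error of the
    subgradients; what remains of the increment is quadratic in \<open>t - s\<close>.\<close>
  have "(\<lambda>s. \<phi> s - n * s) 1 \<le> (\<lambda>s. \<phi> s - n * s) 0"
  proof (rule telescoping_le[where C="\<bar>b\<bar>/2"])
    fix s t :: real assume st: "0 \<le> s" "s \<le> t" "t \<le> 1"
    have "(t - s) * ?g t \<le> (t - s) * (p \<bullet> h + t * b + t * n)"
      using gh[of t] st by (intro mult_left_mono) auto
    then have "\<phi> t - \<phi> s \<le> (t - s) * (t * b + t * n) - (t\<^sup>2 - s\<^sup>2) / 2 * b"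
      using up[where s=s and t=t] by (simp add: \<phi>_def algebra_simps diff_divide_distrib)
    also have "\<dots> = b / 2 * (t - s)\<^sup>2 + (t - s) * t * n" by (simp add: power2_eq_square field_simps)
    also have "\<dots> \<le> \<bar>b\<bar> / 2 * (t - s)\<^sup>2 + (t - s) * 1 * n"
      using st n0 by (intro add_mono mult_right_mono mult_left_mono) auto
    finally show "(\<phi> t - n * t) - (\<phi> s - n * s) \<le> \<bar>b\<bar> / 2 * (t - s)\<^sup>2" by (simp add: algebra_simps)
  qed
  moreover have "(\<lambda>s. - \<phi> s - n * s) 1 \<le> (\<lambda>s. - \<phi> s - n * s) 0"
  proof (rule telescoping_le[where C="\<bar>b\<bar>/2"])
    fix s t :: real assume st: "0 \<le> s" "s \<le> t" "t \<le> 1"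
    have "(t - s) * (p \<bullet> h + s * b - s * n) \<le> (t - s) * ?g s"
      using gh[of s] st by (intro mult_left_mono) auto
    then have "\<phi> s - \<phi> t \<le> (t - s) * (s * n - s * b) + (t\<^sup>2 - s\<^sup>2) / 2 * b"
      using lo[where s=s and t=t] by (simp add: \<phi>_def algebra_simps diff_divide_distrib)
    also have "\<dots> = b / 2 * (t - s)\<^sup>2 + (t - s) * s * n" by (simp add: power2_eq_square field_simps)
    also have "\<dots> \<le> \<bar>b\<bar> / 2 * (t - s)\<^sup>2 + (t - s) * 1 * n"
      using st n0 by (intro add_mono mult_right_mono mult_left_mono) auto
    finally show "(- \<phi> t - n * t) - (- \<phi> s - n * s) \<le> \<bar>b\<bar> / 2 * (t - s)\<^sup>2" by (simp add: algebra_simps)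
  qed
  ultimately have "\<bar>\<phi> 1 - \<phi> 0\<bar> \<le> n" by simp
  then show ?thesis by (simp add: \<phi>_def h_def b_def n_def)
qed

context convex_lipschitz begin

text \<open>Monotonicity of the proximal map along rays makes a lower bound near \<open>z\<close> global.\<close>

lemma prox_growth:
  assumes c: "c > 0" and near: "\<And>w. norm (w - z) < \<rho>0 \<Longrightarrow> c * norm (w - z) \<le> norm (prox v w - prox v z)"
    and \<rho>: "0 < \<rho>" "\<rho> < \<rho>0" and w: "norm (w - z) \<ge> \<rho>"
  shows "c\<^sup>2 * \<rho> \<le> norm (prox v w - prox v z)"
proof -
  define s where "s = norm (w - z)"
  define e where "e = (1/s) *\<^sub>R (w - z)"
  have s: "s \<ge> \<rho>" "s > 0" using w \<rho> by (auto simp: s_def)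
  have e1: "norm e = 1" using s by (simp add: e_def s_def)
  have ws: "w = z + s *\<^sub>R e" using s by (simp add: e_def)
  define w' where "w' = z + \<rho> *\<^sub>R e"
  have nw': "norm (w' - z) = \<rho>" using e1 \<rho> by (simp add: w'_def)
  \<comment> \<open>Firmness turns the bound on the norm into one on the component along the ray, at
    the price of squaring \<open>c\<close>. By monotonicity that component can only grow further
    out.\<close>
  have "(c * \<rho>)\<^sup>2 \<le> (norm (prox v w' - prox v z))\<^sup>2"
    using near[of w'] nw' c \<rho> by (intro power_mono) auto
  also have "\<dots> \<le> \<rho> * (e \<bullet> (prox v w' - prox v z))" using prox_firm[of w' z] by (simp add: w'_def)
  finally have "\<rho> * (c\<^sup>2 * \<rho>) \<le> \<rho> * (e \<bullet> (prox v w' - prox v z))" by (simp add: power2_eq_square mult_ac)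
  then have 1: "c\<^sup>2 * \<rho> \<le> e \<bullet> (prox v w' - prox v z)" using \<rho> by simp
  have 2: "0 \<le> e \<bullet> (prox v w - prox v w')"
  proof (cases "s = \<rho>")
    case False
    have "w - w' = (s - \<rho>) *\<^sub>R e" by (simp add: ws w'_def algebra_simps)
    then have "0 \<le> (s - \<rho>) * (e \<bullet> (prox v w - prox v w'))"
      using prox_firm[of w w'] by (metis inner_scaleR_left order_trans zero_le_power2)
    then show ?thesis using False s by (simp add: zero_le_mult_iff)
  qed (simp add: ws w'_def)
  have "c\<^sup>2 * \<rho> \<le> e \<bullet> (prox v w - prox v z)" using 1 2 by (simp add: inner_diff_right)
  also have "\<dots> \<le> norm (prox v w - prox v z)" using norm_cauchy_schwarz[of e] e1 by simp
  finally show ?thesis .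
qed

text \<open>A point \<open>y\<close> with a subgradient \<open>q\<close> corresponds to
  \<open>w = y + q\<close> with \<open>prox v w = y\<close>. Inverting the expansion of
  \<open>prox v\<close> at \<open>z\<close> gives \<open>w - z\<close>, and thus
  \<open>q - p\<close>, to first order in \<open>y - x\<close>; hence \<open>B\<close> is the
  inverse of \<open>A\<close> minus the identity.\<close>

lemma second_order_at_prox:
  assumes der: "(prox v has_derivative A) (at z)" and inj: "inj A" and x: "x = prox v z"
  obtains p B where "linear B" "((\<lambda>y. (v y - v x - p \<bullet> (y - x) - (1/2) * ((y - x) \<bullet> B (y - x))) / (norm (y - x))\<^sup>2) \<longlongrightarrow> 0) (at x)"
proof -
  have lin: "linear A" using der by (rule has_derivative_linear)
  obtain A' where A': "linear A'" "\<And>h. A' (A h) = h" "\<And>h. A (A' h) = h"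
    using linear_injective_isomorphism[OF lin inj] by metis
  obtain K where K: "K > 0" "\<And>h. norm (A' h) \<le> K * norm h"
    using linear_bounded_pos[OF A'(1)] by blast
  \<comment> \<open>\<open>norm (A h)\<close> is at least \<open>norm h / K\<close>, which is
    \<open>2 * c * norm h\<close>; half of this is sacrificed to the remainder of the
    expansion.\<close>
  define c where "c = 1 / (2 * K)"
  have c: "c > 0" using K by (simp add: c_def)
  define p where "p = z - x"
  define B where "B h = A' h - h" for h
  have B: "linear B" unfolding B_def using A'(1) by (intro linear_compose_sub) (auto simp: linear_id[unfolded id_def])
  have derE: "\<exists>d>0. \<forall>y. norm (y - z) < d \<longrightarrow> norm (prox v y - prox v z - A (y - z)) \<le> e * norm (y - z)" if "e > 0" for e
    using der that unfolding has_derivative_within_alt by auto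
  obtain \<rho>0 where \<rho>0: "\<rho>0 > 0" "\<And>w. norm (w - z) < \<rho>0 \<Longrightarrow> norm (prox v w - prox v z - A (w - z)) \<le> c * norm (w - z)"
    using derE[OF c] by blast
  have near: "c * norm (w - z) \<le> norm (prox v w - prox v z)" if w: "norm (w - z) < \<rho>0" for w
  proof -
    have "norm (w - z) \<le> K * norm (A (w - z))" using K(2)[of "A (w - z)"] A'(2) by simp
    then have "2 * c * norm (w - z) \<le> norm (A (w - z))" using K by (simp add: c_def field_simps)
    moreover have "norm (A (w - z)) \<le> norm (prox v w - prox v z) + norm (prox v w - prox v z - A (w - z))"
      using norm_triangle_ineq4[of "prox v w - prox v z" "prox v w - prox v z - A (w - z)"] by simp
    ultimately show ?thesis using \<rho>0(2)[OF w] by simp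
  qed
  have exp: "\<exists>\<delta>>0. \<forall>y q. norm (y - x) < \<delta> \<longrightarrow> subgrad v y q \<longrightarrow> norm (q - p - B (y - x)) \<le> \<epsilon> * norm (y - x)" if \<epsilon>: "\<epsilon> > 0" for \<epsilon>
  proof -
    define \<epsilon>' where "\<epsilon>' = \<epsilon> * c / K"
    have \<epsilon>': "\<epsilon>' > 0" "K * \<epsilon>' = \<epsilon> * c" using \<epsilon> c K by (auto simp: \<epsilon>'_def)
    obtain \<rho>1 where \<rho>1: "\<rho>1 > 0" "\<And>w. norm (w - z) < \<rho>1 \<Longrightarrow> norm (prox v w - prox v z - A (w - z)) \<le> \<epsilon>' * norm (w - z)"
      using derE[OF \<epsilon>'(1)] by blast
    define \<rho> where "\<rho> = min \<rho>0 \<rho>1 / 2"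
    have \<rho>: "0 < \<rho>" "\<rho> < \<rho>0" "\<rho> < \<rho>1" using \<rho>0 \<rho>1 by (auto simp: \<rho>_def)
    show ?thesis
    proof (intro exI[of _ "c\<^sup>2 * \<rho>"] conjI allI impI)
      fix y q assume y: "norm (y - x) < c\<^sup>2 * \<rho>" and q: "subgrad v y q"
      define w where "w = y + q"
      have w: "prox v w = y" unfolding w_def by (rule prox_eq[OF q])
      \<comment> \<open>\<open>prox_growth\<close> excludes distant \<open>w\<close>: one at
        distance \<rho> or more from \<open>z\<close> would be mapped at least
        \<open>c * c * \<rho>\<close> away from \<open>x\<close>.\<close>
      have wz: "norm (w - z) < \<rho>"
        using prox_growth[OF c near \<rho>(1,2), of w] y w x by (force simp: not_less[symmetric])
      have 1: "c * norm (w - z) \<le> norm (y - x)" using near[of w] wz \<rho> w x by simp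
      have "A' (y - x - A (w - z)) = A' (y - x) - (w - z)"
        by (simp only: linear_diff[OF A'(1), of "y - x"] A'(2))
      then have "q - p - B (y - x) = - A' (y - x - A (w - z))"
        by (simp add: B_def p_def w_def)
      then have "norm (q - p - B (y - x)) \<le> K * norm (y - x - A (w - z))" using K(2) by simp
      also have "\<dots> \<le> K * (\<epsilon>' * norm (w - z))" using \<rho>1(2)[of w] wz \<rho> w x K by (intro mult_left_mono) auto
      also have "\<dots> = \<epsilon> * (c * norm (w - z))" using \<epsilon>'(2) by (metis mult.assoc)
      also have "\<dots> \<le> \<epsilon> * norm (y - x)" using 1 \<epsilon> by (intro mult_left_mono) auto
      finally show "norm (q - p - B (y - x)) \<le> \<epsilon> * norm (y - x)" .
    qed (use c \<rho> in simp)
  qed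
  have "((\<lambda>y. (v y - v x - p \<bullet> (y - x) - (1/2) * ((y - x) \<bullet> B (y - x))) / (norm (y - x))\<^sup>2) \<longlongrightarrow> 0) (at x)"
  proof (rule tendstoI)
    fix e :: real assume e: "e > 0"
    obtain \<delta> where \<delta>: "\<delta> > 0" "\<And>y q. norm (y - x) < \<delta> \<Longrightarrow> subgrad v y q \<Longrightarrow> norm (q - p - B (y - x)) \<le> e/2 * norm (y - x)"
      using exp[of "e/2"] e by auto
    have "dist ((v y - v x - p \<bullet> (y - x) - (1/2) * ((y - x) \<bullet> B (y - x))) / (norm (y - x))\<^sup>2) 0 < e"
      if y: "y \<noteq> x" "dist y x < \<delta>" for y
    proof -
      have "\<bar>v y - v x - p \<bullet> (y - x) - (1/2) * ((y - x) \<bullet> B (y - x))\<bar> \<le> e/2 * (norm (y - x))\<^sup>2"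
        using y e by (intro taylor_of_subgrad[OF subgrad_exists[OF cv lip] B \<delta>(2)]) (auto simp: dist_norm)
      moreover have "(norm (y - x))\<^sup>2 > 0" using y by simp
      ultimately have "\<bar>v y - v x - p \<bullet> (y - x) - (1/2) * ((y - x) \<bullet> B (y - x))\<bar> / \<bar>(norm (y - x))\<^sup>2\<bar> \<le> e/2"
        by (simp add: pos_divide_le_eq)
      also have "\<dots> < e" using e by simp
      finally show ?thesis unfolding dist_real_def diff_0_right abs_divide .
    qed
    then show "eventually (\<lambda>y. dist ((v y - v x - p \<bullet> (y - x) - (1/2) * ((y - x) \<bullet> B (y - x))) / (norm (y - x))\<^sup>2) 0 < e) (at x)"
      unfolding eventually_at using \<delta>(1) by blast
  qed
  with B show ?thesis by (rule that)
qed

theorem Aleksandrov: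
  "AE x in lebesgue. \<exists>p B. linear B \<and>
     ((\<lambda>y. (v y - v x - p \<bullet> (y - x) - (1/2) * ((y - x) \<bullet> B (y - x))) / (norm (y - x))\<^sup>2) \<longlongrightarrow> 0) (at x)"
proof -
  obtain N where N: "negligible N" "{z. \<not> prox v differentiable (at z)} \<subseteq> N"
    using Rademacher[OF prox_lipschitz] unfolding eventually_ae_filter_negligible by blast
  let ?S = "{z. \<exists>A. (prox v has_derivative A) (at z) \<and> \<not> inj A}"
  have "negligible (prox v ` N)"
    using N(1) by (rule negligible_locally_Lipschitz_image[OF order_refl])
      (use lipschitz_onD[OF prox_lipschitz] in \<open>auto simp: dist_norm intro!: exI[of _ UNIV] exI[of _ 1]\<close>)
  moreover have "negligible (prox v ` ?S)" by (rule Sard_lipschitz[OF prox_lipschitz])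
  ultimately have neg: "negligible (prox v ` N \<union> prox v ` ?S)" by (rule negligible_Un)
  have ex: "\<exists>p B. linear B \<and>
     ((\<lambda>y. (v y - v x - p \<bullet> (y - x) - (1/2) * ((y - x) \<bullet> B (y - x))) / (norm (y - x))\<^sup>2) \<longlongrightarrow> 0) (at x)"
    if x: "x \<notin> prox v ` N \<union> prox v ` ?S" for x
  proof -
    obtain p where "subgrad v x p" using subgrad_exists[OF cv lip] by blast
    then have xz: "x = prox v (x + p)" by (simp add: prox_eq)
    then have "x + p \<notin> N" "x + p \<notin> ?S" using x by blast+
    then obtain A where "(prox v has_derivative A) (at (x + p))" "inj A"
      using N(2) by (auto simp: differentiable_def)
    then show ?thesis by (rule second_order_at_prox[OF _ _ xz]) (intro exI conjI)
  qed
  show ?thesis unfolding eventually_ae_filter_negligible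
  proof (intro exI conjI subsetI)
    show "negligible (prox v ` N \<union> prox v ` ?S)" by (rule neg)
    fix x assume "x \<in> {x. \<not> (\<exists>p B. linear B \<and>
     ((\<lambda>y. (v y - v x - p \<bullet> (y - x) - (1/2) * ((y - x) \<bullet> B (y - x))) / (norm (y - x))\<^sup>2) \<longlongrightarrow> 0) (at x))}"
    from CollectD[OF this] show "x \<in> prox v ` N \<union> prox v ` ?S"
      by (rule contrapos_np) (rule ex)
  qed
qed

end

section \<open>Change of variables over finite index types\<close>

text \<open>The change of variables theorem of the library asks for a well-ordered index type. Every finite
  type has a well-ordered copy, and the theorem is transported along it.\<close>

typedef 'a wo = "UNIV :: 'a set" morphisms un_wo to_wo by blast

lemma bij_un_wo: "bij un_wo"
  by (metis bijI' to_wo_inverse un_wo_inject UNIV_I)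

lemma bij_to_wo: "bij to_wo"
  by (metis bijI' un_wo_inverse to_wo_inject UNIV_I)

instance wo :: (finite) finite
proof
  have "(UNIV :: 'a wo set) = range to_wo" using bij_to_wo by (auto simp: bij_def)
  then show "finite (UNIV :: 'a wo set)" by (metis finite_imageI finite)
qed

definition wo_rank :: "'a::finite wo \<Rightarrow> nat" where
  "wo_rank = (SOME f. inj f)"

lemma inj_wo_rank: "inj (wo_rank :: 'a::finite wo \<Rightarrow> nat)"
proof -
  have "\<exists>f :: 'a wo \<Rightarrow> nat. inj f"
    using finite_imp_inj_to_nat_seg[of "UNIV :: 'a wo set"] by auto
  then show ?thesis unfolding wo_rank_def by (rule someI_ex)
qed

instantiation wo :: (finite) wellorder
begin

definition less_eq_wo :: "'a wo \<Rightarrow> 'a wo \<Rightarrow> bool" where "less_eq_wo x y \<longleftrightarrow> wo_rank x \<le> wo_rank y"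
definition less_wo :: "'a wo \<Rightarrow> 'a wo \<Rightarrow> bool" where "less_wo x y \<longleftrightarrow> wo_rank x < wo_rank y"

instance
proof
  fix x y z :: "'a wo" and P :: "'a wo \<Rightarrow> bool"
  show "x < y \<longleftrightarrow> x \<le> y \<and> \<not> y \<le> x" "x \<le> x" "x \<le> y \<Longrightarrow> y \<le> z \<Longrightarrow> x \<le> z" "x \<le> y \<or> y \<le> x"
    by (auto simp: less_eq_wo_def less_wo_def)
  show "x \<le> y \<Longrightarrow> y \<le> x \<Longrightarrow> x = y"
    using inj_wo_rank by (auto simp: less_eq_wo_def dest: injD)
  assume step: "\<And>x. (\<And>y. y < x \<Longrightarrow> P y) \<Longrightarrow> P x"
  show "P x"
    by (induction x rule: measure_induct_rule[of wo_rank]) (auto intro: step simp: less_wo_def)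
qed

end

definition reindex :: "('m \<Rightarrow> 'n) \<Rightarrow> 'a^'n \<Rightarrow> 'a^'m" where
  "reindex e x = (\<chi> i. x $ e i)"

lemma linear_reindex: "linear (reindex e :: real^'n \<Rightarrow> real^'m)"
  by (intro linearI) (auto simp: reindex_def vec_eq_iff)

lemma bounded_linear_reindex: "bounded_linear (reindex e :: real^'n \<Rightarrow> real^'m)"
  using linear_reindex linear_conv_bounded_linear by blast

lemma distr_lborel_reindex:
  fixes e :: "'m::finite \<Rightarrow> 'n::finite"
  assumes e: "bij e"
  shows "distr lborel lborel (reindex e :: real^'n \<Rightarrow> real^'m) = lborel"
proof (rule lborel_eqI[symmetric])
  let ?R = "reindex e :: real^'n \<Rightarrow> real^'m"
  have m: "?R \<in> borel_measurable borel"
    by (intro borel_measurable_continuous_onI linear_continuous_on bounded_linear_reindex)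
  define d where "d = inv e"
  have ed: "e (d i) = i" "d (e j) = j" for i j using e by (simp_all add: d_def bij_is_surj surj_f_inv_f bij_is_inj)
  have bd: "bij d" unfolding d_def by (rule bij_imp_bij_inv[OF e])
  fix l u :: "real^'m" assume lu: "\<And>b. b \<in> Basis \<Longrightarrow> l \<bullet> b \<le> u \<bullet> b"
  have lu': "l $ i \<le> u $ i" for i using lu[of "axis i 1"] by (simp add: axis_in_Basis_iff inner_axis)
  have vim: "?R -` box l u = box (reindex d l) (reindex d u)"
    by (auto simp: mem_box_cart reindex_def ed) (metis ed)+
  have c1: "measure lborel (cbox l u) = (\<Prod>i\<in>UNIV. u $ i - l $ i)"
    using lu' by (intro content_cbox_cart) (auto simp: interval_eq_empty_cart not_less)
  have "measure lborel (cbox (reindex d l) (reindex d u)) = (\<Prod>i\<in>UNIV. u $ d i - l $ d i)"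
    using lu' by (subst content_cbox_cart) (auto simp: interval_eq_empty_cart not_less reindex_def)
  also have "\<dots> = (\<Prod>i\<in>UNIV. u $ i - l $ i)"
    using bd by (rule prod.reindex_bij_betw)
  finally have c2: "measure lborel (cbox (reindex d l) (reindex d u)) = measure lborel (cbox l u)" using c1 by simp
  have box: "emeasure lborel (box a b) = ennreal (measure lborel (cbox a b))" for a b :: "real^'k::finite"
  proof -
    have "emeasure lborel (box a b) = emeasure lborel (cbox a b)"
      by (simp add: emeasure_lborel_box_eq emeasure_lborel_cbox_eq)
    also have "\<dots> = ennreal (measure lborel (cbox a b))"
      using emeasure_lborel_cbox_finite[of a b] by (intro emeasure_eq_ennreal_measure) auto
    finally show ?thesis .
  qed
  have "emeasure (distr lborel lborel ?R) (box l u) = emeasure lborel (box l u)"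
    using m by (simp add: emeasure_distr vim box c2)
  also have "\<dots> = ennreal (\<Prod>b\<in>Basis. (u - l) \<bullet> b)" using lu by (intro emeasure_lborel_box)
  finally show "emeasure (distr lborel lborel ?R) (box l u) = ennreal (\<Prod>b\<in>Basis. (u - l) \<bullet> b)" .
qed simp

lemma lebesgue_reindex:
  fixes e :: "'m::finite \<Rightarrow> 'n::finite"
  assumes e: "bij e"
  shows "(reindex e :: real^'n \<Rightarrow> real^'m) \<in> lebesgue \<rightarrow>\<^sub>M lebesgue" (is ?m)
    and "distr lebesgue lebesgue (reindex e :: real^'n \<Rightarrow> real^'m) = lebesgue" (is ?d)
proof -
  let ?R = "reindex e :: real^'n \<Rightarrow> real^'m"
  have m: "?R \<in> borel_measurable borel"
    by (intro borel_measurable_continuous_onI linear_continuous_on bounded_linear_reindex)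
  then have m': "?R \<in> lborel \<rightarrow>\<^sub>M lborel" by simp
  then have m2: "?R \<in> lebesgue \<rightarrow>\<^sub>M lborel" by (rule measurable_completion)
  have d: "distr lebesgue lborel ?R = lborel"
    using distr_completion[OF m'] distr_lborel_reindex[OF e] by simp
  show ?m by (rule completion.measurable_completion2[OF m2]) (simp add: d)
  show ?d using completion.completion_distr_eq[OF m2] by (simp add: d)
qed

lemma reindex_inverse:
  assumes "bij e"
  shows "reindex (inv e) (reindex e x) = x" "reindex e (reindex (inv e) y) = y"
  using assms by (auto simp: reindex_def vec_eq_iff bij_is_surj surj_f_inv_f bij_is_inj)

lemma reindex_image_eq_vimage:
  assumes "bij e" shows "reindex e ` S = reindex (inv e) -` S"
proof (intro equalityI subsetI)
  fix y assume "y \<in> reindex (inv e) -` S"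
  then have "reindex e (reindex (inv e) y) \<in> reindex e ` S" by (intro imageI) auto
  then show "y \<in> reindex e ` S" by (simp only: reindex_inverse(2)[OF assms])
qed (auto simp: reindex_inverse(1)[OF assms])

lemma reindex_image_lebesgue:
  fixes e :: "'m::finite \<Rightarrow> 'n::finite" and S :: "(real^'n) set"
  assumes e: "bij e" and S: "S \<in> sets lebesgue"
  shows "reindex e ` S \<in> sets lebesgue" "emeasure lebesgue (reindex e ` S) = emeasure lebesgue S"
proof -
  note R = lebesgue_reindex[OF bij_imp_bij_inv[OF e]]
  show "reindex e ` S \<in> sets lebesgue" using measurable_sets[OF R(1) S] by (simp add: reindex_image_eq_vimage[OF e])
  have "emeasure lebesgue S = emeasure (distr lebesgue lebesgue (reindex (inv e) :: real^'m \<Rightarrow> real^'n)) S" by (simp add: R(2))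
  also have "\<dots> = emeasure lebesgue (reindex e ` S)"
    using R(1) S by (subst emeasure_distr) (auto simp: reindex_image_eq_vimage[OF e])
  finally show "emeasure lebesgue (reindex e ` S) = emeasure lebesgue S" by simp
qed

lemma swapidseq_conj:
  assumes "swapidseq n p" "bij f"
  shows "swapidseq n (f \<circ> p \<circ> inv f)"
  using assms(1)
proof (induction rule: swapidseq.induct)
  case id
  have "f \<circ> id \<circ> inv f = id" using assms(2) by (auto simp: fun_eq_iff bij_is_surj surj_f_inv_f)
  then show ?case by (simp only: swapidseq.id)
next
  case (comp_Suc n p a b)
  have inj: "inj f" using assms(2) by (rule bij_is_inj)
  have "f \<circ> (Transposition.transpose a b \<circ> p) \<circ> inv f = Transposition.transpose (f a) (f b) \<circ> (f \<circ> p \<circ> inv f)"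
    using inj by (auto simp: fun_eq_iff Transposition.transpose_def dest: injD)
  moreover have "f a \<noteq> f b" using inj comp_Suc by (auto dest: injD)
  ultimately show ?case using comp_Suc swapidseq.comp_Suc by metis
qed

lemma sign_conj:
  assumes p: "permutation p" and f: "bij f"
  shows "sign (f \<circ> p \<circ> inv f) = sign p"
proof -
  obtain n where n: "swapidseq n p" using p by (auto simp: permutation_def)
  have "evenperm p = even n" "evenperm (f \<circ> p \<circ> inv f) = even n"
    using evenperm_unique[OF n] evenperm_unique[OF swapidseq_conj[OF n f]] by auto
  then show ?thesis by (simp add: sign_def)
qed

text \<open>The permutations of the two index types correspond by conjugation with \<open>e\<close>,
  which keeps the sign because a conjugate of a transposition is a transposition.\<close>

lemma det_reindex:
  fixes A :: "real^'n::finite^'n" and e :: "'m::finite \<Rightarrow> 'n"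
  assumes e: "bij e"
  shows "det (\<chi> i j. A $ e i $ e j) = det A"
proof -
  have "det A = (\<Sum>p | p permutes (UNIV::'n set). of_int (sign p) * (\<Prod>i\<in>UNIV. A $ i $ p i))"
    by (simp add: det_def)
  also have "\<dots> = (\<Sum>q | q permutes (UNIV::'m set). of_int (sign (e \<circ> q \<circ> inv e)) * (\<Prod>i\<in>UNIV. A $ i $ (e \<circ> q \<circ> inv e) i))"
  proof (rule sum.reindex_bij_betw[symmetric])
    have permutes_UNIV: "p permutes UNIV \<longleftrightarrow> bij p" for p :: "'k \<Rightarrow> 'k"
      by (auto intro: bij_imp_permutes permutes_bij)
    have b1: "bij (e \<circ> q \<circ> inv e)" if "bij q" for q using that e by (intro bij_comp bij_imp_bij_inv)
    have b2: "bij (inv e \<circ> q \<circ> e)" if "bij q" for q using that e by (intro bij_comp bij_imp_bij_inv)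
    have ei: "inv e (e x) = x" "e (inv e y) = y" for x y using e by (simp_all add: bij_is_inj bij_is_surj surj_f_inv_f)
    show "bij_betw (\<lambda>q. e \<circ> q \<circ> inv e) {q. q permutes (UNIV::'m set)} {p. p permutes (UNIV::'n set)}"
    proof (rule bij_betwI[where g="\<lambda>q. inv e \<circ> q \<circ> e"])
      show "(\<lambda>q. e \<circ> q \<circ> inv e) \<in> {q. q permutes (UNIV::'m set)} \<rightarrow> {p. p permutes (UNIV::'n set)}"
        using b1 by (auto simp: permutes_UNIV)
      show "(\<lambda>q. inv e \<circ> q \<circ> e) \<in> {q. q permutes (UNIV::'n set)} \<rightarrow> {p. p permutes (UNIV::'m set)}"
        using b2 by (auto simp: permutes_UNIV)
    qed (auto simp: fun_eq_iff ei)
  qed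
  also have "\<dots> = (\<Sum>q | q permutes (UNIV::'m set). of_int (sign q) * (\<Prod>i\<in>UNIV. A $ e i $ e (q i)))"
  proof (rule sum.cong[OF refl])
    fix q assume "q \<in> {q. q permutes (UNIV::'m set)}"
    then have "permutation q" by (auto simp: permutation_permutes)
    then have s: "sign (e \<circ> q \<circ> inv e) = sign q" by (rule sign_conj[OF _ e])
    have "(\<Prod>i\<in>UNIV. A $ e i $ (e \<circ> q \<circ> inv e) (e i)) = (\<Prod>i\<in>UNIV. A $ i $ (e \<circ> q \<circ> inv e) i)"
      using e by (rule prod.reindex_bij_betw)
    then show "of_int (sign (e \<circ> q \<circ> inv e)) * (\<Prod>i\<in>UNIV. A $ i $ (e \<circ> q \<circ> inv e) i) =
         of_int (sign q) * (\<Prod>i\<in>UNIV. A $ e i $ e (q i))" using e by (simp add: s bij_is_inj)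
  qed
  also have "\<dots> = det (\<chi> i j. A $ e i $ e j)" by (simp add: det_def)
  finally show ?thesis by simp
qed

lemma matrix_reindex_conj:
  fixes A :: "real^'n::finite^'n" and e :: "'m::finite \<Rightarrow> 'n"
  assumes e: "bij e"
  shows "reindex e (A *v reindex (inv e) h) = (\<chi> i j. A $ e i $ e j) *v h"
proof -
  have "(\<Sum>j\<in>UNIV. A $ k $ j * h $ inv e j) = (\<Sum>j\<in>UNIV. A $ k $ e j * h $ inv e (e j))" for k
    using e by (rule sum.reindex_bij_betw[symmetric])
  then show ?thesis using e by (simp add: reindex_def vec_eq_iff matrix_vector_mult_def bij_is_inj)
qed

lemma measure_matrix_image:
  fixes A :: "real^'n::finite^'n"
  assumes S: "S \<in> lmeasurable"
  shows "(*v) A ` S \<in> lmeasurable" "measure lebesgue ((*v) A ` S) = \<bar>det A\<bar> * measure lebesgue S"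
proof -
  let ?R = "reindex un_wo :: real^'n \<Rightarrow> real^'n wo" and ?R' = "reindex (inv un_wo) :: real^'n wo \<Rightarrow> real^'n"
  let ?A = "(\<chi> i j. A $ un_wo i $ un_wo j) :: real^'n wo^'n wo"
  note e = bij_un_wo and e' = bij_imp_bij_inv[OF bij_un_wo]
  have Slm: "?R ` S \<in> lmeasurable" "measure lebesgue (?R ` S) = measure lebesgue S"
    using reindex_image_lebesgue[OF e, of S] S by (auto simp: fmeasurable_def measure_def)
  have lin: "linear ((*v) ?A)" by (rule matrix_vector_mul_linear)
  have im: "(*v) ?A ` ?R ` S = ?R ` (*v) A ` S"
    unfolding image_image matrix_reindex_conj[OF e, symmetric] reindex_inverse(1)[OF e] ..
  have 1: "?R ` (*v) A ` S \<in> lmeasurable" "measure lebesgue (?R ` (*v) A ` S) = \<bar>det A\<bar> * measure lebesgue S"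
    using measurable_linear_image[OF lin Slm(1)] measure_linear_image[OF lin Slm(1)] det_reindex[OF e, of A] Slm(2)
    unfolding im by auto
  have 2: "?R' ` ?R ` T = T" for T by (simp add: image_image reindex_inverse(1)[OF e])
  show "(*v) A ` S \<in> lmeasurable" "measure lebesgue ((*v) A ` S) = \<bar>det A\<bar> * measure lebesgue S"
    using reindex_image_lebesgue[OF e', of "?R ` (*v) A ` S"] 1 unfolding 2 by (auto simp: fmeasurable_def measure_def)
qed

text \<open>By the change of variables theorem for injective maps the integral is the volume of the
  image. The set \<open>W\<close> bounds this volume and makes it finite, although \<open>S\<close>
  itself may have infinite measure.\<close>

lemma area_inequality:
  fixes g :: "real^'n::finite \<Rightarrow> real^'n" and A :: "real^'n \<Rightarrow> real^'n^'n"
  assumes S: "S \<in> sets lebesgue" and der: "\<And>x. x \<in> S \<Longrightarrow> (g has_derivative (*v) (A x)) (at x within S)"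
    and inj: "inj_on g S" and W: "g ` S \<subseteq> W" "W \<in> lmeasurable"
    and meas: "(\<lambda>x. \<bar>det (A x)\<bar> * indicator S x) \<in> borel_measurable lebesgue"
  shows "(\<integral>\<^sup>+x. ennreal \<bar>det (A x)\<bar> * indicator S x \<partial>lebesgue) \<le> ennreal (measure lebesgue W)"
proof -
  let ?R = "reindex un_wo :: real^'n \<Rightarrow> real^'n wo" and ?R' = "reindex (inv un_wo) :: real^'n wo \<Rightarrow> real^'n"
  note e = bij_un_wo and e' = bij_imp_bij_inv[OF bij_un_wo]
  have RR[simp]: "?R' (?R x) = x" "?R (?R' y) = y" for x y by (simp_all add: reindex_inverse[OF e])
  define S' where "S' = ?R ` S"
  define g' where "g' y = ?R (g (?R' y))" for y
  define A' where "A' y = ((\<chi> i j. A (?R' y) $ un_wo i $ un_wo j) :: real^'n wo^'n wo)" for y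
  have S': "S' \<in> sets lebesgue" unfolding S'_def by (rule reindex_image_lebesgue[OF e S])
  have R'S: "?R' ` S' = S" by (auto simp: S'_def image_image)
  have R'in: "?R' y \<in> S" if "y \<in> S'" for y using imageI[OF that, of ?R'] unfolding R'S .
  have der': "(g' has_derivative (*v) (A' y)) (at y within S')" if "y \<in> S'" for y
  proof -
    have "?R' y \<in> S" using that by (rule R'in)
    then have 1: "(g has_derivative (*v) (A (?R' y))) (at (?R' y) within ?R' ` S')" using der R'S by simp
    have "(?R' has_derivative ?R') (at y within S')" "(?R has_derivative ?R) (at z)" for z
      by (intro bounded_linear_imp_has_derivative bounded_linear_reindex)+
    then have "((\<lambda>y. ?R (g (?R' y))) has_derivative (\<lambda>h. ?R (A (?R' y) *v ?R' h))) (at y within S')"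
      using has_derivative_in_compose[OF _ 1] has_derivative_compose by blast
    then show ?thesis unfolding g'_def A'_def matrix_reindex_conj[OF e] .
  qed
  have inj': "inj_on g' S'"
  proof (rule inj_onI)
    fix y z assume yz: "y \<in> S'" "z \<in> S'" "g' y = g' z"
    have "?R' (?R (g (?R' y))) = ?R' (?R (g (?R' z)))" using yz(3) unfolding g'_def by (rule arg_cong)
    then have "g (?R' y) = g (?R' z)" by simp
    then have "?R' y = ?R' z" by (rule inj_onD[OF inj]) (intro R'in yz)+
    then have "?R (?R' y) = ?R (?R' z)" by (rule arg_cong)
    then show "y = z" by simp
  qed
  have img: "g' ` S' = ?R ` g ` S" by (auto simp: S'_def g'_def image_image)
  have "g' differentiable_on S'" using der' unfolding differentiable_on_def differentiable_def by blast
  then have "g' ` S' \<in> sets lebesgue" by (intro differentiable_image_in_sets_lebesgue[OF S']) auto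
  have W': "?R ` W \<in> lmeasurable" "measure lebesgue (?R ` W) = measure lebesgue W"
    using reindex_image_lebesgue[OF e, of W] W(2) by (auto simp: fmeasurable_def measure_def)
  have sub: "g' ` S' \<subseteq> ?R ` W" using W(1) unfolding img by blast
  have lm: "g' ` S' \<in> lmeasurable"
    by (rule fmeasurableI2[OF W'(1) sub]) fact
  have "((\<lambda>y. \<bar>det (matrix ((*v) (A' y)))\<bar>) has_integral measure lebesgue (g' ` S')) S'"
    using has_measure_differentiable_image[OF S' der' inj', of "measure lebesgue (g' ` S')"] lm by blast
  then have hi: "((\<lambda>y. \<bar>det (A' y)\<bar>) has_integral measure lebesgue (g' ` S')) S'" by simp
  have detA: "det (A' (?R x)) = det (A x)" for x unfolding A'_def by (simp add: det_reindex[OF e])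
  have memR: "?R x \<in> S' \<longleftrightarrow> x \<in> S" for x
  proof
    assume "?R x \<in> S'"
    then have "?R' (?R x) \<in> S" by (rule R'in)
    then show "x \<in> S" by simp
  qed (simp add: S'_def)
  have m': "(\<lambda>y. \<bar>det (A' y)\<bar> * indicator S' y) \<in> borel_measurable lebesgue"
  proof -
    have "(\<lambda>y. \<bar>det (A (?R' y))\<bar> * indicator S (?R' y)) \<in> borel_measurable lebesgue"
      by (rule measurable_compose[OF lebesgue_reindex(1)[OF e'] meas])
    moreover have "\<bar>det (A (?R' y))\<bar> * indicator S (?R' y) = \<bar>det (A' y)\<bar> * indicator S' y" for y
      using detA[of "?R' y"] memR[of "?R' y"] by (simp add: indicator_def)
    ultimately show ?thesis by simp
  qed
  have "(\<integral>\<^sup>+x. ennreal \<bar>det (A x)\<bar> * indicator S x \<partial>lebesgue)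
      = (\<integral>\<^sup>+x. ennreal (\<bar>det (A' (?R x))\<bar> * indicator S' (?R x)) \<partial>lebesgue)"
    by (intro nn_integral_cong) (simp add: detA indicator_def memR)
  also have "\<dots> = (\<integral>\<^sup>+y. ennreal (\<bar>det (A' y)\<bar> * indicator S' y) \<partial>distr lebesgue lebesgue ?R)"
    using m' by (subst nn_integral_distr[OF lebesgue_reindex(1)[OF e]]) auto
  also have "\<dots> = (\<integral>\<^sup>+y. ennreal \<bar>det (A' y)\<bar> * indicator S' y \<partial>lebesgue)"
    by (simp add: lebesgue_reindex(2)[OF e] ennreal_mult' ennreal_indicator)
  also have "\<dots> = (\<integral>\<^sup>+y. ennreal \<bar>det (A' y)\<bar> * indicator S' y \<partial>lborel)" by (rule nn_integral_completion)
  also have "\<dots> = ennreal (measure lebesgue (g' ` S'))"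
    by (rule nn_integral_has_integral_lebesgue'[OF _ hi]) simp
  also have "\<dots> \<le> ennreal (measure lebesgue W)"
    using measure_mono_fmeasurable[OF sub fmeasurableD[OF lm] W'(1)] W'(2) by (simp add: ennreal_leI)
  finally show ?thesis .
qed

section \<open>Hessians and subgradient images of convex functions\<close>

definition taylor2 :: "(real^'n::finite \<Rightarrow> real) \<Rightarrow> real^'n \<Rightarrow> real^'n \<Rightarrow> real^'n^'n \<Rightarrow> bool" where
  "taylor2 v x g H \<longleftrightarrow>
     ((\<lambda>y. (v y - v x - g \<bullet> (y - x) - (1/2) * ((y - x) \<bullet> (H *v (y - x)))) / (norm (y - x))^2) \<longlongrightarrow> 0) (at x)"

definition second_diff :: "('a::real_normed_vector \<Rightarrow> real) \<Rightarrow> 'a \<Rightarrow> 'a \<Rightarrow> real \<Rightarrow> real" where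
  "second_diff v w x t = (v (x + t *\<^sub>R w) + v (x - t *\<^sub>R w) - 2 * v x) / t\<^sup>2"

text \<open>The limit runs along a fixed sequence so that \<open>lim\<close> gives a Borel function
  of \<open>x\<close> for continuous \<open>v\<close>; where the sequence has no limit the value is
  unspecified.\<close>

definition hess_form :: "('a::real_normed_vector \<Rightarrow> real) \<Rightarrow> 'a \<Rightarrow> 'a \<Rightarrow> real" where
  "hess_form v w x = lim (\<lambda>n. second_diff v w x (inverse (real (Suc n))))"

text \<open>The only candidate for the Hessian, by polarization of second differences. It is symmetric and
  depends measurably on the point, whether or not a second order expansion exists there.\<close>

definition hess_mat :: "(real^'n::finite \<Rightarrow> real) \<Rightarrow> real^'n \<Rightarrow> real^'n^'n" where
  "hess_mat v x = (\<chi> i j. (hess_form v (axis i 1 + axis j 1) x - hess_form v (axis i 1) x - hess_form v (axis j 1) x) / 2)"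

definition twice_diff :: "(real^'n::finite \<Rightarrow> real) \<Rightarrow> real^'n \<Rightarrow> bool" where
  "twice_diff v x \<longleftrightarrow> (\<exists>g. taylor2 v x g (hess_mat v x))"

definition hdet :: "(real^'n::finite \<Rightarrow> real) \<Rightarrow> real^'n \<Rightarrow> real" where
  "hdet v x = (if twice_diff v x then det (hess_mat v x) else 0)"

lemma transpose_hess_mat: "transpose (hess_mat v x) = hess_mat v x"
  by (simp add: hess_mat_def transpose_def vec_eq_iff add.commute)

lemma symmetric_inner:
  fixes H :: "real^'n::finite^'n"
  assumes "transpose H = H"
  shows "a \<bullet> (H *v b) = b \<bullet> (H *v a)"
  by (metis assms dot_lmul_matrix inner_commute transpose_matrix_vector)

lemma taylor2_line:
  assumes "taylor2 v x g H" "w \<noteq> 0"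
  shows "((\<lambda>t. (v (x + t *\<^sub>R w) - v x - t * (g \<bullet> w) - t\<^sup>2 / 2 * (w \<bullet> (H *v w))) / t\<^sup>2) \<longlongrightarrow> 0) (at 0)"
proof -
  have "filterlim (\<lambda>t. x + t *\<^sub>R w) (at x) (at (0::real))"
    using assms(2) by (auto simp: filterlim_at eventually_at intro!: tendsto_eq_intros exI[of _ 1])
  from tendsto_mult_left[OF filterlim_compose[OF assms(1)[unfolded taylor2_def] this], of "(norm w)\<^sup>2"]
  have "((\<lambda>t. (norm w)\<^sup>2 * ((v (x + t *\<^sub>R w) - v x - g \<bullet> (t *\<^sub>R w) - (1/2) * ((t *\<^sub>R w) \<bullet> (H *v (t *\<^sub>R w)))) / (norm (t *\<^sub>R w))\<^sup>2)) \<longlongrightarrow> 0) (at 0)"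
    by simp
  moreover have "(norm w)\<^sup>2 * ((v (x + t *\<^sub>R w) - v x - g \<bullet> (t *\<^sub>R w) - (1/2) * ((t *\<^sub>R w) \<bullet> (H *v (t *\<^sub>R w)))) / (norm (t *\<^sub>R w))\<^sup>2)
      = (v (x + t *\<^sub>R w) - v x - t * (g \<bullet> w) - t\<^sup>2 / 2 * (w \<bullet> (H *v w))) / t\<^sup>2" for t
    using assms(2) by (simp add: matrix_vector_mult_scaleR power_mult_distrib power2_eq_square)
  ultimately show ?thesis by simp
qed

lemma taylor2_second_diff:
  assumes "taylor2 v x g H"
  shows "((\<lambda>t. second_diff v w x t) \<longlongrightarrow> w \<bullet> (H *v w)) (at 0)"
proof (cases "w = 0")
  case False
  have "((\<lambda>t. second_diff v w x t - w \<bullet> (H *v w)) \<longlongrightarrow> 0 + 0) (at 0)"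
  proof (rule Lim_transform_eventually)
    have m: "(H *v (- w)) = - (H *v w)" by (simp add: vec.neg)
    show "((\<lambda>t. (v (x + t *\<^sub>R w) - v x - t * (g \<bullet> w) - t\<^sup>2 / 2 * (w \<bullet> (H *v w))) / t\<^sup>2 +
        (v (x + t *\<^sub>R (- w)) - v x - t * (g \<bullet> (- w)) - t\<^sup>2 / 2 * ((- w) \<bullet> (H *v (- w)))) / t\<^sup>2) \<longlongrightarrow> 0 + 0) (at 0)"
      using False by (intro tendsto_add taylor2_line[OF assms]) auto
    show "\<forall>\<^sub>F t in at 0. (v (x + t *\<^sub>R w) - v x - t * (g \<bullet> w) - t\<^sup>2 / 2 * (w \<bullet> (H *v w))) / t\<^sup>2 +
        (v (x + t *\<^sub>R (- w)) - v x - t * (g \<bullet> (- w)) - t\<^sup>2 / 2 * ((- w) \<bullet> (H *v (- w)))) / t\<^sup>2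
       = second_diff v w x t - w \<bullet> (H *v w)"
      unfolding eventually_at by (rule exI[of _ 1]) (auto simp: second_diff_def m field_simps)
  qed
  then show ?thesis by (simp add: LIM_zero_iff)
qed (simp add: second_diff_def)

lemma hess_form_taylor2:
  assumes "taylor2 v x g H"
  shows "hess_form v w x = w \<bullet> (H *v w)"
proof -
  have "filterlim (\<lambda>n. inverse (real (Suc n))) (at 0) sequentially"
    using LIMSEQ_inverse_real_of_nat by (auto simp: filterlim_at)
  from filterlim_compose[OF taylor2_second_diff[OF assms] this] show ?thesis
    unfolding hess_form_def by (rule limI)
qed

text \<open>Second differences determine the quadratic form of \<open>H\<close>, and polarization on
  the axis vectors recovers the entries, because \<open>H\<close> is symmetric.\<close>

lemma hess_mat_unique:
  assumes t: "taylor2 v x g H" and sym: "transpose H = H"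
  shows "hess_mat v x = H"
proof -
  have ax: "axis i 1 \<bullet> (H *v axis j 1) = H $ i $ j" for i j
    by (simp add: inner_axis' matrix_vector_mul_component inner_axis)
  have "H $ j $ i = H $ i $ j" for i j using sym by (metis transpose_def vec_lambda_beta)
  then show ?thesis
    by (simp add: hess_mat_def vec_eq_iff hess_form_taylor2[OF t] matrix_vector_right_distrib inner_add_left inner_add_right ax)
qed

lemma twice_diffI: "taylor2 v x g H \<Longrightarrow> transpose H = H \<Longrightarrow> twice_diff v x"
  unfolding twice_diff_def by (metis hess_mat_unique)

lemma second_diff_nonneg:
  assumes "convex_on UNIV v"
  shows "0 \<le> second_diff v w x t"
proof -
  have "(1 - 1/2) *\<^sub>R (x + t *\<^sub>R w) + (1/2) *\<^sub>R (x - t *\<^sub>R w) = x"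
    by (simp add: algebra_simps flip: scaleR_add_left)
  then have "v x \<le> (1 - 1/2) * v (x + t *\<^sub>R w) + (1/2) * v (x - t *\<^sub>R w)"
    using convex_onD[OF assms, of "1/2" "x + t *\<^sub>R w" "x - t *\<^sub>R w"] by simp
  then show ?thesis by (auto simp: second_diff_def)
qed

lemma taylor2_psd:
  assumes "taylor2 v x g H" "convex_on UNIV v"
  shows "0 \<le> w \<bullet> (H *v w)"
  by (rule tendsto_lowerbound[OF taylor2_second_diff[OF assms(1)]])
    (use second_diff_nonneg[OF assms(2)] in auto)

text \<open>Testing semidefiniteness at \<open>w - s *\<^sub>R z\<close> with
  \<open>z = H *v w\<close> leaves a term linear in \<open>s\<close> of the wrong sign; letting
  \<open>s\<close> tend to 0 forces \<open>z = 0\<close>.\<close>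

lemma psd_kernel:
  fixes H :: "real^'n::finite^'n"
  assumes sym: "transpose H = H" and psd: "\<And>w. 0 \<le> w \<bullet> (H *v w)" and 0: "w \<bullet> (H *v w) = 0"
  shows "H *v w = 0"
proof -
  define z where "z = H *v w"
  define C where "C = z \<bullet> (H *v z)"
  have "2 * (z \<bullet> z) \<le> s * C" if s: "s > 0" for s
  proof -
    have "0 \<le> (w - s *\<^sub>R z) \<bullet> (H *v (w - s *\<^sub>R z))" by (rule psd)
    also have "\<dots> = w \<bullet> (H *v w) - s * (w \<bullet> (H *v z)) - s * (z \<bullet> (H *v w)) + s * s * C"
      by (simp add: matrix_vector_mult_diff_distrib matrix_vector_mult_scaleR inner_diff_left inner_diff_right C_def algebra_simps)
    also have "w \<bullet> (H *v z) = z \<bullet> (H *v w)" by (rule symmetric_inner[OF sym])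
    also have "z \<bullet> (H *v w) = z \<bullet> z" by (simp add: z_def)
    finally have "0 \<le> s * (s * C - 2 * (z \<bullet> z))" using 0 by (simp add: algebra_simps)
    then show ?thesis using s by (simp add: zero_le_mult_iff)
  qed
  then have le: "2 * (z \<bullet> z) \<le> s * C" if "s \<in> {0<..}" for s using that by auto
  have "((\<lambda>s. s * C) \<longlongrightarrow> 0 * C) (at_right 0)" by (intro tendsto_intros)
  then have "2 * (z \<bullet> z) \<le> 0 * C"
    by (rule tendsto_lowerbound) (use le in \<open>auto simp: eventually_at_filter\<close>)
  then have "z \<bullet> z = 0" using inner_ge_zero[of z] by linarith
  then show ?thesis by (simp add: z_def)
qed

text \<open>The determinant does not vanish on the segment from the identity to \<open>H\<close>, except possibly at \<open>H\<close>.\<close>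

lemma det_psd_nonneg:
  fixes H :: "real^'n::finite^'n"
  assumes psd: "\<And>w. 0 \<le> w \<bullet> (H *v w)"
  shows "0 \<le> det H"
proof (rule ccontr)
  assume neg: "\<not> 0 \<le> det H"
  define P where "P t = (1 - t) *\<^sub>R mat 1 + t *\<^sub>R H" for t :: real
  have Pv: "P t *v w = (1 - t) *\<^sub>R w + t *\<^sub>R (H *v w)" for t w
    by (simp add: P_def matrix_vector_mult_add_rdistrib scaleR_matrix_vector_assoc[symmetric])
  have cont: "continuous_on {0..1} (\<lambda>t. det (P t))"
    unfolding det_def P_def by (intro continuous_intros)
  have "det (P 0) = 1" "det (P 1) = det H" by (simp_all add: P_def)
  then obtain t where t: "0 \<le> t" "t \<le> 1" "det (P t) = 0"
    using IVT2'[of "\<lambda>t. det (P t)" 1 0 0, OF _ _ _ cont] neg by auto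
  then have "t \<noteq> 1" using neg \<open>det (P 1) = det H\<close> by auto
  have "\<not> inj ((*v) (P t))" using t(3) det_nz_iff_inj[OF matrix_vector_mul_linear[of "P t"]] by simp
  then obtain w where w: "w \<noteq> 0" "P t *v w = 0"
    using linear_injective_0[OF matrix_vector_mul_linear[of "P t"]] by auto
  have "0 = w \<bullet> (P t *v w)" using w by simp
  also have "\<dots> = (1 - t) * (w \<bullet> w) + t * (w \<bullet> (H *v w))" by (simp add: Pv inner_add_right)
  finally have "(1 - t) * (w \<bullet> w) \<le> 0" using psd[of w] t by (smt (verit) mult_nonneg_nonneg)
  moreover have "0 < (1 - t) * (w \<bullet> w)"
    using \<open>t \<noteq> 1\<close> t w by (intro mult_pos_pos) auto
  ultimately show False by linarith
qed

lemma AE_twice_diff: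
  fixes v :: "real^'n::finite \<Rightarrow> real"
  assumes "convex_lipschitz v M"
  shows "AE x in lebesgue. twice_diff v x"
  using convex_lipschitz.Aleksandrov[OF assms]
proof eventually_elim
  case (elim x)
  then obtain p B where B: "linear B" and lim: "((\<lambda>y. (v y - v x - p \<bullet> (y - x) - (1/2) * ((y - x) \<bullet> B (y - x))) / (norm (y - x))\<^sup>2) \<longlongrightarrow> 0) (at x)"
    by blast
  \<comment> \<open>The linear map \<open>B\<close> is not known to be symmetric, but the quadratic
    form sees only its symmetric part.\<close>
  define H where "H = (1/2) *\<^sub>R (matrix B + transpose (matrix B))"
  have sym: "transpose H = H" by (simp add: H_def transpose_def vec_eq_iff add.commute)
  have "h \<bullet> (H *v h) = h \<bullet> B h" for h
  proof -
    have "h \<bullet> (transpose (matrix B) *v h) = h \<bullet> (matrix B *v h)"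
      by (metis dot_lmul_matrix inner_commute transpose_matrix_vector)
    then have "h \<bullet> (H *v h) = h \<bullet> (matrix B *v h)"
      by (simp add: H_def scaleR_matrix_vector_assoc[symmetric] matrix_vector_mult_add_rdistrib inner_add_right)
    then show ?thesis using matrix_works[of B h] B by (simp add: linear_matrix_vector_mul_eq)
  qed
  then have "taylor2 v x p H" unfolding taylor2_def using lim by simp
  then show ?case using sym by (rule twice_diffI)
qed

lemma hess_mat_measurable:
  fixes v :: "real^'n::finite \<Rightarrow> real"
  assumes "continuous_on UNIV v"
  shows "(\<lambda>x. det (hess_mat v x)) \<in> borel_measurable borel"
proof -
  have [measurable]: "v \<in> borel_measurable borel" using assms by (rule borel_measurable_continuous_onI)
  have [measurable]: "hess_form v w \<in> borel_measurable borel" for w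
    unfolding hess_form_def second_diff_def by measurable
  show ?thesis unfolding det_def hess_mat_def by simp measurable
qed

lemma hdet_nonneg: "convex_on UNIV v \<Longrightarrow> 0 \<le> hdet v x"
  unfolding hdet_def twice_diff_def by (auto intro: det_psd_nonneg taylor2_psd)

lemma hdet_measurable:
  fixes v :: "real^'n::finite \<Rightarrow> real"
  assumes "convex_lipschitz v M"
  shows "{x. twice_diff v x} \<in> sets lebesgue" "hdet v \<in> borel_measurable lebesgue"
proof -
  obtain N where N: "negligible N" "{x. \<not> twice_diff v x} \<subseteq> N"
    using AE_twice_diff[OF assms] unfolding eventually_ae_filter_negligible by blast
  have "negligible {x. \<not> twice_diff v x}" using N by (rule negligible_subset)
  then have "- {x. \<not> twice_diff v x} \<in> sets lebesgue"
    by (intro sets.compl_sets[where M=lebesgue, simplified, folded Compl_eq_Diff_UNIV]) (simp add: negligible_imp_sets)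
  moreover have "- {x. \<not> twice_diff v x} = {x. twice_diff v x}" by auto
  ultimately show G: "{x. twice_diff v x} \<in> sets lebesgue" by simp
  have "(\<lambda>x. det (hess_mat v x)) \<in> borel_measurable lebesgue"
    by (intro measurable_completion) (use hess_mat_measurable lipschitz_on_continuous_on assms in \<open>auto simp: convex_lipschitz_def\<close>)
  then have "(\<lambda>x. det (hess_mat v x) * indicator {x. twice_diff v x} x) \<in> borel_measurable lebesgue"
    using G by (intro borel_measurable_times borel_measurable_indicator)
  moreover have "(\<lambda>x. det (hess_mat v x) * indicator {x. twice_diff v x} x) = hdet v"
    by (auto simp: hdet_def fun_eq_iff)
  ultimately show "hdet v \<in> borel_measurable lebesgue" by simp
qed

section \<open>Subgradients of nearby convex functions\<close>

text \<open>The subgradient inequality is tested at distance \<open>s\<close> in the direction of the error; the best \<open>s\<close> is of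
  order \<open>sqrt \<delta>\<close>.\<close>

lemma subgrad_near_quadratic:
  fixes H :: "real^'n::finite^'n"
  assumes sym: "transpose H = H" and K: "\<And>h. norm (H *v h) \<le> K * norm h"
    and near: "\<And>z. z \<in> cball x R \<Longrightarrow> \<bar>u z - (a + g \<bullet> (z - x) + (1/2) * ((z - x) \<bullet> (H *v (z - x))))\<bar> \<le> \<delta>"
    and p: "subgrad u y p" and s: "s > 0" "norm (y - x) + s \<le> R"
  shows "norm (p - g - H *v (y - x)) \<le> 2 * \<delta> / s + K * s / 2"
proof -
  define d where "d = p - g - H *v (y - x)"
  define e where "e = (1 / norm d) *\<^sub>R d"
  define h where "h = y - x"
  have yR: "y \<in> cball x R" using s by (simp add: dist_norm norm_minus_commute)
  show ?thesis
  proof (cases "d = 0")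
    case True
    have "0 \<le> \<delta>" using near[OF yR] by linarith
    moreover have "0 \<le> K" using K[of "axis undefined 1"] order_trans[OF norm_ge_zero, of _ "K * norm (axis undefined 1 :: real^'n)"]
      by (simp add: norm_axis_1)
    ultimately show ?thesis using True s unfolding d_def[symmetric] by simp
  next
    case False
    have e1: "norm e = 1" using False by (simp add: e_def)
    have de: "d \<bullet> e = norm d" using False by (simp add: e_def dot_square_norm power2_eq_square)
    have zR: "y + s *\<^sub>R e \<in> cball x R"
    proof -
      have "norm (y + s *\<^sub>R e - x) \<le> norm (y - x) + norm (s *\<^sub>R e)"
        using norm_triangle_ineq[of "y - x" "s *\<^sub>R e"] by (simp add: algebra_simps)
      then show ?thesis using s e1 by (simp add: dist_norm norm_minus_commute)
    qed
    have eHe: "e \<bullet> (H *v e) \<le> K" using norm_cauchy_schwarz[of e "H *v e"] K[of e] e1 by simp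
    have "(h + s *\<^sub>R e) \<bullet> (H *v (h + s *\<^sub>R e)) = h \<bullet> (H *v h) + s * (h \<bullet> (H *v e)) + s * (e \<bullet> (H *v h)) + s * s * (e \<bullet> (H *v e))"
      by (simp add: matrix_vector_right_distrib matrix_vector_mult_scaleR inner_add_left inner_add_right algebra_simps)
    also have "h \<bullet> (H *v e) = e \<bullet> (H *v h)" by (rule symmetric_inner[OF sym])
    finally have q: "(h + s *\<^sub>R e) \<bullet> (H *v (h + s *\<^sub>R e)) = h \<bullet> (H *v h) + 2 * s * (e \<bullet> (H *v h)) + s * s * (e \<bullet> (H *v e))" by simp
    have "u y + s * (p \<bullet> e) \<le> u (y + s *\<^sub>R e)" using subgradD[OF p, of "y + s *\<^sub>R e"] by simp
    moreover have yse: "y + s *\<^sub>R e - x = h + s *\<^sub>R e" by (simp add: h_def)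
    \<comment> \<open>The term \<open>2 * \<delta>\<close> is paid for comparing \<open>u\<close>
      with the quadratic function at \<open>y\<close> and at
      \<open>y + s *\<^sub>R e\<close>.\<close>
    ultimately have "s * (p \<bullet> e) \<le> g \<bullet> (s *\<^sub>R e) + (1/2) * ((h + s *\<^sub>R e) \<bullet> (H *v (h + s *\<^sub>R e))) - (1/2) * (h \<bullet> (H *v h)) + 2 * \<delta>"
      using near[OF yR] near[OF zR, unfolded yse] by (simp add: h_def[symmetric] inner_add_right abs_le_iff)
    then have "s * (p \<bullet> e - g \<bullet> e - e \<bullet> (H *v h)) \<le> s * s / 2 * (e \<bullet> (H *v e)) + 2 * \<delta>"
      unfolding q by (simp add: algebra_simps)
    also have "p \<bullet> e - g \<bullet> e - e \<bullet> (H *v h) = norm d"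
      using de by (simp add: d_def h_def inner_diff_left inner_commute[of "H *v (y - x)" e])
    also have "s * s / 2 * (e \<bullet> (H *v e)) \<le> s * s / 2 * K" using s eHe by (intro mult_left_mono) auto
    finally have "s * norm d \<le> s * (2 * \<delta> / s + K * s / 2)" using s by (simp add: algebra_simps)
    then show ?thesis using s by (simp add: d_def)
  qed
qed

text \<open>On the double ball \<open>u\<close> differs from the quadratic expansion by at most
  \<open>5 * \<eta> * r\<^sup>2\<close>: one part from \<open>u - v\<close> and four from the
  remainder. Testing at distance \<open>t * r\<close> with \<open>\<eta> = t * t\<close> makes both
  terms of \<open>subgrad_near_quadratic\<close> proportional to \<open>t * r\<close>; the double
  radius leaves room for this step.\<close>

lemma subgrad_near_taylor2:
  fixes H :: "real^'n::finite^'n"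
  assumes t: "taylor2 v x g H" and sym: "transpose H = H" and \<epsilon>: "\<epsilon> > 0"
  shows "\<exists>\<rho>>0. \<forall>r. 0 < r \<and> r < \<rho> \<longrightarrow> (\<exists>\<delta>>0. \<forall>u. (\<forall>z\<in>cball x (2*r). \<bar>u z - v z\<bar> \<le> \<delta>) \<longrightarrow>
     (\<forall>y\<in>cball x r. \<forall>p. subgrad u y p \<longrightarrow> norm (p - g - H *v (y - x)) \<le> \<epsilon> * r))"
proof -
  obtain K where K: "K > 0" "\<And>h. norm (H *v h) \<le> K * norm h"
    using linear_bounded_pos[OF matrix_vector_mul_linear[of H]] by blast
  \<comment> \<open>The 10 comes from \<open>2 * 5 * \<eta> / t = 10 * t\<close>, the
    \<open>K / 2\<close> from the curvature term; \<open>t \<le> 1\<close> keeps the test points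
    inside the double ball.\<close>
  define t where "t = min 1 (\<epsilon> / (10 + K / 2))"
  have t0: "0 < t" "t \<le> 1" using \<epsilon> K by (auto simp: t_def add_pos_pos)
  have t1: "t * (10 + K / 2) \<le> \<epsilon>"
  proof -
    have "t * (10 + K / 2) \<le> (\<epsilon> / (10 + K / 2)) * (10 + K / 2)" using K by (intro mult_right_mono) (auto simp: t_def)
    then show ?thesis using K by simp
  qed
  define \<eta> where "\<eta> = t * t"
  have \<eta>: "\<eta> > 0" using t0 by (simp add: \<eta>_def)
  have "\<forall>\<^sub>F y in at x. dist ((v y - v x - g \<bullet> (y - x) - (1/2) * ((y - x) \<bullet> (H *v (y - x)))) / (norm (y - x))\<^sup>2) 0 < \<eta>"
    using assms(1)[unfolded taylor2_def] \<eta> by (rule tendstoD)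
  then obtain d where d: "d > 0" "\<And>y. y \<noteq> x \<Longrightarrow> dist y x < d \<Longrightarrow> \<bar>(v y - v x - g \<bullet> (y - x) - (1/2) * ((y - x) \<bullet> (H *v (y - x)))) / (norm (y - x))\<^sup>2\<bar> < \<eta>"
    unfolding eventually_at by auto
  have vq: "\<bar>v y - (v x + g \<bullet> (y - x) + (1/2) * ((y - x) \<bullet> (H *v (y - x))))\<bar> \<le> \<eta> * (norm (y - x))\<^sup>2" if y: "dist y x < d" for y
  proof (cases "y = x")
    case False
    then have n: "(norm (y - x))\<^sup>2 > 0" by simp
    have "\<bar>v y - v x - g \<bullet> (y - x) - (1/2) * ((y - x) \<bullet> (H *v (y - x)))\<bar> / (norm (y - x))\<^sup>2 < \<eta>"
      using d(2)[OF False y] unfolding abs_divide by simp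
    then have "\<bar>v y - v x - g \<bullet> (y - x) - (1/2) * ((y - x) \<bullet> (H *v (y - x)))\<bar> < \<eta> * (norm (y - x))\<^sup>2"
      using n by (simp only: pos_divide_less_eq)
    then show ?thesis by (simp add: algebra_simps)
  qed simp
  show ?thesis
  proof (rule exI[of _ "d / 2"], intro conjI allI impI)
    fix r assume r: "0 < r \<and> r < d / 2"
    show "\<exists>\<delta>>0. \<forall>u. (\<forall>z\<in>cball x (2*r). \<bar>u z - v z\<bar> \<le> \<delta>) \<longrightarrow>
     (\<forall>y\<in>cball x r. \<forall>p. subgrad u y p \<longrightarrow> norm (p - g - H *v (y - x)) \<le> \<epsilon> * r)"
    proof (intro exI[of _ "\<eta> * r\<^sup>2"] conjI allI impI ballI)
      fix u y p assume u: "\<forall>z\<in>cball x (2*r). \<bar>u z - v z\<bar> \<le> \<eta> * r\<^sup>2" and y: "y \<in> cball x r" and p: "subgrad u y p"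
      have near: "\<bar>u z - (v x + g \<bullet> (z - x) + (1/2) * ((z - x) \<bullet> (H *v (z - x))))\<bar> \<le> 5 * \<eta> * r\<^sup>2" if z: "z \<in> cball x (2*r)" for z
      proof -
        have nz: "norm (z - x) \<le> 2 * r" using z by (simp add: dist_norm norm_minus_commute)
        have "(norm (z - x))\<^sup>2 \<le> (2 * r)\<^sup>2" using nz by (intro power_mono) auto
        then have "\<eta> * (norm (z - x))\<^sup>2 \<le> 4 * \<eta> * r\<^sup>2" using \<eta> by (simp add: power_mult_distrib)
        moreover have "dist z x < d" using nz r by (simp add: dist_norm)
        ultimately show ?thesis using vq[of z] u z by fastforce
      qed
      have "norm (p - g - H *v (y - x)) \<le> 2 * (5 * \<eta> * r\<^sup>2) / (t * r) + K * (t * r) / 2"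
      proof (rule subgrad_near_quadratic[OF sym K(2) near p])
        show "0 < t * r" using t0 r by simp
        have "t * r \<le> 1 * r" using t0 r by (intro mult_right_mono) auto
        then show "norm (y - x) + t * r \<le> 2 * r" using y by (simp add: dist_norm norm_minus_commute)
      qed
      also have "\<dots> = t * (10 + K / 2) * r" using t0 r by (simp add: \<eta>_def power2_eq_square field_simps)
      also have "\<dots> \<le> \<epsilon> * r" using t1 r by (intro mult_right_mono) auto
      finally show "norm (p - g - H *v (y - x)) \<le> \<epsilon> * r" .
    qed (use \<eta> r in simp)
  qed (use d in simp)
qed

text \<open>After subtracting \<open>g\<close> and dividing by \<open>r\<close>, the subgradients
  over \<open>cball x r\<close> lie within \<open>d/2\<close> of the ellipsoid that \<open>H\<close>
  makes of the unit ball, whose volume is \<open>det H\<close> times that of the unit ball. The set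
  \<open>W\<close> is fixed before \<open>u\<close>, so that it serves all functions of an
  approximating sequence.\<close>

lemma subgrad_image_small:
  fixes H :: "real^'n::finite^'n"
  assumes t: "taylor2 v x g H" and sym: "transpose H = H" and psd: "0 \<le> det H" and e: "e > 0"
  shows "\<exists>\<rho>>0. \<forall>r. 0 < r \<and> r < \<rho> \<longrightarrow> (\<exists>\<delta>>0. \<exists>W\<in>lmeasurable. measure lebesgue W \<le> (det H + e) * measure lebesgue (cball x r) \<and>
     (\<forall>u. (\<forall>z\<in>cball x (2*r). \<bar>u z - v z\<bar> \<le> \<delta>) \<longrightarrow> (\<forall>y\<in>cball x r. \<forall>p. subgrad u y p \<longrightarrow> p \<in> W)))"
proof -
  let ?K = "(*v) H ` cball 0 1" and ?\<omega> = "measure lebesgue (cball (0::real^'n) 1)"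
  have \<omega>: "?\<omega> > 0" using content_cball_pos[of 1 "0::real^'n"] by simp
  have K: "compact ?K" by (intro compact_continuous_image matrix_vector_mult_linear_continuous_on compact_cball)
  have Kc: "convex ?K" by (intro convex_linear_image matrix_vector_mul_linear convex_cball)
  have mK: "measure lebesgue ?K = det H * ?\<omega>" using measure_matrix_image(2)[of "cball 0 1" H] psd by simp
  have "negligible (frontier ?K)" by (rule negligible_convex_frontier[OF Kc])
  then obtain d where d: "d > 0" "\<And>T. T \<in> lmeasurable \<Longrightarrow> (\<And>y. y \<in> T \<Longrightarrow> \<exists>x. x \<in> ?K \<and> dist x y < d) \<Longrightarrow> measure lebesgue T < measure lebesgue ?K + e * ?\<omega>"
    using measure_semicontinuous_with_hausdist_explicit[of ?K "e * ?\<omega>"] compact_imp_bounded[OF K] e \<omega> by (metis mult_pos_pos)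
  \<comment> \<open>Radius \<open>d/2\<close> instead of \<open>d\<close> keeps the closed
    neighbourhood, which is compact and hence measurable, strictly within distance
    \<open>d\<close>.\<close>
  define N where "N = {a + b | a b. a \<in> ?K \<and> b \<in> cball 0 (d/2)}"
  have N: "compact N" unfolding N_def by (rule compact_sums[OF K compact_cball])
  have "measure lebesgue N < measure lebesgue ?K + e * ?\<omega>"
  proof (rule d(2)[OF lmeasurable_compact[OF N]])
    fix y assume "y \<in> N"
    then obtain a b where ab: "a \<in> ?K" "norm b \<le> d / 2" "y = a + b" by (auto simp: N_def)
    then have "dist a y < d" using d(1) by (simp add: dist_norm)
    then show "\<exists>x. x \<in> ?K \<and> dist x y < d" using ab by blast
  qed
  then have mN: "measure lebesgue N \<le> (det H + e) * ?\<omega>" by (simp add: mK distrib_right)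
  obtain \<rho> where \<rho>: "\<rho> > 0" "\<And>r. 0 < r \<Longrightarrow> r < \<rho> \<Longrightarrow> \<exists>\<delta>>0. \<forall>u. (\<forall>z\<in>cball x (2*r). \<bar>u z - v z\<bar> \<le> \<delta>) \<longrightarrow>
     (\<forall>y\<in>cball x r. \<forall>p. subgrad u y p \<longrightarrow> norm (p - g - H *v (y - x)) \<le> d/2 * r)"
    using subgrad_near_taylor2[OF t sym, of "d/2"] d(1) by auto
  show ?thesis
  proof (rule exI[of _ \<rho>], intro conjI allI impI \<rho>(1))
    fix r assume r: "0 < r \<and> r < \<rho>"
    obtain \<delta> where \<delta>: "\<delta> > 0" "\<And>u y p. (\<forall>z\<in>cball x (2*r). \<bar>u z - v z\<bar> \<le> \<delta>) \<Longrightarrow> y\<in>cball x r \<Longrightarrow> subgrad u y p \<Longrightarrow> norm (p - g - H *v (y - x)) \<le> d/2 * r"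
      using \<rho>(2)[of r] r by metis
    define W where "W = (\<lambda>z. r *\<^sub>R z + g) ` N"
    have "compact W" unfolding W_def by (intro compact_continuous_image continuous_intros N)
    then have Wl: "W \<in> lmeasurable" by (rule lmeasurable_compact)
    have "measure lebesgue W = r ^ DIM(real^'n) * measure lebesgue N" unfolding W_def using r by (intro scaled_measure) simp
    also have "\<dots> \<le> r ^ DIM(real^'n) * ((det H + e) * ?\<omega>)" using r mN by (intro mult_left_mono) auto
    also have "\<dots> = (det H + e) * measure lebesgue (cball x r)" using measure_cball_scale[of r x] r by (simp only: mult.left_commute less_imp_le)
    finally have mW: "measure lebesgue W \<le> (det H + e) * measure lebesgue (cball x r)" .
    have "p \<in> W" if u: "\<forall>z\<in>cball x (2*r). \<bar>u z - v z\<bar> \<le> \<delta>" and y: "y\<in>cball x r" and p: "subgrad u y p" for u y p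
    proof -
      define a where "a = H *v ((1/r) *\<^sub>R (y - x))"
      define b where "b = (1/r) *\<^sub>R (p - g - H *v (y - x))"
      have "norm b \<le> (1/r) * (d/2 * r)" unfolding b_def using \<delta>(2)[OF u y p] r by (simp add: divide_le_eq)
      then have "norm b \<le> d/2" using r by simp
      moreover have "a \<in> ?K" unfolding a_def using y r by (intro imageI) (simp add: dist_norm norm_minus_commute divide_le_eq)
      ultimately have "a + b \<in> N" by (auto simp: N_def)
      moreover have "p = r *\<^sub>R (a + b) + g" using r by (simp add: a_def b_def matrix_vector_mult_scaleR scaleR_add_right)
      ultimately show ?thesis unfolding W_def by blast
    qed
    then show "\<exists>\<delta>>0. \<exists>W\<in>lmeasurable. measure lebesgue W \<le> (det H + e) * measure lebesgue (cball x r) \<and>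
     (\<forall>u. (\<forall>z\<in>cball x (2*r). \<bar>u z - v z\<bar> \<le> \<delta>) \<longrightarrow> (\<forall>y\<in>cball x r. \<forall>p. subgrad u y p \<longrightarrow> p \<in> W))"
      using \<delta>(1) Wl mW by (intro exI[of _ \<delta>] bexI[of _ W] conjI allI ballI impI) auto
  qed
qed

text \<open>The estimate for nearby functions is applied with \<open>u = v\<close> itself. Any
  selection of subgradients is then forced at \<open>x\<close> and differentiable there, whatever is
  chosen elsewhere.\<close>

lemma subgrad_has_derivative:
  fixes v :: "real^'n::finite \<Rightarrow> real"
  assumes t: "taylor2 v x g H" and sym: "transpose H = H" and G: "\<And>y. subgrad v y (G y)"
  shows "G x = g" "(G has_derivative (*v) H) (at x)"
proof -
  have key: "\<exists>\<rho>>0. \<forall>r. 0 < r \<and> r < \<rho> \<longrightarrow> (\<forall>y\<in>cball x r. norm (G y - g - H *v (y - x)) \<le> \<epsilon> * r)" if \<epsilon>: "\<epsilon> > 0" for \<epsilon>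
  proof -
    obtain \<rho> where \<rho>: "\<rho> > 0" "\<And>r. 0 < r \<Longrightarrow> r < \<rho> \<Longrightarrow> \<exists>\<delta>>0. \<forall>u. (\<forall>z\<in>cball x (2*r). \<bar>u z - v z\<bar> \<le> \<delta>) \<longrightarrow>
       (\<forall>y\<in>cball x r. \<forall>p. subgrad u y p \<longrightarrow> norm (p - g - H *v (y - x)) \<le> \<epsilon> * r)"
      using subgrad_near_taylor2[OF t sym \<epsilon>] by auto
    have "norm (G y - g - H *v (y - x)) \<le> \<epsilon> * r" if r: "0 < r" "r < \<rho>" and y: "y \<in> cball x r" for r y
    proof -
      obtain \<delta> where \<delta>: "\<delta> > 0" and *: "\<And>u y p. (\<forall>z\<in>cball x (2*r). \<bar>u z - v z\<bar> \<le> \<delta>) \<Longrightarrow> y\<in>cball x r \<Longrightarrow> subgrad u y p \<Longrightarrow> norm (p - g - H *v (y - x)) \<le> \<epsilon> * r"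
        using \<rho>(2)[OF r] by metis
      show ?thesis by (rule *[OF _ y G]) (use \<delta> in simp)
    qed
    then show ?thesis using \<rho>(1) by blast
  qed
  obtain \<rho> where \<rho>: "\<rho> > 0" "\<And>r. 0 < r \<Longrightarrow> r < \<rho> \<Longrightarrow> (\<forall>y\<in>cball x r. norm (G y - g - H *v (y - x)) \<le> 1 * r)"
    using key[of 1] by auto
  have "norm (G x - g) \<le> e" if e: "e > 0" for e
  proof -
    define r where "r = min e \<rho> / 2"
    have r: "0 < r" "r < \<rho>" "r \<le> e" using e \<rho>(1) by (auto simp: r_def)
    then have "x \<in> cball x r" by simp
    from bspec[OF \<rho>(2)[OF r(1,2)] this] have "norm (G x - g) \<le> r" by simp
    with r show ?thesis by simp
  qed
  then show g: "G x = g" using field_le_epsilon[of "norm (G x - g)" 0] by simp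
  show "(G has_derivative (*v) H) (at x)"
    unfolding has_derivative_within_alt
  proof (intro conjI allI impI)
    show "bounded_linear ((*v) H)" by (rule matrix_vector_mul_bounded_linear)
    fix e :: real assume "0 < e"
    then obtain \<rho> where \<rho>: "\<rho> > 0" "\<And>r. 0 < r \<Longrightarrow> r < \<rho> \<Longrightarrow> (\<forall>y\<in>cball x r. norm (G y - g - H *v (y - x)) \<le> e * r)"
      using key by metis
    show "\<exists>d>0. \<forall>y\<in>UNIV. norm (y - x) < d \<longrightarrow> norm (G y - G x - H *v (y - x)) \<le> e * norm (y - x)"
    proof (intro exI[of _ \<rho>] conjI ballI impI \<rho>(1))
      fix y assume y: "norm (y - x) < \<rho>"
      show "norm (G y - G x - H *v (y - x)) \<le> e * norm (y - x)"
        using \<rho>(2)[of "norm (y - x)"] y g by (cases "y = x") (auto simp: dist_norm norm_minus_commute)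
    qed
  qed
qed

section \<open>The area bound for the Hessian determinant\<close>

text \<open>A selection of subgradients is injective where the determinant is positive: equal
  subgradients at \<open>x\<close> and \<open>y\<close> make \<open>v\<close> affine between them,
  so the semidefinite Hessian at \<open>x\<close> annihilates \<open>y - x\<close>. The area formula
  then applies, and points of zero determinant contribute nothing to the integral.\<close>

lemma hdet_integral_le:
  fixes v :: "real^'n::finite \<Rightarrow> real"
  assumes cl: "convex_lipschitz v M" and S: "S \<in> sets lebesgue" and W: "W \<in> lmeasurable"
    and sub: "\<And>x p. x \<in> S \<Longrightarrow> subgrad v x p \<Longrightarrow> p \<in> W"
  shows "(\<integral>\<^sup>+x\<in>S. ennreal (hdet v x) \<partial>lebesgue) \<le> ennreal (measure lebesgue W)"
proof -
  have cv: "convex_on UNIV v" and lip: "M-lipschitz_on UNIV v" using cl by (auto simp: convex_lipschitz_def)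
  obtain G where G: "\<And>y. subgrad v y (G y)" using subgrad_exists[OF cv lip] by metis
  note [measurable] = hdet_measurable(2)[OF cl]
  define S' where "S' = S \<inter> {x \<in> space lebesgue. 0 < hdet v x}"
  have "{x \<in> space lebesgue. 0 < hdet v x} \<in> sets lebesgue" by measurable
  then have S': "S' \<in> sets lebesgue" unfolding S'_def using S by (intro sets.Int)
  have tw: "twice_diff v x" "hdet v x = det (hess_mat v x)" if "x \<in> S'" for x
    using that by (auto simp: S'_def hdet_def split: if_splits)
  have der: "(G has_derivative (*v) (hess_mat v x)) (at x within S')" if x: "x \<in> S'" for x
  proof -
    obtain g where "taylor2 v x g (hess_mat v x)" using tw(1)[OF x] by (auto simp: twice_diff_def)
    from subgrad_has_derivative(2)[OF this transpose_hess_mat G] show ?thesis by (rule has_derivative_at_withinI)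
  qed
  have inj: "inj_on G S'"
  proof (rule inj_onI, rule ccontr)
    fix x y assume x: "x \<in> S'" and y: "y \<in> S'" and eq: "G x = G y" and "x \<noteq> y"
    define w where "w = y - x"
    have w: "w \<noteq> 0" using \<open>x \<noteq> y\<close> by (simp add: w_def)
    obtain g where t: "taylor2 v x g (hess_mat v x)" using tw(1)[OF x] by (auto simp: twice_diff_def)
    have g: "G x = g" by (rule subgrad_has_derivative(1)[OF t transpose_hess_mat G])
    have vy: "v y = v x + g \<bullet> w"
      using subgradD[OF G, of x y] subgradD[OF G, of y x] eq g by (simp add: w_def inner_diff_right)
    have line: "v (x + s *\<^sub>R w) = v x + s * (g \<bullet> w)" if s: "0 \<le> s" "s \<le> 1" for s
    proof (rule antisym)
      have "(1 - s) *\<^sub>R x + s *\<^sub>R y = x + s *\<^sub>R w" by (simp add: w_def algebra_simps)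
      then have "v (x + s *\<^sub>R w) \<le> (1 - s) * v x + s * v y"
        using convex_onD[OF cv s, of x y] by simp
      then show "v (x + s *\<^sub>R w) \<le> v x + s * (g \<bullet> w)" unfolding vy by (simp add: algebra_simps)
      show "v x + s * (g \<bullet> w) \<le> v (x + s *\<^sub>R w)" using subgradD[OF G, of x "x + s *\<^sub>R w"] g by simp
    qed
    let ?q = "w \<bullet> (hess_mat v x *v w)"
    have "((\<lambda>t. (v (x + t *\<^sub>R w) - v x - t * (g \<bullet> w) - t\<^sup>2 / 2 * ?q) / t\<^sup>2) \<longlongrightarrow> 0) (at_right 0)"
      by (rule filterlim_mono[OF taylor2_line[OF t w] order_refl]) (simp add: at_le)
    moreover have "\<forall>\<^sub>F t in at_right 0. (v (x + t *\<^sub>R w) - v x - t * (g \<bullet> w) - t\<^sup>2 / 2 * ?q) / t\<^sup>2 = - ?q / 2"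
      unfolding eventually_at by (rule exI[of _ 1]) (auto simp: line)
    ultimately have "((\<lambda>t::real. - ?q / 2) \<longlongrightarrow> 0) (at_right 0)" by (rule Lim_transform_eventually)
    then have "- ?q / 2 = 0" by (simp add: tendsto_const_iff)
    then have "hess_mat v x *v w = 0" by (intro psd_kernel transpose_hess_mat taylor2_psd[OF t cv]) simp
    then have "\<not> inj ((*v) (hess_mat v x))" using w linear_injective_0[OF matrix_vector_mul_linear[of "hess_mat v x"]] by auto
    then have "det (hess_mat v x) = 0" using det_nz_iff_inj[OF matrix_vector_mul_linear[of "hess_mat v x"]] by simp
    then show False using x tw(2)[OF x] by (simp add: S'_def)
  qed
  have eq: "\<bar>det (hess_mat v x)\<bar> * indicator S' x = hdet v x * indicator S' x" for x
    using tw(2)[of x] by (auto simp: indicator_def S'_def)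
  have "ennreal (hdet v x) * indicator S x = ennreal \<bar>det (hess_mat v x)\<bar> * indicator S' x" for x
  proof (cases "x \<in> S'")
    case True
    then have "x \<in> S" "0 < hdet v x" by (auto simp: S'_def)
    then show ?thesis using True tw(2)[OF True] by simp
  next
    case False
    then have "x \<notin> S \<or> hdet v x = 0" using hdet_nonneg[OF cv, of x] by (auto simp: S'_def)
    then show ?thesis using False by auto
  qed
  then have "(\<integral>\<^sup>+x\<in>S. ennreal (hdet v x) \<partial>lebesgue) = (\<integral>\<^sup>+x. ennreal \<bar>det (hess_mat v x)\<bar> * indicator S' x \<partial>lebesgue)"
    by (intro nn_integral_cong) simp
  also have "\<dots> \<le> ennreal (measure lebesgue W)"
  proof (rule area_inequality[OF S' der inj _ W])
    show "G ` S' \<subseteq> W" using sub G by (auto simp: S'_def)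
    show "(\<lambda>x. \<bar>det (hess_mat v x)\<bar> * indicator S' x) \<in> borel_measurable lebesgue"
      unfolding eq using S' by measurable
  qed
  finally show ?thesis .
qed

section \<open>Epi-convergence\<close>

text \<open>McShane's extension, the infimal convolution of \<open>f\<close> with \<open>M\<close>
  times the norm. It is convex because near-minimizers \<open>z\<close> and \<open>z'\<close> for
  two points can be averaged inside the convex set \<open>C\<close>.\<close>

lemma lipschitz_convex_extension:
  fixes f :: "'a::euclidean_space \<Rightarrow> real"
  assumes f: "convex_on C f" and lip: "M-lipschitz_on C f" and ne: "C \<noteq> {}"
  obtains v where "convex_lipschitz v M" "\<And>x. x \<in> C \<Longrightarrow> v x = f x"
proof -
  have M0: "0 \<le> M" by (rule lipschitz_on_nonneg[OF lip])
  have C: "convex C" using f by (rule convex_on_imp_convex)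
  obtain z0 where z0: "z0 \<in> C" using ne by blast
  define v where "v y = (INF z\<in>C. f z + M * dist y z)" for y
  have bdd: "bdd_below ((\<lambda>z. f z + M * dist y z) ` C)" for y
  proof (rule bdd_belowI2)
    fix z assume z: "z \<in> C"
    have "\<bar>f z0 - f z\<bar> \<le> M * dist z0 z" using lipschitz_onD[OF lip z0 z] by (simp add: dist_real_def)
    moreover have "M * dist z0 z \<le> M * (dist y z0 + dist y z)"
      using M0 dist_triangle[of z0 z y] by (intro mult_left_mono) (auto simp: dist_commute)
    ultimately show "f z0 - M * dist y z0 \<le> f z + M * dist y z" by (simp add: algebra_simps)
  qed
  have low: "v y \<le> f z + M * dist y z" if "z \<in> C" for y z
    unfolding v_def by (rule cINF_lower[OF bdd that])
  have great: "b \<le> v y" if "\<And>z. z \<in> C \<Longrightarrow> b \<le> f z + M * dist y z" for b y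
    unfolding v_def by (rule cINF_greatest[OF ne that])
  have approx: "\<exists>z\<in>C. f z + M * dist y z < v y + e" if e: "e > 0" for y e
  proof (rule ccontr)
    assume "\<not> ?thesis"
    then have "v y + e \<le> v y" by (intro great) (auto simp: not_less)
    then show False using e by simp
  qed
  have eq: "v x = f x" if x: "x \<in> C" for x
  proof (rule antisym)
    show "v x \<le> f x" using low[OF x, of x] by simp
    show "f x \<le> v x"
    proof (rule great)
      fix z assume "z \<in> C"
      then show "f x \<le> f z + M * dist x z" using lipschitz_onD[OF lip x, of z] by (auto simp: dist_real_def)
    qed
  qed
  have vle: "v y \<le> v y' + M * dist y y'" for y y'
  proof -
    have "v y - M * dist y y' \<le> v y'"
    proof (rule great)
      fix z assume z: "z \<in> C"
      have "M * dist y z \<le> M * (dist y y' + dist y' z)" using M0 by (intro mult_left_mono dist_triangle) 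
      then show "v y - M * dist y y' \<le> f z + M * dist y' z" using low[OF z, of y] by (simp add: algebra_simps)
    qed
    then show ?thesis by simp
  qed
  have "M-lipschitz_on UNIV v"
  proof (rule lipschitz_onI)
    fix y y' show "dist (v y) (v y') \<le> M * dist y y'"
      using vle[of y y'] vle[of y' y] by (simp add: dist_real_def dist_commute abs_le_iff)
  qed (rule M0)
  moreover have "convex_on UNIV v"
  proof (rule convex_onI)
    fix t :: real and y y' :: 'a assume t: "0 < t" "t < 1"
    show "v ((1 - t) *\<^sub>R y + t *\<^sub>R y') \<le> (1 - t) * v y + t * v y'"
    proof (rule field_le_epsilon)
      fix e :: real assume e: "e > 0"
      obtain z where z: "z \<in> C" "f z + M * dist y z < v y + e" using approx[OF e] by blast
      obtain z' where z': "z' \<in> C" "f z' + M * dist y' z' < v y' + e" using approx[OF e] by blast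
      let ?z = "(1 - t) *\<^sub>R z + t *\<^sub>R z'"
      have zC: "?z \<in> C" using C z z' t by (simp add: convex_alt)
      have d: "dist ((1 - t) *\<^sub>R y + t *\<^sub>R y') ?z \<le> (1 - t) * dist y z + t * dist y' z'"
      proof -
        have "(1 - t) *\<^sub>R y + t *\<^sub>R y' - ?z = (1 - t) *\<^sub>R (y - z) + t *\<^sub>R (y' - z')" by (simp add: algebra_simps)
        then show ?thesis using norm_triangle_ineq[of "(1 - t) *\<^sub>R (y - z)" "t *\<^sub>R (y' - z')"] t by (simp add: dist_norm)
      qed
      have "v ((1 - t) *\<^sub>R y + t *\<^sub>R y') \<le> f ?z + M * dist ((1 - t) *\<^sub>R y + t *\<^sub>R y') ?z" by (rule low[OF zC])
      also have "\<dots> \<le> ((1 - t) * f z + t * f z') + M * ((1 - t) * dist y z + t * dist y' z')"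
        using convex_onD[OF f, of t z z'] z z' t d M0 by (intro add_mono mult_left_mono) auto
      also have "\<dots> = (1 - t) * (f z + M * dist y z) + t * (f z' + M * dist y' z')" by (simp add: algebra_simps)
      also have "\<dots> \<le> (1 - t) * (v y + e) + t * (v y' + e)" using z z' t by (intro add_mono[OF mult_left_mono mult_left_mono]) auto
      finally show "v ((1 - t) *\<^sub>R y + t *\<^sub>R y') \<le> (1 - t) * v y + t * v y' + e" by (simp add: algebra_simps)
    qed
  qed simp
  ultimately show ?thesis using eq by (intro that[of v]) (auto simp: convex_lipschitz_def)
qed

abbreviation (input) rfun :: "(real^'n::finite \<Rightarrow> ereal) \<Rightarrow> real^'n \<Rightarrow> real" where
  "rfun u \<equiv> \<lambda>x. real_of_ereal (u x)"

lemma conv_cdL_facts: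
  assumes "conv_cdL u"
  shows "convex (edom u)" "compact (edom u)" "edom u \<noteq> {}" "convex_on (edom u) (rfun u)"
    "\<And>x. x \<in> edom u \<Longrightarrow> u x = ereal (rfun u x)"
    "\<And>x. x \<notin> edom u \<Longrightarrow> u x = \<infinity>"
proof -
  have c: "\<And>x. u x \<noteq> -\<infinity>" "\<exists>x. u x \<noteq> \<infinity>" "convex (edom u)" "convex_on (edom u) (rfun u)" "compact (edom u)"
    using assms by (auto simp: conv_cdL_def conv_fun_def)
  show "convex (edom u)" "compact (edom u)" "convex_on (edom u) (rfun u)" by fact+
  show "edom u \<noteq> {}" using c(2) by (auto simp: edom_def)
  show "u x = \<infinity>" if "x \<notin> edom u" for x using that by (simp add: edom_def)
  show "u x = ereal (rfun u x)" if "x \<in> edom u" for x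
    using that c(1)[of x] by (intro ereal_real'[symmetric]) (auto simp: edom_def)
qed

lemma conv_cdL_extension:
  assumes u: "conv_cdL u" and lip: "M-lipschitz_on (interior (edom u)) (rfun u)" and ne: "interior (edom u) \<noteq> {}"
  obtains v where "convex_lipschitz v M" "\<And>x. x \<in> interior (edom u) \<Longrightarrow> v x = rfun u x"
proof (rule lipschitz_convex_extension[OF _ lip ne])
  show "convex_on (interior (edom u)) (rfun u)"
    by (rule convex_on_subset[OF conv_cdL_facts(4)[OF u] interior_subset convex_interior[OF conv_cdL_facts(1)[OF u]]])
qed (rule that)

lemma has_hessian_at_iff_taylor2:
  assumes eq: "\<And>x. x \<in> interior (edom u) \<Longrightarrow> v x = rfun u x" and x: "x \<in> interior (edom u)"
  shows "has_hessian_at u H x \<longleftrightarrow> transpose H = H \<and> (\<exists>g. taylor2 v x g H)"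
proof -
  have "((\<lambda>y. (rfun u y - rfun u x - g \<bullet> (y - x) - (1/2) * ((y - x) \<bullet> (H *v (y - x)))) / (norm (y - x))^2) \<longlongrightarrow> 0) (at x)
     \<longleftrightarrow> taylor2 v x g H" for g
    unfolding taylor2_def
  proof (rule filterlim_cong[OF refl refl])
    have "\<forall>\<^sub>F y in at x. y \<in> interior (edom u)" by (rule eventually_at_in_open'[OF open_interior x])
    then show "\<forall>\<^sub>F y in at x. (rfun u y - rfun u x - g \<bullet> (y - x) - (1/2) * ((y - x) \<bullet> (H *v (y - x)))) / (norm (y - x))^2
        = (v y - v x - g \<bullet> (y - x) - (1/2) * ((y - x) \<bullet> (H *v (y - x)))) / (norm (y - x))^2"
      by eventually_elim (simp add: eq x)
  qed
  then show ?thesis using x by (simp add: has_hessian_at_def)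
qed

lemma det_hess_eq_hdet:
  assumes eq: "\<And>x. x \<in> interior (edom u) \<Longrightarrow> v x = rfun u x"
  shows "det_hess u x = (if x \<in> interior (edom u) then hdet v x else 0)"
proof (cases "x \<in> interior (edom u)")
  case x: True
  note iff = has_hessian_at_iff_taylor2[OF eq x]
  show ?thesis
  proof (cases "twice_diff v x")
    case True
    then have h: "has_hessian_at u (hess_mat v x) x" by (auto simp: iff twice_diff_def transpose_hess_mat)
    have "(THE H. has_hessian_at u H x) = hess_mat v x"
      using h by (rule the_equality) (use hess_mat_unique iff in metis)
    then show ?thesis using h x True by (auto simp: det_hess_def hdet_def)
  next
    case False
    then have "\<not> (\<exists>H. has_hessian_at u H x)" using twice_diffI iff by metis
    then show ?thesis using x False by (auto simp: det_hess_def hdet_def)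
  qed
qed (simp add: det_hess_def has_hessian_at_def)

text \<open>The Lipschitz bound is given on the interior, while \<open>y\<close> may lie on the
  boundary. The midpoint of \<open>y\<close> and \<open>z\<close> is interior; convexity compares it
  with \<open>y\<close>, the Lipschitz bound compares it with \<open>z\<close>.\<close>

lemma lipschitz_to_domain:
  assumes u: "conv_cdL u" and lip: "M-lipschitz_on (interior (edom u)) (rfun u)"
    and y: "y \<in> edom u" and z: "z \<in> interior (edom u)"
  shows "rfun u z \<le> rfun u y + M * dist z y"
proof -
  define w where "w = (1/2) *\<^sub>R y + (1/2) *\<^sub>R z"
  have wz: "w = y - (1/2) *\<^sub>R (y - z)" "dist z w = dist z y / 2"
  proof -
    show "w = y - (1/2) *\<^sub>R (y - z)" by (simp add: w_def vec_eq_iff field_simps)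
    have "z - w = (1/2) *\<^sub>R (z - y)" by (simp add: w_def vec_eq_iff field_simps)
    then show "dist z w = dist z y / 2" by (simp add: dist_norm)
  qed
  have zK: "z \<in> edom u" using z interior_subset by blast
  have w: "w \<in> interior (edom u)" unfolding wz(1)
    by (rule mem_interior_convex_shrink[OF conv_cdL_facts(1)[OF u] z y]) auto
  have "rfun u w \<le> (1 - 1/2) * rfun u y + (1/2) * rfun u z"
    using convex_onD[OF conv_cdL_facts(4)[OF u], of "1/2" y z] y zK by (simp add: w_def)
  moreover have "\<bar>rfun u z - rfun u w\<bar> \<le> M * dist z y / 2"
    using lipschitz_onD[OF lip z w] wz(2) by (simp add: dist_real_def)
  ultimately have "rfun u z \<le> (1 - 1/2) * rfun u y + 1/2 * rfun u z + M * dist z y / 2"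
    using abs_le_D1 by fastforce
  then show ?thesis by (simp add: field_simps)
qed

text \<open>When the interior is empty, \<open>S\<close> lies in a hyperplane, whose normal is
  oriented to suit \<open>z\<close>. Otherwise a hyperplane separates \<open>z\<close> from the
  interior, and the inequality extends to the closure.\<close>

lemma separate_from_convex:
  fixes S :: "'a::euclidean_space set"
  assumes S: "convex S" and z: "z \<notin> interior S"
  obtains w where "norm w = 1" "\<And>y. y \<in> S \<Longrightarrow> w \<bullet> y \<le> w \<bullet> z"
proof -
  have "\<exists>w. w \<noteq> 0 \<and> (\<forall>y\<in>S. w \<bullet> y \<le> w \<bullet> z)"
  proof (cases "interior S = {}")
    case True
    then obtain a b where ab: "a \<noteq> 0" "S \<subseteq> {x. a \<bullet> x = b}" using empty_interior_subset_hyperplane[OF S] by blast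
    show ?thesis
    proof (cases "b \<le> a \<bullet> z")
      case True
      then show ?thesis using ab by (intro exI[of _ a]) auto
    next
      case False
      then show ?thesis using ab by (intro exI[of _ "- a"]) auto
    qed
  next
    case False
    obtain a b where ab: "a \<noteq> 0" "\<forall>x\<in>{z}. a \<bullet> x \<le> b" "\<forall>x\<in>interior S. b \<le> a \<bullet> x"
      using separating_hyperplane_sets[of "{z}" "interior S"] convex_interior[OF S] False z by auto
    have "closure (interior S) \<subseteq> {x. b \<le> a \<bullet> x}"
      using ab by (intro closure_minimal) (auto simp: closed_halfspace_ge)
    then have "S \<subseteq> {x. b \<le> a \<bullet> x}"
      using convex_closure_interior[OF S False] closure_subset[of S] by blast
    then have "\<forall>y\<in>S. (- a) \<bullet> y \<le> (- a) \<bullet> z" using ab(2) by fastforce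
    then show ?thesis using ab(1) by (intro exI[of _ "- a"]) auto
  qed
  then obtain w where w: "w \<noteq> 0" "\<And>y. y \<in> S \<Longrightarrow> w \<bullet> y \<le> w \<bullet> z" by blast
  show ?thesis
    by (rule that[of "(1 / norm w) *\<^sub>R w"]) (use w in \<open>auto simp: divide_right_mono\<close>)
qed

lemma finite_net:
  fixes S :: "'a::euclidean_space set"
  assumes "compact S" "\<delta> > 0"
  obtains A where "finite A" "A \<subseteq> S" "\<And>x. x \<in> S \<Longrightarrow> \<exists>a\<in>A. dist a x < \<delta>"
proof -
  have "S \<subseteq> (\<Union>a\<in>S. ball a \<delta>)" using assms(2) by auto
  then obtain A where A: "A \<subseteq> S" "finite A" "S \<subseteq> (\<Union>a\<in>A. ball a \<delta>)"
    by (rule compactE_image[OF assms(1), rotated]) auto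
  show ?thesis 
  proof (rule that[OF A(2,1)])
    fix x assume "x \<in> S"
    then have "x \<in> (\<Union>a\<in>A. ball a \<delta>)" by (rule subsetD[OF A(3)])
    then show "\<exists>a\<in>A. dist a x < \<delta>" by simp
  qed
qed

section \<open>Control of domains and values along the sequence\<close>

locale epi_seq =
  fixes us :: "nat \<Rightarrow> real^'n::finite \<Rightarrow> ereal" and u :: "real^'n \<Rightarrow> ereal" and M :: real
  assumes us: "\<And>k. conv_cdL (us k)" and u: "conv_cdL u" and epi: "epi_converges us u"
    and lip: "\<And>k. M-lipschitz_on (interior (edom (us k))) (rfun (us k))"
begin

lemma M0: "0 \<le> M" by (rule lipschitz_on_nonneg[OF lip])

lemma recovery:
  assumes "x \<in> edom u"
  obtains xs where "xs \<longlonglongrightarrow> x" "(\<lambda>k. us k (xs k)) \<longlonglongrightarrow> ereal (rfun u x)"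
    "eventually (\<lambda>k. xs k \<in> edom (us k)) sequentially" "(\<lambda>k. rfun (us k) (xs k)) \<longlonglongrightarrow> rfun u x"
proof -
  obtain xs where xs: "xs \<longlonglongrightarrow> x" "(\<lambda>k. us k (xs k)) \<longlonglongrightarrow> u x"
    using epi unfolding epi_converges_def by blast
  have lim: "(\<lambda>k. us k (xs k)) \<longlonglongrightarrow> ereal (rfun u x)"
    using xs(2) conv_cdL_facts(5)[OF u assms] by simp
  have "eventually (\<lambda>k. us k (xs k) < \<infinity>) sequentially" using lim by (rule order_tendstoD) simp
  then have "eventually (\<lambda>k. xs k \<in> edom (us k)) sequentially" by (simp add: edom_def)
  then show ?thesis using that[OF xs(1) lim] lim_real_of_ereal[OF lim] by simp
qed

text \<open>The uniform Lipschitz constant is decisive. If domains kept reaching distance \<eta>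
  from the limit domain, segments from recovery points to such far points would cross distance
  \<open>\<eta>/2\<close>, where the values are bounded by one constant \<open>C\<close>. A cluster
  point of the crossings lies outside the limit domain, yet the liminf inequality would make
  \<open>u\<close> finite there.\<close>

lemma eventually_near_domain:
  assumes \<eta>: "\<eta> > 0"
  shows "eventually (\<lambda>k. \<forall>x\<in>interior (edom (us k)). infdist x (edom u) < \<eta>) sequentially"
proof (rule ccontr)
  assume neg: "\<not> ?thesis"
  let ?K = "edom u"
  obtain y where y: "y \<in> ?K" using conv_cdL_facts(3)[OF u] by blast
  obtain ys where ys: "ys \<longlonglongrightarrow> y" "eventually (\<lambda>k. ys k \<in> edom (us k)) sequentially" "(\<lambda>k. rfun (us k) (ys k)) \<longlonglongrightarrow> rfun u y"
    using recovery[OF y] by metis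
  define c where "c = rfun u y + 1"
  have "eventually (\<lambda>k. rfun (us k) (ys k) < c) sequentially" using ys(3) by (rule order_tendstoD) (simp add: c_def)
  moreover have "eventually (\<lambda>k. dist (ys k) y < \<eta>/2) sequentially" using ys(1) \<eta> by (intro tendstoD) auto
  ultimately have ev: "eventually (\<lambda>k. ys k \<in> edom (us k) \<and> rfun (us k) (ys k) < c \<and> dist (ys k) y < \<eta>/2) sequentially"
    using ys(2) by eventually_elim auto
  then obtain N where N: "\<And>k. k \<ge> N \<Longrightarrow> ys k \<in> edom (us k) \<and> rfun (us k) (ys k) < c \<and> dist (ys k) y < \<eta>/2"
    by (auto simp: eventually_sequentially)
  have bdQ: "compact {z. infdist z ?K \<le> \<eta>/2}"
    using conv_cdL_facts[OF u] \<eta> by (intro compact_infdist_le) auto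
  then obtain D where D: "\<And>z. infdist z ?K \<le> \<eta>/2 \<Longrightarrow> dist y z \<le> D"
    using bounded_any_center[of _ y] compact_imp_bounded[OF bdQ] by auto
  \<comment> \<open>A bound for the value at the recovery point plus \<open>M\<close> times one for
    its distance from the crossing: \<open>D\<close> from \<open>y\<close> to the crossing and
    \<open>\<eta>/2\<close> from \<open>y\<close> to the recovery point.\<close>
  define C where "C = c + M * (D + \<eta>/2)"
  define S where "S = {k. k \<ge> N \<and> (\<exists>x\<in>interior (edom (us k)). infdist x ?K \<ge> \<eta>)}"
  have "infinite S"
    unfolding infinite_nat_iff_unbounded_le
  proof
    fix m
    obtain k where "k \<ge> max m N" "\<not> (\<forall>x\<in>interior (edom (us k)). infdist x ?K < \<eta>)"
      using neg unfolding eventually_sequentially by blast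
    then show "\<exists>n\<ge>m. n \<in> S" by (intro exI[of _ k]) (auto simp: S_def not_less)
  qed
  have "\<exists>z. infdist z ?K = \<eta>/2 \<and> us k z \<le> ereal C" if k: "k \<in> S" for k
  proof -
    obtain x where x: "x \<in> interior (edom (us k))" "infdist x ?K \<ge> \<eta>" and kN: "k \<ge> N" using k by (auto simp: S_def)
    note Nk = N[OF kN]
    have ik: "infdist (ys k) ?K < \<eta>/2" using infdist_le[OF y, of "ys k"] Nk by linarith
    define \<phi> where "\<phi> s = infdist (ys k - s *\<^sub>R (ys k - x)) ?K" for s
    have "continuous_on {0..1} \<phi>" unfolding \<phi>_def by (intro continuous_intros)
    then obtain s where s: "0 \<le> s" "s \<le> 1" "\<phi> s = \<eta>/2"
      using IVT'[of \<phi> 0 "\<eta>/2" 1] ik x(2) \<eta> by (auto simp: \<phi>_def)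
    define z where "z = ys k - s *\<^sub>R (ys k - x)"
    have iz: "infdist z ?K = \<eta>/2" using s(3) by (simp add: z_def \<phi>_def)
    have "s \<noteq> 0" using s(3) ik by (auto simp: \<phi>_def)
    then have z: "z \<in> interior (edom (us k))"
      unfolding z_def using s Nk by (intro mem_interior_convex_shrink[OF conv_cdL_facts(1)[OF us] x(1)]) auto
    have "dist z (ys k) \<le> dist y z + dist (ys k) y" using dist_triangle[of z "ys k" y] by (simp add: dist_commute)
    also have "\<dots> \<le> D + \<eta>/2" using D[of z] iz Nk by (intro add_mono) auto
    finally have "M * dist z (ys k) \<le> M * (D + \<eta>/2)" using M0 by (rule mult_left_mono)
    moreover have "rfun (us k) z \<le> rfun (us k) (ys k) + M * dist z (ys k)"
      using Nk by (intro lipschitz_to_domain[OF us lip _ z]) auto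
    ultimately have "rfun (us k) z \<le> C" using Nk by (simp add: C_def)
    moreover have "us k z = ereal (rfun (us k) z)" using z interior_subset by (intro conv_cdL_facts(5)[OF us]) auto
    ultimately have "us k z \<le> ereal C" by (metis ereal_less_eq(3))
    with iz show ?thesis by blast
  qed
  then obtain Z where Z: "\<And>k. k \<in> S \<Longrightarrow> infdist (Z k) ?K = \<eta>/2" "\<And>k. k \<in> S \<Longrightarrow> us k (Z k) \<le> ereal C" by metis
  obtain r where r: "strict_mono (r::nat\<Rightarrow>nat)" "\<And>n. r n \<in> S" using infinite_enumerate[OF \<open>infinite S\<close>] by auto
  have "\<forall>n. Z (r n) \<in> {z. infdist z ?K \<le> \<eta>/2}" using Z(1) r(2) by simp
  then obtain z s where s: "strict_mono (s::nat\<Rightarrow>nat)" "((\<lambda>n. Z (r n)) \<circ> s) \<longlonglongrightarrow> z"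
    using bdQ[unfolded compact_def, rule_format, of "\<lambda>n. Z (r n)"] by blast
  define q where "q = r \<circ> s"
  have q: "strict_mono q" "\<And>n. q n \<in> S" unfolding q_def using r s(1) by (auto simp: strict_mono_o)
  have Zq: "(\<lambda>n. Z (q n)) \<longlonglongrightarrow> z" using s(2) by (simp add: q_def comp_def)
  have "(\<lambda>n. infdist (Z (q n)) ?K) \<longlonglongrightarrow> infdist z ?K" by (intro tendsto_infdist Zq)
  then have "(\<lambda>n::nat. \<eta>/2) \<longlonglongrightarrow> infdist z ?K" using Z(1)[OF q(2)] by simp
  then have "infdist z ?K = \<eta>/2" unfolding LIMSEQ_const_iff by (rule sym)
  then have "z \<notin> ?K" using \<eta> by auto
  then have uz: "u z = \<infinity>" by (rule conv_cdL_facts(6)[OF u])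
  \<comment> \<open>The liminf condition speaks of full sequences, so the gaps of the subsequence
    are filled with the limit point.\<close>
  define xs where "xs k = (if k \<in> range q then Z k else z)" for k
  have "xs \<longlonglongrightarrow> z"
  proof (rule metric_LIMSEQ_I)
    fix e :: real assume e: "0 < e"
    obtain n0 where n0: "\<And>n. n \<ge> n0 \<Longrightarrow> dist (Z (q n)) z < e" using metric_LIMSEQ_D[OF Zq e] by blast
    show "\<exists>no. \<forall>k\<ge>no. dist (xs k) z < e"
    proof (intro exI allI impI)
      fix k assume k: "k \<ge> q n0"
      show "dist (xs k) z < e"
      proof (cases "k \<in> range q")
        case True
        then obtain n where n: "k = q n" by blast
        then have "n \<ge> n0" using k q(1) by (simp add: strict_mono_less_eq)
        then show ?thesis using n0[of n] n by (simp add: xs_def)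
      qed (simp add: xs_def e)
    qed
  qed
  then have "u z \<le> liminf (\<lambda>k. us k (xs k))" using epi by (auto simp: epi_converges_def)
  also have "\<dots> \<le> liminf ((\<lambda>k. us k (xs k)) \<circ> q)" by (rule liminf_subseq_mono[OF q(1)])
  also have "\<dots> \<le> liminf (\<lambda>n. ereal C)"
    using Z(2)[OF q(2)] by (intro Liminf_mono always_eventually) (auto simp: xs_def)
  also have "\<dots> = ereal C" by (simp add: Liminf_const)
  finally show False using uz by simp
qed

text \<open>Recovery sequences place points of the \<open>k\<close>-th domain near finitely many
  points of a slightly larger sphere. A point of the ball outside the interior of this domain would
  bound a half-space containing the domain, but in the direction of its normal one of those points
  lies beyond the hyperplane.\<close>

lemma eventually_cball_in_domain:
  assumes x: "cball x R \<subseteq> interior (edom u)" and R: "R > 0"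
  shows "eventually (\<lambda>k. cball x R \<subseteq> interior (edom (us k))) sequentially"
proof -
  obtain \<rho> where \<rho>: "\<rho> > 0" "cball x (R + \<rho>) \<subseteq> edom u"
  proof -
    have "compact (cball x R)" by simp
    then obtain e where e: "e > 0" "(\<Union>y\<in>cball x R. cball y e) \<subseteq> interior (edom u)"
      using compact_subset_open_imp_cball_epsilon_subset[OF _ open_interior x] by metis
    have "cball x (R + e) \<subseteq> (\<Union>y\<in>cball x R. cball y e)"
    proof
      fix z assume z: "z \<in> cball x (R + e)"
      show "z \<in> (\<Union>y\<in>cball x R. cball y e)"
      proof (cases "dist x z \<le> R")
        case True then show ?thesis using e(1) by (intro UN_I[of z]) auto
      next
        case False
        define n where "n = norm (z - x)"
        have n: "n > R" "n \<le> R + e" using False z by (auto simp: n_def dist_norm norm_minus_commute)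
        define y where "y = x + (R / n) *\<^sub>R (z - x)"
        have "norm (y - x) = R" using n R by (simp add: y_def n_def[symmetric])
        moreover have "z - y = (1 - R / n) *\<^sub>R (z - x)" by (simp add: y_def algebra_simps)
        then have "norm (z - y) = (1 - R / n) * n" using n R by (simp add: n_def[symmetric])
        then have "norm (z - y) = n - R" using n R by (simp add: left_diff_distrib)
        ultimately show ?thesis using n by (intro UN_I[of y]) (auto simp: dist_norm norm_minus_commute)
      qed
    qed
    then show ?thesis using e interior_subset[of "edom u"] by (intro that[of e]) auto
  qed
  \<comment> \<open>The margin \<rho> is split: one half is spent on the mesh of the directions, as
    \<open>(R + \<rho>) * \<delta> = \<rho> / 2\<close>, the other on the error of the recovery
    sequences.\<close>
  define \<delta> where "\<delta> = \<rho> / (2 * (R + \<rho>))"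
  have \<delta>: "\<delta> > 0" using R \<rho> by (simp add: \<delta>_def)
  have "R + \<rho> \<noteq> 0" using R \<rho> by simp
  moreover have "s * (\<rho> / (2 * s)) = \<rho> / 2" if "s \<noteq> 0" for s using that by simp
  ultimately have \<delta>2: "(R + \<rho>) * \<delta> = \<rho> / 2" unfolding \<delta>_def by blast
  obtain A :: "(real^'n) set" where A: "finite A" "A \<subseteq> sphere 0 1" "\<And>w. w \<in> sphere 0 1 \<Longrightarrow> \<exists>a\<in>A. dist a w < \<delta>"
    using finite_net[OF compact_sphere \<delta>] by metis
  have "eventually (\<lambda>k. \<exists>b\<in>edom (us k). dist b (x + (R + \<rho>) *\<^sub>R a) < \<rho>/2) sequentially" if a: "a \<in> A" for a
  proof -
    have "x + (R + \<rho>) *\<^sub>R a \<in> cball x (R + \<rho>)" using a A(2) R \<rho>(1) by (auto simp: dist_norm)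
    then have "x + (R + \<rho>) *\<^sub>R a \<in> edom u" using \<rho>(2) by blast
    then obtain xs where xs: "xs \<longlonglongrightarrow> x + (R + \<rho>) *\<^sub>R a" "eventually (\<lambda>k. xs k \<in> edom (us k)) sequentially"
      using recovery by metis
    have "eventually (\<lambda>k. dist (xs k) (x + (R + \<rho>) *\<^sub>R a) < \<rho>/2) sequentially" using xs(1) \<rho>(1) by (intro tendstoD) auto
    with xs(2) show ?thesis by eventually_elim auto
  qed
  then have "eventually (\<lambda>k. \<forall>a\<in>A. \<exists>b\<in>edom (us k). dist b (x + (R + \<rho>) *\<^sub>R a) < \<rho>/2) sequentially"
    using A(1) by (intro eventually_ball_finite) auto
  then show ?thesis
  proof eventually_elim
    case (elim k)
    show ?case
    proof (rule subsetI, rule ccontr)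
      fix z assume z: "z \<in> cball x R" and zn: "z \<notin> interior (edom (us k))"
      obtain w where w: "norm w = 1" "\<And>y. y \<in> edom (us k) \<Longrightarrow> w \<bullet> y \<le> w \<bullet> z"
        using separate_from_convex[OF conv_cdL_facts(1)[OF us] zn] by metis
      obtain a where a: "a \<in> A" "dist a w < \<delta>" using A(3)[of w] w(1) by auto
      obtain b where b: "b \<in> edom (us k)" "dist b (x + (R + \<rho>) *\<^sub>R a) < \<rho>/2" using elim a(1) by blast
      have "w \<bullet> z = w \<bullet> x + w \<bullet> (z - x)" by (simp add: inner_diff_right)
      also have "w \<bullet> (z - x) \<le> R" using norm_cauchy_schwarz[of w "z - x"] w(1) z by (simp add: dist_norm norm_minus_commute)
      finally have 1: "w \<bullet> z \<le> w \<bullet> x + R" by simp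
      have "w \<bullet> (w - a) < \<delta>" using norm_cauchy_schwarz[of w "w - a"] w(1) a(2) by (simp add: dist_norm norm_minus_commute)
      then have "(R + \<rho>) * (w \<bullet> (w - a)) < (R + \<rho>) * \<delta>" using R \<rho>(1) by (intro mult_strict_left_mono) auto
      then have 2: "(R + \<rho>) * (w \<bullet> a) > R + \<rho> / 2" using \<delta>2 w(1) by (simp add: inner_diff_right dot_square_norm algebra_simps)
      have "w \<bullet> ((x + (R + \<rho>) *\<^sub>R a) - b) < \<rho> / 2"
        using norm_cauchy_schwarz[of w "(x + (R + \<rho>) *\<^sub>R a) - b"] w(1) b(2) by (simp add: dist_norm norm_minus_commute)
      then have "w \<bullet> b > w \<bullet> x + R" using 2 by (simp add: inner_diff_right inner_add_right)
      then show False using w(2)[OF b(1)] 1 by simp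
    qed
  qed
qed

lemma pointwise_convergence:
  assumes x: "x \<in> interior (edom u)"
  shows "(\<lambda>k. rfun (us k) x) \<longlonglongrightarrow> rfun u x"
proof -
  obtain R where R: "R > 0" "cball x R \<subseteq> interior (edom u)" using x open_interior open_contains_cball by blast
  obtain xs where xs: "xs \<longlonglongrightarrow> x" "(\<lambda>k. rfun (us k) (xs k)) \<longlonglongrightarrow> rfun u x"
    using recovery[of x] x interior_subset[of "edom u"] by (metis subsetD)
  have "eventually (\<lambda>k. dist (xs k) x < R) sequentially" by (rule tendstoD[OF xs(1) R(1)])
  then have "eventually (\<lambda>k. norm (rfun (us k) x - rfun (us k) (xs k)) \<le> M * dist (xs k) x) sequentially"
    using eventually_cball_in_domain[OF R(2,1)]
  proof eventually_elim
    case (elim k)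
    then have "x \<in> interior (edom (us k))" "xs k \<in> interior (edom (us k))" using R(1) by (auto simp: dist_commute)
    from lipschitz_onD[OF lip this] show ?case by (simp add: dist_real_def dist_commute)
  qed
  moreover have "(\<lambda>k. M * dist (xs k) x) \<longlonglongrightarrow> 0" using tendsto_mult_left[OF tendsto_dist[OF xs(1) tendsto_const[of x]], of M] by simp
  ultimately have "(\<lambda>k. rfun (us k) x - rfun (us k) (xs k)) \<longlonglongrightarrow> 0" by (rule Lim_null_comparison)
  from tendsto_add[OF this xs(2)] show ?thesis by simp
qed

lemma uniform_convergence:
  assumes x: "cball x R \<subseteq> interior (edom u)" and R: "R > 0" and \<delta>: "\<delta> > 0"
  shows "eventually (\<lambda>k. \<forall>z\<in>cball x R. \<bar>rfun (us k) z - rfun u z\<bar> \<le> \<delta>) sequentially"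
proof -
  obtain L where L: "L-lipschitz_on (interior (edom u)) (rfun u)" using u by (auto simp: conv_cdL_def)
  have L0: "0 \<le> L" by (rule lipschitz_on_nonneg[OF L])
  \<comment> \<open>Passing to a net point costs at most \<open>M * m\<close> for
    \<open>us k\<close> and \<open>L * m\<close> for \<open>u\<close>, together at most half of
    \<delta>; the other half is left for convergence on the net.\<close>
  define m where "m = \<delta> / (2 * (M + L + 1))"
  have m: "m > 0" using \<delta> M0 L0 by (simp add: m_def)
  have mL: "(M + L) * m \<le> \<delta>/2"
  proof -
    have "(M + L) * m \<le> (M + L + 1) * m" using m by (intro mult_right_mono) auto
    also have "\<dots> = \<delta> / 2" using M0 L0 unfolding m_def by (simp add: field_simps add_nonneg_eq_0_iff)
    finally show ?thesis .
  qed
  obtain A where A: "finite A" "A \<subseteq> cball x R" "\<And>z. z \<in> cball x R \<Longrightarrow> \<exists>a\<in>A. dist a z < m"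
    using finite_net[OF compact_cball m, of x R] by metis
  have "eventually (\<lambda>k. \<forall>a\<in>A. dist (rfun (us k) a) (rfun u a) < \<delta>/2) sequentially"
    using A(1)
  proof (rule eventually_ball_finite, intro ballI)
    fix a assume "a \<in> A"
    then have "a \<in> interior (edom u)" using A(2) x by blast
    then show "eventually (\<lambda>k. dist (rfun (us k) a) (rfun u a) < \<delta>/2) sequentially"
      using \<delta> by (intro tendstoD pointwise_convergence) auto
  qed
  then show ?thesis using eventually_cball_in_domain[OF x R]
  proof eventually_elim
    case (elim k)
    show ?case
    proof
      fix z assume z: "z \<in> cball x R"
      obtain a where a: "a \<in> A" "dist a z < m" using A(3)[OF z] by blast
      have aR: "a \<in> cball x R" using a A(2) by blast
      have "\<bar>rfun (us k) z - rfun (us k) a\<bar> \<le> M * dist z a"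
        using lipschitz_onD[OF lip subsetD[OF elim(2) z] subsetD[OF elim(2) aR]] by (simp add: dist_real_def)
      moreover have "\<bar>rfun u z - rfun u a\<bar> \<le> L * dist z a"
        using lipschitz_onD[OF L subsetD[OF x z] subsetD[OF x aR]] by (simp add: dist_real_def)
      moreover have "(M + L) * dist z a \<le> (M + L) * m" using a(2) M0 L0 by (intro mult_left_mono) (auto simp: dist_commute)
      moreover have "\<bar>rfun (us k) a - rfun u a\<bar> < \<delta>/2" using elim(1) a(1) by (simp add: dist_real_def)
      ultimately show "\<bar>rfun (us k) z - rfun u z\<bar> \<le> \<delta>" using mL unfolding distrib_right by linarith
    qed
  qed
qed

end

section \<open>Upper semicontinuity\<close>

locale concave_weight =
  fixes \<zeta> :: "real \<Rightarrow> real"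
  assumes nonneg: "\<And>t. 0 \<le> t \<Longrightarrow> 0 \<le> \<zeta> t"
    and conc: "concave_on {0..} \<zeta>"
    and lim0: "(\<zeta> \<longlongrightarrow> 0) (at_right 0)"
    and liminf: "((\<lambda>t. \<zeta> t / t) \<longlongrightarrow> 0) at_top"
begin

lemma concD: "0 \<le> t \<Longrightarrow> t \<le> 1 \<Longrightarrow> 0 \<le> x \<Longrightarrow> 0 \<le> y \<Longrightarrow> (1 - t) * \<zeta> x + t * \<zeta> y \<le> \<zeta> ((1 - t) * x + t * y)"
  using convex_onD[OF conc[unfolded concave_on_def], of t x y] by simp

text \<open>The hypothesis concerns the limit from the right only. Concavity on the closed half-line
  prevents \<zeta> from jumping up at 0, and nonnegativity prevents it from jumping down.\<close>

lemma zero: "\<zeta> 0 = 0"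
proof -
  have "((\<lambda>t. (1 - t) * \<zeta> 0) \<longlongrightarrow> (1 - 0) * \<zeta> 0) (at_right 0)" by (intro tendsto_intros)
  moreover have "\<forall>\<^sub>F t in at_right 0. (1 - t) * \<zeta> 0 \<le> \<zeta> t"
  proof -
    have "\<forall>\<^sub>F t in at_right (0::real). t < 1" "\<forall>\<^sub>F t in at_right (0::real). 0 < t"
      by (auto simp: eventually_at_filter intro: eventually_mono[OF eventually_nhds_in_open[of "{..<1}"]])
    then show ?thesis
    proof eventually_elim
      case (elim t)
      then have "0 \<le> t * \<zeta> 1" using nonneg[of 1] by simp
      moreover have "(1 - t) * \<zeta> 0 + t * \<zeta> 1 \<le> \<zeta> t" using concD[of t 0 1] elim by simp
      ultimately show ?case by linarith
    qed
  qed
  ultimately have "(1 - 0) * \<zeta> 0 \<le> 0" by (intro tendsto_le[OF _ lim0]) auto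
  then show ?thesis using nonneg[of 0] by simp
qed

text \<open>A decrease would have to continue until \<zeta> is negative: for a far point
  \<open>T\<close>, where \<zeta> is still nonnegative, concavity bounds \<open>\<zeta> t\<close>
  from below by nearly \<open>\<zeta> s\<close>.\<close>

lemma mono: assumes "0 \<le> s" "s \<le> t" shows "\<zeta> s \<le> \<zeta> t"
proof -
  have "\<zeta> s - \<zeta> t \<le> \<zeta> s / real (Suc n)" for n
  proof -
    let ?l = "1 / real (Suc n)"
    have l: "0 \<le> ?l" "?l \<le> 1" by auto
    define T where "T = s + real (Suc n) * (t - s)"
    have T: "0 \<le> T" using assms by (simp add: T_def)
    have "(1 - ?l) * s + ?l * T = t" by (simp add: T_def left_diff_distrib distrib_left del: of_nat_Suc)
    then have "(1 - ?l) * \<zeta> s + ?l * \<zeta> T \<le> \<zeta> t" using concD[OF l assms(1) T] by simp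
    moreover have "0 \<le> ?l * \<zeta> T" using l nonneg[OF T] by (rule_tac mult_nonneg_nonneg) auto
    ultimately show ?thesis by (simp add: left_diff_distrib)
  qed
  moreover have "(\<lambda>n. \<zeta> s / real (Suc n)) \<longlonglongrightarrow> 0" using LIMSEQ_Suc[OF lim_const_over_n[of "\<zeta> s"]] by simp
  ultimately have "\<zeta> s - \<zeta> t \<le> 0" by (intro LIMSEQ_le_const) auto
  then show ?thesis by simp
qed

text \<open>Since \<open>\<zeta> 0 = 0\<close>, chords from the origin lie below the graph, and both
  summands are compared with the chord to \<open>a + b\<close>.\<close>

lemma subadd: assumes "0 \<le> a" "0 \<le> b" shows "\<zeta> (a + b) \<le> \<zeta> a + \<zeta> b"
proof (cases "a + b = 0")
  case False
  define s where "s = a + b"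
  have s: "s > 0" using False assms by (simp add: s_def)
  have *: "c / s * \<zeta> s \<le> \<zeta> c" if "0 \<le> c" "c \<le> s" for c
    using concD[of "c / s" 0 s] that s by (simp add: zero)
  have "a / s * \<zeta> s + b / s * \<zeta> s \<le> \<zeta> a + \<zeta> b" using assms by (intro add_mono *) (auto simp: s_def)
  moreover have "a / s * \<zeta> s + b / s * \<zeta> s = \<zeta> s" using s by (simp add: distrib_right[symmetric] add_divide_distrib[symmetric] s_def[symmetric])
  ultimately show ?thesis by (simp add: s_def)
qed (use assms zero nonneg in \<open>auto simp: add_nonneg_eq_0_iff\<close>)

text \<open>The slope is the one from the right. Positivity of \<open>t\<close> matters: at 0 the
  graph of \<zeta> may be vertical. Monotonicity makes \<open>a\<close> nonnegative, so that an
  upper bound for an average of \<open>s\<close> can be inserted.\<close>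

lemma tangent:
  assumes t: "0 < t"
  obtains a where "0 \<le> a" "\<And>s. 0 \<le> s \<Longrightarrow> \<zeta> s \<le> \<zeta> t + a * (s - t)"
proof -
  define a where "a = - Inf ((\<lambda>s. ((- \<zeta>) t - (- \<zeta>) s) / (t - s)) ` ({t<..} \<inter> {0..}))"
  have tan: "\<zeta> s \<le> \<zeta> t + a * (s - t)" if "0 \<le> s" for s
    using convex_le_Inf_differential[OF conc[unfolded concave_on_def], of t s] t that
    by (simp add: a_def)
  have "0 \<le> a" using tan[of "t + 1"] mono[of t "t + 1"] t by simp
  then show ?thesis using tan by (rule that)
qed

lemma sublinear:
  assumes e: "0 < e"
  obtains C where "0 \<le> C" "\<And>t. 0 \<le> t \<Longrightarrow> \<zeta> t \<le> C + e * t"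
proof -
  have "\<forall>\<^sub>F t in at_top. \<zeta> t / t < e" using liminf e by (rule order_tendstoD)
  then obtain T where T: "\<And>t. t \<ge> T \<Longrightarrow> \<zeta> t / t < e" by (auto simp: eventually_at_top_linorder)
  define S where "S = max T 1"
  have S: "S \<ge> T" "S > 0" by (auto simp: S_def)
  show ?thesis
  proof (rule that[of "\<zeta> S"])
    show "0 \<le> \<zeta> S" using S by (intro nonneg) auto
    fix t :: real assume t: "0 \<le> t"
    show "\<zeta> t \<le> \<zeta> S + e * t"
    proof (cases "t \<le> S")
      case True
      then show ?thesis using mono[OF t True] e t by (simp add: add_increasing2)
    next
      case False
      then have "\<zeta> t < e * t" using T[of t] S by (simp add: pos_divide_less_eq)
      then show ?thesis using nonneg[of S] S by simp
    qed
  qed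
qed

lemma small:
  assumes "0 < e"
  obtains \<tau> where "0 < \<tau>" "\<zeta> \<tau> \<le> e"
proof -
  have "\<forall>\<^sub>F t in at_right 0. \<zeta> t < e" using lim0 assms by (rule order_tendstoD)
  then obtain b where "b > 0" "\<And>y. y > 0 \<Longrightarrow> y < b \<Longrightarrow> \<zeta> y < e" by (auto simp: eventually_at_right_field)
  then show ?thesis using that[of "b/2"] by (simp add: less_imp_le)
qed

lemma measurable_comp:
  assumes "f \<in> borel_measurable N" "\<And>x. 0 \<le> f x"
  shows "(\<lambda>x. \<zeta> (f x)) \<in> borel_measurable N"
proof -
  \<comment> \<open>Nothing is known about \<zeta> at negative arguments; clipping gives a monotone
    function on the whole line.\<close>
  have "(\<lambda>t. \<zeta> (max 0 t)) \<in> borel_measurable borel"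
    by (rule borel_measurable_mono) (auto intro!: monoI mono)
  from measurable_compose[OF assms(1) this] show ?thesis using assms(2) by simp
qed

end

section \<open>The determinant of the Hessian on the domain\<close>

lemma det_hess_props:
  assumes u: "conv_cdL u"
  shows "det_hess u \<in> borel_measurable lebesgue" "0 \<le> det_hess u x"
    "x \<notin> interior (edom u) \<Longrightarrow> det_hess u x = 0"
proof -
  show out: "det_hess u x = 0" if "x \<notin> interior (edom u)" for x
    using that by (simp add: det_hess_def has_hessian_at_def)
  obtain L where L: "L-lipschitz_on (interior (edom u)) (rfun u)" using u by (auto simp: conv_cdL_def)
  have "det_hess u \<in> borel_measurable lebesgue \<and> 0 \<le> det_hess u x"
  proof (cases "interior (edom u) = {}")
    case True
    then have "det_hess u = (\<lambda>x. 0)" using out by auto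
    then show ?thesis by simp
  next
    case False
    obtain v where v: "convex_lipschitz v L" "\<And>x. x \<in> interior (edom u) \<Longrightarrow> v x = rfun u x"
      using conv_cdL_extension[OF u L False] by metis
    note eq = det_hess_eq_hdet[OF v(2)]
    have [measurable]: "interior (edom u) \<in> sets lebesgue" by simp
    note [measurable] = hdet_measurable(2)[OF v(1)]
    have "(\<lambda>x. hdet v x * indicator (interior (edom u)) x) \<in> borel_measurable lebesgue" by measurable
    moreover have "(\<lambda>x. hdet v x * indicator (interior (edom u)) x) = det_hess u"
      by (auto simp: eq fun_eq_iff)
    moreover have "0 \<le> det_hess u x" using hdet_nonneg v(1) by (auto simp: eq convex_lipschitz_def)
    ultimately show ?thesis by simp
  qed
  then show "det_hess u \<in> borel_measurable lebesgue" "0 \<le> det_hess u x" by auto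
qed

lemma det_hess_integral_le:
  assumes v: "convex_lipschitz v M" "\<And>x. x \<in> interior (edom u) \<Longrightarrow> v x = rfun u x"
    and S: "S \<in> sets lebesgue" and W: "W \<in> lmeasurable" and sub: "\<And>x p. x \<in> S \<Longrightarrow> subgrad v x p \<Longrightarrow> p \<in> W"
  shows "(\<integral>\<^sup>+x\<in>S. ennreal (det_hess u x) \<partial>lebesgue) \<le> ennreal (measure lebesgue W)"
proof -
  have "(\<integral>\<^sup>+x\<in>S. ennreal (det_hess u x) \<partial>lebesgue) \<le> (\<integral>\<^sup>+x\<in>S. ennreal (hdet v x) \<partial>lebesgue)"
    by (intro nn_integral_mono mult_right_mono ennreal_leI) (use hdet_nonneg v(1) in \<open>auto simp: det_hess_eq_hdet[OF v(2)] convex_lipschitz_def\<close>)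
  also have "\<dots> \<le> ennreal (measure lebesgue W)" by (rule hdet_integral_le[OF v(1) S W sub])
  finally show ?thesis .
qed

lemma det_hess_total:
  fixes u :: "real^'n::finite \<Rightarrow> ereal"
  assumes u: "conv_cdL u" and lip: "M-lipschitz_on (interior (edom u)) (rfun u)" and S: "S \<in> sets lebesgue"
  shows "(\<integral>\<^sup>+x\<in>S. ennreal (det_hess u x) \<partial>lebesgue) \<le> ennreal (measure lebesgue (cball (0::real^'n) M))"
proof (cases "interior (edom u) = {}")
  case True
  then show ?thesis using det_hess_props(3)[OF u] by simp
next
  case False
  obtain v where v: "convex_lipschitz v M" "\<And>x. x \<in> interior (edom u) \<Longrightarrow> v x = rfun u x"
    using conv_cdL_extension[OF u lip False] by metis
  show ?thesis
    by (rule det_hess_integral_le[OF v S lmeasurable_cball])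
      (use subgrad_norm_le v(1) in \<open>auto simp: convex_lipschitz_def\<close>)
qed

section \<open>The energy as a measure\<close>

context concave_weight begin

definition Zm :: "(real^'n::finite \<Rightarrow> ereal) \<Rightarrow> (real^'n) measure" where
  "Zm u = density lebesgue (\<lambda>x. ennreal (\<zeta> (det_hess u x)))"

lemma sets_Zm [simp]: "sets (Zm u) = sets lebesgue" by (simp add: Zm_def)

lemma Zm_measurable:
  assumes "conv_cdL u" shows "(\<lambda>x. ennreal (\<zeta> (det_hess u x))) \<in> borel_measurable lebesgue"
  using measurable_comp[OF det_hess_props(1,2)[OF assms]] by measurable

lemma emeasure_Zm:
  assumes "conv_cdL u" "S \<in> sets lebesgue"
  shows "emeasure (Zm u) S = (\<integral>\<^sup>+x\<in>S. ennreal (\<zeta> (det_hess u x)) \<partial>lebesgue)"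
  unfolding Zm_def by (rule emeasure_density[OF Zm_measurable[OF assms(1)] assms(2)])

text \<open>Off the interior \<open>det_hess\<close> has the default value 0, and
  \<open>\<zeta> 0 = 0\<close>, so the boundary of the domain carries no energy.\<close>

lemma Zfun_eq_Zm:
  assumes u: "conv_cdL u" shows "Zfun \<zeta> u = emeasure (Zm u) (interior (edom u))"
proof -
  have "ennreal (\<zeta> (det_hess u x)) * indicator (edom u) x = ennreal (\<zeta> (det_hess u x)) * indicator (interior (edom u)) x" for x
  proof (cases "x \<in> interior (edom u)")
    case True
    then have "x \<in> edom u" using interior_subset by blast
    then show ?thesis using True by simp
  qed (simp add: det_hess_props(3)[OF u] zero)
  then show ?thesis unfolding Zfun_def by (subst emeasure_Zm[OF u]) auto
qed

text \<open>Uniform absolute continuity over all functions with Lipschitz constant \<open>M\<close>: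
  the slope \<open>e\<close> meets the fixed volume of the ball of gradients, and \<open>C\<close>
  meets only the volume of \<open>S\<close>.\<close>

lemma Zm_le:
  fixes u :: "real^'n::finite \<Rightarrow> ereal"
  assumes u: "conv_cdL u" and lip: "M-lipschitz_on (interior (edom u)) (rfun u)" and S: "S \<in> sets lebesgue"
    and C: "0 \<le> C" "0 \<le> e" "\<And>t. 0 \<le> t \<Longrightarrow> \<zeta> t \<le> C + e * t"
  shows "emeasure (Zm u) S \<le> ennreal C * emeasure lebesgue S + ennreal (e * measure lebesgue (cball (0::real^'n) M))"
proof -
  note [measurable] = det_hess_props(1)[OF u] S
  have "emeasure (Zm u) S \<le> (\<integral>\<^sup>+x. ennreal C * indicator S x + ennreal e * (ennreal (det_hess u x) * indicator S x) \<partial>lebesgue)"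
    unfolding emeasure_Zm[OF u S]
  proof (intro nn_integral_mono)
    fix x
    have d: "0 \<le> det_hess u x" by (rule det_hess_props(2)[OF u])
    have "ennreal (\<zeta> (det_hess u x)) \<le> ennreal (C + e * det_hess u x)" by (intro ennreal_leI C(3) d)
    also have "\<dots> = ennreal C + ennreal e * ennreal (det_hess u x)" using C(1,2) d by (simp add: ennreal_mult)
    finally show "ennreal (\<zeta> (det_hess u x)) * indicator S x \<le> ennreal C * indicator S x + ennreal e * (ennreal (det_hess u x) * indicator S x)"
      by (auto simp: indicator_def)
  qed
  also have "\<dots> = ennreal C * emeasure lebesgue S + ennreal e * (\<integral>\<^sup>+x. ennreal (det_hess u x) * indicator S x \<partial>lebesgue)"
    by (subst nn_integral_add) (auto simp: nn_integral_cmult nn_integral_cmult_indicator)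
  also have "\<dots> \<le> ennreal C * emeasure lebesgue S + ennreal e * ennreal (measure lebesgue (cball (0::real^'n) M))"
    by (intro add_left_mono mult_left_mono det_hess_total[OF u lip S]) auto
  finally show ?thesis using C by (simp add: ennreal_mult)
qed

text \<open>Jensen's inequality in the form of the tangent at \<open>t\<close>, integrated over
  \<open>B\<close>. Its slope is nonnegative, so the upper bound
  \<open>t * measure lebesgue B\<close> for the integral of the determinant is enough to cancel the
  linear term.\<close>

lemma Zm_Jensen:
  assumes u: "conv_cdL u" and v: "convex_lipschitz v M" "\<And>x. x \<in> interior (edom u) \<Longrightarrow> v x = rfun u x"
    and B: "B \<in> lmeasurable" and W: "W \<in> lmeasurable" and sub: "\<And>x p. x \<in> B \<Longrightarrow> subgrad v x p \<Longrightarrow> p \<in> W"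
    and t: "0 < t" and le: "measure lebesgue W \<le> t * measure lebesgue B"
  shows "emeasure (Zm u) B \<le> ennreal (\<zeta> t * measure lebesgue B)"
proof -
  obtain a where a: "0 \<le> a" "\<And>s. 0 \<le> s \<Longrightarrow> \<zeta> s \<le> \<zeta> t + a * (s - t)" using tangent[OF t] by metis
  have Bs[measurable]: "B \<in> sets lebesgue" using B by (rule fmeasurableD)
  note [measurable] = det_hess_props(1)[OF u] Zm_measurable[OF u]
  let ?b = "measure lebesgue B"
  have eb: "emeasure lebesgue B = ennreal ?b" using B by (rule emeasure_eq_measure2)
  have \<zeta>t: "0 \<le> \<zeta> t" using t by (intro nonneg) auto
  \<comment> \<open>Subtraction in \<open>ennreal\<close> is truncated, so the negative part of the
    tangent is carried on the left-hand side.\<close>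
  have "ennreal (a * t * ?b) + emeasure (Zm u) B
      = (\<integral>\<^sup>+x. ennreal (a * t) * indicator B x + ennreal (\<zeta> (det_hess u x)) * indicator B x \<partial>lebesgue)"
    using a t by (subst nn_integral_add) (auto simp: emeasure_Zm[OF u Bs] nn_integral_cmult_indicator eb ennreal_mult)
  also have "\<dots> \<le> (\<integral>\<^sup>+x. ennreal (\<zeta> t) * indicator B x + ennreal a * (ennreal (det_hess u x) * indicator B x) \<partial>lebesgue)"
  proof (intro nn_integral_mono)
    fix x
    have d: "0 \<le> det_hess u x" by (rule det_hess_props(2)[OF u])
    have "ennreal (a * t) + ennreal (\<zeta> (det_hess u x)) = ennreal (a * t + \<zeta> (det_hess u x))"
      using a t nonneg[OF d] by simp
    also have "\<dots> \<le> ennreal (\<zeta> t + a * det_hess u x)" using a(2)[OF d] by (intro ennreal_leI) (simp add: algebra_simps)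
    also have "\<dots> = ennreal (\<zeta> t) + ennreal a * ennreal (det_hess u x)" using a d \<zeta>t by (simp add: ennreal_mult)
    finally show "ennreal (a * t) * indicator B x + ennreal (\<zeta> (det_hess u x)) * indicator B x
       \<le> ennreal (\<zeta> t) * indicator B x + ennreal a * (ennreal (det_hess u x) * indicator B x)"
      by (auto simp: indicator_def)
  qed
  also have "\<dots> = ennreal (\<zeta> t * ?b) + ennreal a * (\<integral>\<^sup>+x. ennreal (det_hess u x) * indicator B x \<partial>lebesgue)"
    using \<zeta>t by (subst nn_integral_add) (auto simp: nn_integral_cmult nn_integral_cmult_indicator eb ennreal_mult)
  also have "\<dots> \<le> ennreal (\<zeta> t * ?b) + ennreal a * ennreal (t * ?b)"
    using le by (intro add_left_mono mult_left_mono order_trans[OF det_hess_integral_le[OF v Bs W sub]] ennreal_leI) auto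
  also have "ennreal a * ennreal (t * ?b) = ennreal (a * t * ?b)" using a t by (simp add: ennreal_mult'[symmetric] mult.assoc)
  finally have "ennreal (a * t * ?b) + emeasure (Zm u) B \<le> ennreal (a * t * ?b) + ennreal (\<zeta> t * ?b)" by (simp add: add.commute)
  then show ?thesis by (simp add: ennreal_add_left_cancel_le)
qed

lemma Zfun_finite:
  fixes u :: "real^'n::finite \<Rightarrow> ereal"
  assumes u: "conv_cdL u" shows "Zfun \<zeta> u < \<infinity>"
proof -
  obtain L where L: "L-lipschitz_on (interior (edom u)) (rfun u)" using u by (auto simp: conv_cdL_def)
  obtain C where C: "0 \<le> C" "\<And>t. 0 \<le> t \<Longrightarrow> \<zeta> t \<le> C + 1 * t" using sublinear[of 1] by auto
  have "bounded (interior (edom u))"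
    using conv_cdL_facts(2)[OF u] compact_imp_bounded bounded_interior by blast
  then have "interior (edom u) \<in> lmeasurable" by (intro lmeasurable_open) auto
  then have fin: "emeasure lebesgue (interior (edom u)) < \<infinity>"
    using fmeasurableD2 by (auto simp: less_top)
  have "Zfun \<zeta> u \<le> ennreal C * emeasure lebesgue (interior (edom u)) + ennreal (1 * measure lebesgue (cball (0::real^'n) L))"
    unfolding Zfun_eq_Zm[OF u] by (rule Zm_le[OF u L _ C(1) _ C(2)]) auto
  also have "\<dots> < \<infinity>" using fin by (simp add: ennreal_mult_less_top)
  finally show ?thesis .
qed

text \<open>On such a ball Jensen's inequality bounds the energy of every function close to \<open>u\<close> by the energy of
  \<open>u\<close> plus \<open>e\<close> times the volume.\<close>

definition good_ball :: "(real^'n::finite \<Rightarrow> ereal) \<Rightarrow> real \<Rightarrow> real^'n \<Rightarrow> real \<Rightarrow> bool" where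
  "good_ball u e x r \<longleftrightarrow> cball x (2*r) \<subseteq> interior (edom u) \<and>
    (\<exists>t>0. \<exists>\<delta>>0. \<exists>W\<in>lmeasurable. measure lebesgue W \<le> t * measure lebesgue (cball x r) \<and>
      ennreal (\<zeta> t * measure lebesgue (cball x r)) \<le> emeasure (Zm u) (cball x r) + ennreal (e * measure lebesgue (cball x r)) \<and>
      (\<forall>w. (\<forall>z\<in>cball x (2*r). \<bar>w z - rfun u z\<bar> \<le> \<delta>) \<longrightarrow> (\<forall>y\<in>cball x r. \<forall>p. subgrad w y p \<longrightarrow> p \<in> W)))"

text \<open>Almost every point has a second order expansion and satisfies the lower Lebesgue
  estimate for the energy density of \<open>u\<close>. Half of \<open>e\<close> covers the error of
  that estimate, the other half the excess \<tau>, since \<zeta> is subadditive.\<close>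

lemma AE_good_ball:
  assumes u: "conv_cdL u" and e: "e > 0"
  shows "AE x in lebesgue. x \<in> interior (edom u) \<longrightarrow> (\<forall>d>0. \<exists>r. 0 < r \<and> r < d \<and> good_ball u e x r)"
proof (cases "interior (edom u) = {}")
  case True
  then show ?thesis by simp
next
  case False
  obtain L where L: "L-lipschitz_on (interior (edom u)) (rfun u)" using u by (auto simp: conv_cdL_def)
  obtain v where v: "convex_lipschitz v L" "\<And>x. x \<in> interior (edom u) \<Longrightarrow> v x = rfun u x"
    using conv_cdL_extension[OF u L False] by metis
  have cv: "convex_on UNIV v" using v(1) by (simp add: convex_lipschitz_def)
  obtain \<tau> where \<tau>: "0 < \<tau>" "\<zeta> \<tau> \<le> e/2" using small[of "e/2"] e by auto
  have "AE x in lebesgue. \<forall>e>0. \<exists>\<rho>>0. \<forall>r. 0 < r \<and> r < \<rho> \<longrightarrow> (\<forall>S\<in>sets lebesgue. S \<subseteq> cball x r \<longrightarrow>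
             ennreal (\<zeta> (det_hess u x) * measure lebesgue S - e * measure lebesgue (cball x r)) \<le> emeasure (density lebesgue (\<lambda>y. ennreal (\<zeta> (det_hess u y)))) S)"
    by (rule AE_Lebesgue_lower) (use measurable_comp[OF det_hess_props(1,2)[OF u]] nonneg[OF det_hess_props(2)[OF u]] in auto)
  then show ?thesis using AE_twice_diff[OF v(1)]
  proof eventually_elim
    case (elim x)
    show ?case
    proof (intro impI allI)
      fix d :: real assume x: "x \<in> interior (edom u)" and d: "0 < d"
      obtain \<rho>1 where \<rho>1: "\<rho>1 > 0" "\<And>r S. 0 < r \<Longrightarrow> r < \<rho>1 \<Longrightarrow> S\<in>sets lebesgue \<Longrightarrow> S \<subseteq> cball x r \<Longrightarrow>
         ennreal (\<zeta> (det_hess u x) * measure lebesgue S - e/2 * measure lebesgue (cball x r)) \<le> emeasure (Zm u) S"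
        using elim(1)[rule_format, of "e/2"] e unfolding Zm_def by auto
      obtain g where g: "taylor2 v x g (hess_mat v x)" using elim(2) by (auto simp: twice_diff_def)
      have dx: "det_hess u x = det (hess_mat v x)" using x elim(2) by (simp add: det_hess_eq_hdet[OF v(2)] hdet_def)
      have d0: "0 \<le> det_hess u x" by (rule det_hess_props(2)[OF u])
      obtain \<rho>2 where \<rho>2: "\<rho>2 > 0" "\<And>r. 0 < r \<Longrightarrow> r < \<rho>2 \<Longrightarrow> (\<exists>\<delta>>0. \<exists>W\<in>lmeasurable. measure lebesgue W \<le> (det (hess_mat v x) + \<tau>) * measure lebesgue (cball x r) \<and>
         (\<forall>w. (\<forall>z\<in>cball x (2*r). \<bar>w z - v z\<bar> \<le> \<delta>) \<longrightarrow> (\<forall>y\<in>cball x r. \<forall>p. subgrad w y p \<longrightarrow> p \<in> W)))"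
        using subgrad_image_small[OF g transpose_hess_mat det_psd_nonneg[OF taylor2_psd[OF g cv]] \<tau>(1)] by auto
      obtain R where R: "R > 0" "cball x R \<subseteq> interior (edom u)" using x open_interior open_contains_cball by blast
      define r where "r = min (min d \<rho>1) (min \<rho>2 R) / 2"
      have r: "0 < r" "r < d" "r < \<rho>1" "r < \<rho>2" "2 * r \<le> R" using d \<rho>1(1) \<rho>2(1) R(1) by (auto simp: r_def)
      have sub: "cball x (2*r) \<subseteq> interior (edom u)" using R(2) subset_cball[OF r(5), of x] by blast
      let ?b = "measure lebesgue (cball x r)" and ?t = "det_hess u x + \<tau>"
      obtain \<delta> W where W: "\<delta> > 0" "W \<in> lmeasurable" "measure lebesgue W \<le> ?t * ?b"
          "\<And>w y p. (\<forall>z\<in>cball x (2*r). \<bar>w z - v z\<bar> \<le> \<delta>) \<Longrightarrow> y\<in>cball x r \<Longrightarrow> subgrad w y p \<Longrightarrow> p \<in> W"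
        using \<rho>2(2)[OF r(1,4)] unfolding dx by metis
      have "\<zeta> ?t * ?b \<le> (\<zeta> (det_hess u x) + \<zeta> \<tau>) * ?b" using subadd[OF d0, of \<tau>] \<tau>(1) by (intro mult_right_mono) auto
      also have "\<dots> \<le> (\<zeta> (det_hess u x) + e/2) * ?b" using \<tau>(2) by (intro mult_right_mono) auto
      also have "\<dots> = (\<zeta> (det_hess u x) * ?b - e/2 * ?b) + e * ?b" by (simp add: algebra_simps)
      finally have "ennreal (\<zeta> ?t * ?b) \<le> ennreal ((\<zeta> (det_hess u x) * ?b - e/2 * ?b) + e * ?b)" by (rule ennreal_leI)
      \<comment> \<open>The difference may be negative, in which case \<open>ennreal\<close> maps it
        to 0, so the two signs are treated apart.\<close>
      also have "\<dots> \<le> ennreal (\<zeta> (det_hess u x) * ?b - e/2 * ?b) + ennreal (e * ?b)"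
      proof (cases "0 \<le> \<zeta> (det_hess u x) * ?b - e/2 * ?b")
        case True
        then show ?thesis using e by (subst ennreal_plus) auto
      next
        case False
        then have "(\<zeta> (det_hess u x) * ?b - e/2 * ?b) + e * ?b \<le> e * ?b" by simp
        then have "ennreal ((\<zeta> (det_hess u x) * ?b - e/2 * ?b) + e * ?b) \<le> ennreal (e * ?b)" by (rule ennreal_leI)
        also have "\<dots> \<le> ennreal (\<zeta> (det_hess u x) * ?b - e/2 * ?b) + ennreal (e * ?b)" by (rule add_increasing) auto
        finally show ?thesis .
      qed
      also have "\<dots> \<le> emeasure (Zm u) (cball x r) + ennreal (e * ?b)"
        by (intro add_right_mono \<rho>1(2)[OF r(1,3)]) auto
      finally have "ennreal (\<zeta> ?t * ?b) \<le> emeasure (Zm u) (cball x r) + ennreal (e * ?b)" .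
      moreover have "p \<in> W" if w: "\<forall>z\<in>cball x (2*r). \<bar>w z - rfun u z\<bar> \<le> \<delta>" and y: "y\<in>cball x r" and p: "subgrad w y p" for w y p
        by (rule W(4)[OF _ y p]) (use w sub v(2) in auto)
      moreover have "0 < ?t" using d0 \<tau>(1) by simp
      ultimately have "good_ball u e x r"
        unfolding good_ball_def using sub W(1-3) by blast
      then show "\<exists>r. 0 < r \<and> r < d \<and> good_ball u e x r" using r by blast
    qed
  qed
qed

text \<open>Vitali's theorem gives countably many balls, of which finitely many already carry almost
  the whole volume. The frontier of the convex domain is null, so nothing is lost there.\<close>

lemma good_family:
  fixes u :: "real^'n::finite \<Rightarrow> ereal"
  assumes u: "conv_cdL u" and e: "e > 0" and \<delta>: "\<delta> > 0"
  obtains F where "finite F" "\<And>p. p \<in> F \<Longrightarrow> 0 < snd p \<and> good_ball u e (fst p) (snd p)"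
    "disjoint_family_on (\<lambda>p. cball (fst p) (snd p)) F"
    "measure lebesgue (edom u) - \<delta> < measure lebesgue (\<Union>p\<in>F. cball (fst p) (snd p))"
proof -
  let ?U = "interior (edom u)" and ?B = "\<lambda>p::(real^'n)\<times>real. cball (fst p) (snd p)"
  obtain N where N: "negligible N" "{x. \<not> (x \<in> ?U \<longrightarrow> (\<forall>d>0. \<exists>r. 0 < r \<and> r < d \<and> good_ball u e x r))} \<subseteq> N"
    using AE_good_ball[OF u e] unfolding eventually_ae_filter_negligible by blast
  have ex: "\<exists>r. 0 < r \<and> r < d \<and> good_ball u e x r" if "x \<in> ?U - N" "0 < d" for x d
    using that N(2) by blast
  obtain C where C: "countable C" "\<And>x r. (x, r) \<in> C \<Longrightarrow> x \<in> ?U - N \<and> 0 < r \<and> good_ball u e x r \<and> cball x r \<subseteq> ?U"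
    "disjoint_family_on ?B C" "negligible (?U - N - (\<Union>p\<in>C. ?B p))"
    by (rule Vitali_centered_cballs[where P="good_ball u e", OF open_interior Diff_subset ex]) (assumption | rule that)+
  have C2: "0 < snd p" "good_ball u e (fst p) (snd p)" "?B p \<subseteq> ?U" if "p \<in> C" for p
    using C(2)[of "fst p" "snd p"] that by auto
  have K: "compact (edom u)" "convex (edom u)" by (rule conv_cdL_facts[OF u])+
  have Kl: "edom u \<in> lmeasurable" using K(1) by (rule lmeasurable_compact)
  have Ul: "?U \<in> lmeasurable" using compact_imp_bounded[OF K(1)] by (intro lmeasurable_open bounded_interior) auto
  have bound: "measure lebesgue (\<Union>p\<in>I. ?B p) \<le> measure lebesgue ?U" if "I \<subseteq> C" "finite I" for I
    using that C2(3) Ul by (intro measure_mono_fmeasurable UN_least sets.finite_UN) auto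
  have W: "(\<Union>p\<in>C. ?B p) \<in> lmeasurable" by (rule fmeasurable_UN_bound[OF C(1) _ bound]) auto
  have "measure lebesgue (edom u) \<le> measure lebesgue (\<Union>p\<in>C. ?B p)"
  proof -
    let ?N = "frontier (edom u) \<union> N \<union> (?U - N - (\<Union>p\<in>C. ?B p))"
    have n: "negligible ?N" using N(1) C(4) negligible_convex_frontier[OF K(2)] by (intro negligible_Un)
    have "edom u \<subseteq> (\<Union>p\<in>C. ?B p) \<union> ?N" using closure_subset[of "edom u"] by (auto simp: frontier_def)
    then have "measure lebesgue (edom u) \<le> measure lebesgue ((\<Union>p\<in>C. ?B p) \<union> ?N)"
      by (intro measure_mono_fmeasurable fmeasurableD[OF Kl] fmeasurable.Un[OF W negligible_imp_measurable[OF n]])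
    also have "\<dots> \<le> measure lebesgue (\<Union>p\<in>C. ?B p) + measure lebesgue ?N"
      by (intro measure_Un_le fmeasurableD W negligible_imp_measurable n)
    finally show ?thesis using negligible_imp_measure0[OF n] by simp
  qed
  moreover obtain D where D: "D \<subseteq> ?B ` C" "finite D" "measure lebesgue (\<Union>(?B ` C)) - \<delta> < measure lebesgue (\<Union>D)"
  proof (rule measure_countable_Union_approachable[of "?B ` C" \<delta> "measure lebesgue ?U"])
    show "measure lebesgue (\<Union>D') \<le> measure lebesgue ?U" if D': "D' \<subseteq> ?B ` C" "finite D'" for D'
    proof -
      obtain I where "I \<subseteq> C" "finite I" "D' = ?B ` I" using finite_subset_image[OF D'(2,1)] by blast
      then show ?thesis using bound[of I] by simp
    qed
  qed (use C(1) \<delta> in auto)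
  moreover obtain F where F: "F \<subseteq> C" "finite F" "D = ?B ` F" using finite_subset_image[OF D(2,1)] by blast
  ultimately have "measure lebesgue (edom u) - \<delta> < measure lebesgue (\<Union>p\<in>F. ?B p)" by simp
  moreover have "disjoint_family_on ?B F" using F(1) C(3) by (rule disjoint_family_on_mono)
  ultimately show ?thesis using F C2 by (intro that[of F]) auto
qed

text \<open>Budget: \<open>E/2\<close> for the good balls, and for the remainder \<open>E/4\<close>
  for its volume and \<open>E/4\<close> for its gradient mass. The remainder is small because the
  balls nearly fill the limit domain, while the domain of \<open>us k\<close> cannot have much more
  volume than the limit domain.\<close>

lemma eventually_Zfun_le:
  fixes us :: "nat \<Rightarrow> real^'n::finite \<Rightarrow> ereal"
  assumes "epi_seq us u M" and E: "0 < E"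
  shows "eventually (\<lambda>k. Zfun \<zeta> (us k) \<le> Zfun \<zeta> u + ennreal E) sequentially"
proof -
  interpret epi_seq us u M by fact
  let ?K = "edom u" and ?B = "\<lambda>p::(real^'n)\<times>real. cball (fst p) (snd p)"
  let ?\<kappa> = "measure lebesgue ?K" and ?\<omega> = "measure lebesgue (cball (0::real^'n) M)"
  have K: "compact ?K" "convex ?K" "?K \<noteq> {}" by (rule conv_cdL_facts[OF u])+
  have cancel: "E / (c * (x + 1)) * (x + 1) = E / c" if "0 \<le> x" for c x :: real
  proof -
    define y where "y = x + 1"
    have "y \<noteq> 0" using that by (simp add: y_def)
    then show ?thesis unfolding y_def[symmetric] by simp
  qed
  define e where "e = E / (2 * (?\<kappa> + 1))"
  have e: "0 < e" using E by (simp add: e_def add_nonneg_pos)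
  have e\<kappa>: "e * ?\<kappa> \<le> E / 2"
  proof -
    have "e * ?\<kappa> \<le> e * (?\<kappa> + 1)" using e by (intro mult_left_mono) auto
    also have "\<dots> = E / 2" unfolding e_def by (rule cancel) simp
    finally show ?thesis .
  qed
  define e2 where "e2 = E / (4 * (?\<omega> + 1))"
  have e2: "0 < e2" using E by (simp add: e2_def add_nonneg_pos)
  have e2\<omega>: "e2 * ?\<omega> \<le> E / 4"
  proof -
    have "e2 * ?\<omega> \<le> e2 * (?\<omega> + 1)" using e2 by (intro mult_left_mono) auto
    also have "\<dots> = E / 4" unfolding e2_def by (rule cancel) simp
    finally show ?thesis .
  qed
  \<comment> \<open>The order of choices matters: \<open>e2\<close> depends on \<open>E\<close> and
    \<open>M\<close> only, \<open>C\<close> on \<open>e2\<close>, and \<delta> on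
    \<open>C\<close>.\<close>
  obtain C where C: "0 \<le> C" "\<And>t. 0 \<le> t \<Longrightarrow> \<zeta> t \<le> C + e2 * t" using sublinear[OF e2] by metis
  define \<delta> where "\<delta> = E / (4 * (C + 1))"
  have \<delta>: "0 < \<delta>" using E C by (simp add: \<delta>_def)
  have C\<delta>: "C * \<delta> \<le> E / 4"
  proof -
    have "C * \<delta> \<le> (C + 1) * \<delta>" using \<delta> by (intro mult_right_mono) auto
    also have "\<dots> = E / 4" unfolding \<delta>_def by (subst mult.commute, rule cancel) (rule C)
    finally show ?thesis .
  qed
  obtain F where F: "finite F" "\<And>p. p \<in> F \<Longrightarrow> 0 < snd p \<and> good_ball u e (fst p) (snd p)" "disjoint_family_on ?B F"
      "?\<kappa> - \<delta>/2 < measure lebesgue (\<Union>p\<in>F. ?B p)"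
    using good_family[OF u e, of "\<delta>/2"] \<delta> by auto
  let ?W = "\<Union>p\<in>F. ?B p"
  have Wl: "?W \<in> lmeasurable" using F(1) by (intro fmeasurable.finite_UN) auto
  have Bsub: "?B p \<subseteq> cball (fst p) (2 * snd p)" "cball (fst p) (2 * snd p) \<subseteq> interior ?K" if "p \<in> F" for p
    using F(2)[OF that] by (auto simp: good_ball_def)
  \<comment> \<open>Since the convex limit domain has a null frontier, thin neighbourhoods add
    little volume; this is how closeness of the domains becomes a bound for their volume.\<close>
  obtain d where d: "d > 0" "\<And>T. T \<in> lmeasurable \<Longrightarrow> (\<And>y. y \<in> T \<Longrightarrow> \<exists>x. x \<in> ?K \<and> dist x y < d) \<Longrightarrow> measure lebesgue T < ?\<kappa> + \<delta>/2"
    using measure_semicontinuous_with_hausdist_explicit[OF compact_imp_bounded[OF K(1)] negligible_convex_frontier[OF K(2)], of "\<delta>/2"] \<delta> by (metis half_gt_zero)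
  have ev1: "eventually (\<lambda>k. \<forall>x\<in>interior (edom (us k)). infdist x ?K < d) sequentially"
    by (rule eventually_near_domain[OF d(1)])
  have ev2: "eventually (\<lambda>k. \<forall>p\<in>F. cball (fst p) (2 * snd p) \<subseteq> interior (edom (us k))) sequentially"
    using F(1)
  proof (rule eventually_ball_finite, intro ballI)
    fix p assume p: "p \<in> F"
    show "eventually (\<lambda>k. cball (fst p) (2 * snd p) \<subseteq> interior (edom (us k))) sequentially"
      using Bsub(2)[OF p] F(2)[OF p] by (intro eventually_cball_in_domain) auto
  qed
  have ev3: "eventually (\<lambda>k. \<forall>p\<in>F. emeasure (Zm (us k)) (?B p) \<le> emeasure (Zm u) (?B p) + ennreal (e * measure lebesgue (?B p))) sequentially"
    using F(1)
  proof (rule eventually_ball_finite, intro ballI)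
    fix p assume p: "p \<in> F"
    have r: "0 < snd p" and g: "good_ball u e (fst p) (snd p)" using F(2)[OF p] by auto
    obtain t \<eta> W where W: "t > 0" "\<eta> > 0" "W \<in> lmeasurable" "measure lebesgue W \<le> t * measure lebesgue (?B p)"
        "ennreal (\<zeta> t * measure lebesgue (?B p)) \<le> emeasure (Zm u) (?B p) + ennreal (e * measure lebesgue (?B p))"
        "\<And>w y q. (\<forall>z\<in>cball (fst p) (2 * snd p). \<bar>w z - rfun u z\<bar> \<le> \<eta>) \<Longrightarrow> y \<in> ?B p \<Longrightarrow> subgrad w y q \<Longrightarrow> q \<in> W"
      using g unfolding good_ball_def by metis
    have "eventually (\<lambda>k. cball (fst p) (2 * snd p) \<subseteq> interior (edom (us k))) sequentially"
      using Bsub(2)[OF p] r by (intro eventually_cball_in_domain) auto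
    moreover have "eventually (\<lambda>k. \<forall>z\<in>cball (fst p) (2 * snd p). \<bar>rfun (us k) z - rfun u z\<bar> \<le> \<eta>) sequentially"
      using Bsub(2)[OF p] r W(2) by (intro uniform_convergence) auto
    ultimately show "eventually (\<lambda>k. emeasure (Zm (us k)) (?B p) \<le> emeasure (Zm u) (?B p) + ennreal (e * measure lebesgue (?B p))) sequentially"
    proof eventually_elim
      case (elim k)
      have "fst p \<in> cball (fst p) (2 * snd p)" using r by simp
      then have "interior (edom (us k)) \<noteq> {}" using elim(1) by blast
      then obtain v where v: "convex_lipschitz v M" "\<And>x. x \<in> interior (edom (us k)) \<Longrightarrow> v x = rfun (us k) x"
        using conv_cdL_extension[OF us lip] by metis
      have "\<forall>z\<in>cball (fst p) (2 * snd p). \<bar>v z - rfun u z\<bar> \<le> \<eta>"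
        using elim(2) v(2) subsetD[OF elim(1)] by simp
      then have "q \<in> W" if "y \<in> ?B p" "subgrad v y q" for y q using W(6) that by blast
      then have "emeasure (Zm (us k)) (?B p) \<le> ennreal (\<zeta> t * measure lebesgue (?B p))"
        by (intro Zm_Jensen[OF us v lmeasurable_cball W(3) _ W(1) W(4)]) auto
      also note W(5)
      finally show ?case .
    qed
  qed
  from ev1 ev2 ev3 show ?thesis
  proof eventually_elim
    case (elim k)
    let ?V = "interior (edom (us k))"
    have Vb: "bounded ?V" using conv_cdL_facts(2)[OF us[of k]] by (intro bounded_interior compact_imp_bounded)
    have Vl: "?V \<in> lmeasurable" using Vb by (intro lmeasurable_open) auto
    have mV: "measure lebesgue ?V < ?\<kappa> + \<delta>/2"
    proof (rule d(2)[OF Vl])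
      fix y assume y: "y \<in> ?V"
      obtain x where "x \<in> ?K" "infdist y ?K = dist y x"
        using infdist_attains_inf[OF compact_imp_closed[OF K(1)] K(3), of y] by metis
      then show "\<exists>x. x \<in> ?K \<and> dist x y < d" using elim(1) y by (intro exI[of _ x]) (auto simp: dist_commute)
    qed
    have WV: "?W \<subseteq> ?V" using Bsub(1) elim(2) by (intro UN_least) blast
    have WU: "?W \<subseteq> interior ?K" using Bsub by (intro UN_least) blast
    have Ws: "?W \<in> sets lebesgue" and Vs: "?V \<in> sets lebesgue" using Wl Vl by auto
    have "measure lebesgue (?V - ?W) = measure lebesgue ?V - measure lebesgue ?W"
      using WV Vl Wl by (intro measurable_measure_Diff) auto
    then have "measure lebesgue (?V - ?W) \<le> \<delta>" using mV F(4) by simp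
    then have A: "emeasure lebesgue (?V - ?W) \<le> ennreal \<delta>"
      using fmeasurable.Diff[OF Vl Wl] by (simp add: emeasure_eq_measure2 ennreal_leI)
    have "Zfun \<zeta> (us k) = emeasure (Zm (us k)) ?W + emeasure (Zm (us k)) (?V - ?W)"
      unfolding Zfun_eq_Zm[OF us] using WV Ws Vs by (subst plus_emeasure) (auto simp: Un_absorb1)
    also have "emeasure (Zm (us k)) ?W \<le> emeasure (Zm u) ?W + ennreal (e * measure lebesgue ?W)"
    proof -
      have pw: "pairwise (\<lambda>p q. disjnt (?B p) (?B q)) F"
        unfolding pairwise_def disjnt_def using F(3) unfolding disjoint_family_on_def by blast
      have "emeasure (Zm (us k)) ?W = (\<Sum>p\<in>F. emeasure (Zm (us k)) (?B p))"
        using F(1,3) by (intro sum_emeasure[symmetric]) auto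
      also have "\<dots> \<le> (\<Sum>p\<in>F. emeasure (Zm u) (?B p) + ennreal (e * measure lebesgue (?B p)))"
        using elim(3) by (intro sum_mono) auto
      also have "\<dots> = (\<Sum>p\<in>F. emeasure (Zm u) (?B p)) + ennreal (e * (\<Sum>p\<in>F. measure lebesgue (?B p)))"
        using e by (simp add: sum.distrib sum_distrib_left sum_ennreal)
      also have "(\<Sum>p\<in>F. emeasure (Zm u) (?B p)) = emeasure (Zm u) ?W"
        using F(1,3) by (intro sum_emeasure) auto
      also have "(\<Sum>p\<in>F. measure lebesgue (?B p)) = measure lebesgue ?W"
        using F(1) pw by (intro measure_UNION'[symmetric]) auto
      finally show ?thesis .
    qed
    also have "emeasure (Zm u) ?W \<le> Zfun \<zeta> u"
      unfolding Zfun_eq_Zm[OF u] using WU by (intro emeasure_mono) auto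
    also have "ennreal (e * measure lebesgue ?W) \<le> ennreal (E / 2)"
    proof (rule ennreal_leI)
      have "measure lebesgue ?W \<le> ?\<kappa>"
        using WU interior_subset[of ?K] Ws lmeasurable_compact[OF K(1)] by (intro measure_mono_fmeasurable) auto
      then have "e * measure lebesgue ?W \<le> e * ?\<kappa>" using e by (intro mult_left_mono) auto
      then show "e * measure lebesgue ?W \<le> E / 2" using e\<kappa> by simp
    qed
    also have "emeasure (Zm (us k)) (?V - ?W) \<le> ennreal (E / 2)"
    proof -
      have "emeasure (Zm (us k)) (?V - ?W) \<le> ennreal C * emeasure lebesgue (?V - ?W) + ennreal (e2 * ?\<omega>)"
        using Vs Ws e2 by (intro Zm_le[OF us lip _ C(1) _ C(2)]) auto
      also have "\<dots> \<le> ennreal C * ennreal \<delta> + ennreal (e2 * ?\<omega>)" using A by (intro add_right_mono mult_left_mono) auto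
      also have "\<dots> = ennreal (C * \<delta> + e2 * ?\<omega>)" using C(1) \<delta> e2 by (simp add: ennreal_mult)
      also have "\<dots> \<le> ennreal (E / 2)" using C\<delta> e2\<omega> by (intro ennreal_leI) simp
      finally show ?thesis .
    qed
    finally have "Zfun \<zeta> (us k) \<le> Zfun \<zeta> u + ennreal (E / 2) + ennreal (E / 2)" by (simp add: add_mono)
    also have "\<dots> = Zfun \<zeta> u + ennreal E" using E by (simp add: add.assoc ennreal_plus[symmetric] del: ennreal_plus)
    finally show ?case .
  qed
qed

end

theorem theorem1p1:
  fixes \<zeta> :: "real \<Rightarrow> real"
  assumes nonneg: "\<forall>t\<ge>0. \<zeta> t \<ge> 0"
    and conc: "concave_on {0..} \<zeta>"
    and lim0: "(\<zeta> \<longlongrightarrow> 0) (at_right 0)"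
    and liminf: "((\<lambda>t. \<zeta> t / t) \<longlongrightarrow> 0) at_top"
  shows "(\<forall>u::real^'n::finite \<Rightarrow> ereal. conv_cdL u \<longrightarrow> Zfun \<zeta> u < \<infinity>) \<and>
    (\<forall>(us::nat \<Rightarrow> real^'n \<Rightarrow> ereal) u M.
       (\<forall>k. conv_cdL (us k)) \<and> conv_cdL u \<and> epi_converges us u \<and> M > 0 \<and>
       (\<forall>k. M-lipschitz_on (interior (edom (us k))) (\<lambda>x. real_of_ereal (us k x)))
       \<longrightarrow> limsup (\<lambda>k. Zfun \<zeta> (us k)) \<le> Zfun \<zeta> u)"
proof -
  interpret concave_weight \<zeta> using assms by unfold_locales auto
  have "limsup (\<lambda>k. Zfun \<zeta> (us k)) \<le> Zfun \<zeta> u"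
    if "epi_seq us u M" for us :: "nat \<Rightarrow> real^'n \<Rightarrow> ereal" and u M
  proof (rule ennreal_le_epsilon)
    fix E :: real assume "0 < E"
    then show "limsup (\<lambda>k. Zfun \<zeta> (us k)) \<le> Zfun \<zeta> u + ennreal E"
      using eventually_Zfun_le[OF that] by (intro Limsup_bounded)
  qed
  then show ?thesis using Zfun_finite by (auto simp: epi_seq_def)
qed

end
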